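(* (1) The sets $\mathcal L_{r,s}$ ($r\in\mathbb N_{>0}$, $s\in\mathbb S$) are pairwise disjoint and the set $\mathcal L$ of all lattices in $\mathrm{Osc}_{1,0}$ is their disjoint union: $\mathcal L=\coprod_{r=1}^\infty\coprod_{s\in\mathbb S}\mathcal L_{r,s}$. (2) For all $r\in\mathbb N_{>0}$ and $s\in\mathbb S$, the map $\mathcal P_{r,s}\to\mathcal L_{r,s}$, $(\eta,P,z,\xi)\mapsto L_{r,s}(\eta,P,z,\xi)$, induces a bijection $$\mathcal P_{r,s}/(\Gamma_r\rtimes\mathcal B_r)\longrightarrow\mathcal L_{r,s}.$$
   Context: Let $\omega(\xi,\xi')=xy'-x'y$ for $\xi=(x,y),\xi'=(x',y')\in\mathbb R^2$. The Heisenberg group is $H=\mathbb R\times\mathbb R^2$ with $(z,\xi)(z',\xi')=(z+z'+\tfrac12\omega(\xi,\xi'),\xi+\xi')$. For $P\in\mathrm{GL}(2,\mathbb R)$ and $\eta\in\mathbb R^2$ define automorphisms of $H$ by $\bar F_P(z,\xi)=(\det(P)z,P\xi)$ and $\bar F_\eta(z,\xi)=(z+\omega(\eta,\xi),\xi)$; this identifies $\mathrm{Aut}(H)$ with $\mathbb R^2\rtimes\mathrm{GL}(2,\mathbb R)$, $(\eta,P)\leftrightarrow\bar F_\eta\bar F_P$. Let $A=\begin{pmatrix}0&1\\1&0\end{pmatrix}$. The split oscillator group is $\mathrm{Osc}_{1,0}=H\rtimes\mathbb R$, with multiplication $(z,\xi,t)(z',\xi',t')=(z+z'+\tfrac12\omega(\xi,e^{tA}\xi'),\xi+e^{tA}\xi',t+t')$;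 $H$ is identified with $\{t=0\}$, and $p:\mathrm{Osc}_{1,0}\to\mathbb R$ is $(z,\xi,t)\mapsto t$. For $\eta\in\mathbb R^2$ let $F_\eta$ be the automorphism of $\mathrm{Osc}_{1,0}$ with $F_\eta|_H=\bar F_\eta$ and $F_\eta(0,0,t)=(-\tfrac12\omega(\eta,e^{tA}\eta),\eta-e^{tA}\eta,t)$ (i.e. conjugation by $(0,\eta,0)$). A lattice in a Lie group $G$ is a discrete subgroup $L$ such that $L\backslash G$ has finite invariant measure. For $r\in\mathbb N_{>0}$, $\Gamma_r=\{(z,\xi)\in H\mid\xi=(\xi_1,\xi_2)\in\mathbb Z^2,\ z\in\tfrac12\xi_1\xi_2+\tfrac1r\mathbb Z\}$, a lattice in $H$. Let $\mathcal B_r=\{(\xi,B)\in\mathbb R^2\rtimes\mathrm{GL}(2,\mathbb R)\mid\bar F_\xi\bar F_B(\Gamma_r)=\Gamma_r\}$, a group acting on $\Gamma_r$ by automorphisms. Let $\mathbb S=\{s\in\mathbb R_{>0}\mid e^s+e^{-s}\in\mathbb N\}$. For a lattice $L$ in $\mathrm{Osc}_{1,0}$, $L\cap H$ is a lattice in $H$, hence isomorphic to $\Gamma_r$ for a unique $r=:r(L)$, and $p(L)=s\mathbb Z$ for a unique $s=:s(L)>0$; one has $s(L)\in\mathbb S$. Put $\mathcal L_{r,s}=\{L\in\mathcal L\mid r(L)=r,\ s(L)=s\}$. Let $\mathcal P_{r,s}$ be the set of $(\eta,P,z,\xi)\in\mathbb R^2\times\mathrm{GL}(2,\mathbb R)\times\mathbb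 R\times\mathbb R^2$ with $(\xi,B)\in\mathcal B_r$ for $B:=P^{-1}e^{sA}P$. For $(\eta,P,z,\xi)\in\mathcal P_{r,s}$ let $$L_{r,s}(\eta,P,z,\xi)=F_\eta\big(\big\langle\bar F_P(\Gamma_r),\,(\bar F_P(z,\xi),s)\big\rangle\big)\in\mathcal L_{r,s},$$ where $(\bar F_P(z,\xi),s)=(\det(P)z,P\xi,s)$. The group $\Gamma_r\rtimes\mathcal B_r$ acts on $\mathcal P_{r,s}$ from the right: for $(k,l)\in\Gamma_r$ and $(\zeta,K)\in\mathcal B_r$, $(\eta,P,z,\xi)\cdot(k,l,\zeta,K)=(\tilde\eta,\tilde P,\tilde z,\tilde\xi)$ with $(\tilde\eta,\tilde P)=(\eta,P)\cdot(\zeta,K)=(\eta+P\zeta,PK)$ and $(\tilde z,\tilde\xi)=\bar F_{K^{-1}}\big((0,-\zeta)(k,l)^{-1}(z,\xi)(0,B\zeta)\big)$, where $B=P^{-1}e^{sA}P$ and the product inside is taken in $H$. *)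

theory Defs
  imports "HOL-Analysis.Analysis" "HOL-Algebra.Generated_Groups"
begin

section \<open>Lattices in topological groups\<close>

text \<open>The Borel sets of \<open>L\G\<close> (right cosets \<open>L g\<close>), equipped with the quotient topology:
  \<open>U\<close> is open iff its preimage under \<open>g \<mapsto> L g\<close> is open in \<open>G\<close>. The topology of \<open>G\<close> is the one
  its carrier inherits from the type.\<close>

definition coset_borel :: "('a::topological_space, 'b) monoid_scheme \<Rightarrow> 'a set \<Rightarrow> 'a set measure" where
  "coset_borel G L = sigma (rcosets\<^bsub>G\<^esub> L)
     {U. U \<subseteq> rcosets\<^bsub>G\<^esub> L \<and>
         openin (top_of_set (carrier G)) {g \<in> carrier G. L #>\<^bsub>G\<^esub> g \<in> U}}"

text \<open>The measure must be nonzero: the zero measure is always finite and invariant.\<close>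

definition finite_invariant_measure ::
  "('a::topological_space, 'b) monoid_scheme \<Rightarrow> 'a set \<Rightarrow> 'a set measure \<Rightarrow> bool" where
  "finite_invariant_measure G L \<mu> \<longleftrightarrow>
     sets \<mu> = sets (coset_borel G L) \<and> finite_measure \<mu> \<and> emeasure \<mu> (space \<mu>) \<noteq> 0 \<and>
     (\<forall>g \<in> carrier G. \<forall>U \<in> sets \<mu>. emeasure \<mu> ((\<lambda>C. C #>\<^bsub>G\<^esub> g) ` U) = emeasure \<mu> U)"

definition is_lattice :: "('a::topological_space, 'b) monoid_scheme \<Rightarrow> 'a set \<Rightarrow> bool" where
  "is_lattice G L \<longleftrightarrow>
     subgroup L G \<and> discrete L \<and> (\<exists>\<mu>. finite_invariant_measure G L \<mu>)"


section \<open>The Heisenberg group\<close>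

type_synonym vec2 = "real^2"
type_synonym mat2 = "real^2^2"
type_synonym heis = "real \<times> vec2"
type_synonym osc = "real \<times> vec2 \<times> real"

definition \<omega> :: "vec2 \<Rightarrow> vec2 \<Rightarrow> real" where
  "\<omega> \<xi> \<xi>' = \<xi>$1 * \<xi>'$2 - \<xi>'$1 * \<xi>$2"

definition Heis :: "heis monoid" where
  "Heis = \<lparr>carrier = UNIV,
           mult = (\<lambda>(z, \<xi>) (z', \<xi>'). (z + z' + 1/2 * \<omega> \<xi> \<xi>', \<xi> + \<xi>')),
           one = (0, 0)\<rparr>"

text \<open>\<open>H_lin P\<close> and \<open>H_inn \<eta>\<close> are the automorphisms usually written as F-bar with index \<open>P\<close>,
  respectively \<open>\<eta>\<close>; \<open>(\<eta>, P)\<close> in the semidirect product of \<open>\<real>\<^sup>2\<close> and \<open>GL(2,\<real>)\<close> acts as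
  \<open>H_inn \<eta> \<circ> H_lin P\<close>.\<close>

definition H_lin :: "mat2 \<Rightarrow> heis \<Rightarrow> heis" where
  "H_lin P = (\<lambda>(z, \<xi>). (det P * z, P *v \<xi>))"

definition H_inn :: "vec2 \<Rightarrow> heis \<Rightarrow> heis" where
  "H_inn \<eta> = (\<lambda>(z, \<xi>). (z + \<omega> \<eta> \<xi>, \<xi>))"

definition \<Gamma> :: "nat \<Rightarrow> heis set" where
  "\<Gamma> r = {(z, \<xi>). \<xi>$1 \<in> \<int> \<and> \<xi>$2 \<in> \<int> \<and> (\<exists>m::int. z = 1/2 * \<xi>$1 * \<xi>$2 + 1 / real r * of_int m)}"

definition \<B> :: "nat \<Rightarrow> (vec2 \<times> mat2) set" where
  "\<B> r = {(\<xi>, B). invertible B \<and> (H_inn \<xi> \<circ> H_lin B) ` \<Gamma> r = \<Gamma> r}"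


section \<open>The split oscillator group\<close>

text \<open>The power series of the matrix exponential; on \<open>real^2^2\<close> the operation \<open>**\<close> is the matrix
  product (whereas \<open>*\<close> and \<open>^\<close> act entrywise).\<close>

definition mat_exp :: "mat2 \<Rightarrow> mat2" where
  "mat_exp M = (\<Sum>n. (1 / fact n) *\<^sub>R ((\<lambda>X. M ** X) ^^ n) (mat 1))"

definition A_mat :: "mat2" where
  "A_mat = vector [vector [0, 1], vector [1, 0]]"

abbreviation expA :: "real \<Rightarrow> mat2" where
  "expA t \<equiv> mat_exp (t *\<^sub>R A_mat)"

definition Osc :: "osc monoid" where
  "Osc = \<lparr>carrier = UNIV,
          mult = (\<lambda>(z, \<xi>, t) (z', \<xi>', t').
                    (z + z' + 1/2 * \<omega> \<xi> (expA t *v \<xi>'), \<xi> + expA t *v \<xi>', t + t')),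
          one = (0, 0, 0)\<rparr>"

definition at_level :: "real \<Rightarrow> heis \<Rightarrow> osc" where
  "at_level t = (\<lambda>(z, \<xi>). (z, \<xi>, t))"

definition H_in_Osc :: "osc set" where
  "H_in_Osc = range (at_level 0)"

definition p_Osc :: "osc \<Rightarrow> real" where
  "p_Osc = (\<lambda>(z, \<xi>, t). t)"

text \<open>The automorphism is determined by its values on \<open>H\<close> and on \<open>(0, 0, t)\<close>, because
  \<open>(z, \<xi>, t) = (z, \<xi>, 0) (0, 0, t)\<close>.\<close>

definition Osc_inn :: "vec2 \<Rightarrow> osc \<Rightarrow> osc" where
  "Osc_inn \<eta> = (\<lambda>(z, \<xi>, t).
     at_level 0 (H_inn \<eta> (z, \<xi>)) \<otimes>\<^bsub>Osc\<^esub>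
     (- (1/2) * \<omega> \<eta> (expA t *v \<eta>), \<eta> - expA t *v \<eta>, t))"


section \<open>Lattices in the split oscillator group\<close>

definition Lats :: "osc set set" where
  "Lats = {L. is_lattice Osc L}"

definition SS :: "real set" where
  "SS = {s. s > 0 \<and> exp s + exp (- s) \<in> \<nat>}"

text \<open>The isomorphism in \<open>r_inv\<close> is one of abstract groups, and \<open>THE\<close> leaves the value unspecified
  should there be no unique \<open>r\<close> (or \<open>s\<close>).\<close>

definition r_inv :: "osc set \<Rightarrow> nat" where
  "r_inv L = (THE r. r > 0 \<and> Osc\<lparr>carrier := L \<inter> H_in_Osc\<rparr> \<cong> Heis\<lparr>carrier := \<Gamma> r\<rparr>)"

definition s_inv :: "osc set \<Rightarrow> real" where
  "s_inv L = (THE s. s > 0 \<and> p_Osc ` L = {s * of_int n | n::int. True})"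

definition Lats_rs :: "nat \<Rightarrow> real \<Rightarrow> osc set set" where
  "Lats_rs r s = {L \<in> Lats. r_inv L = r \<and> s_inv L = s}"


section \<open>The parametrisation\<close>

type_synonym param = "vec2 \<times> mat2 \<times> heis"

definition conj_exp :: "real \<Rightarrow> mat2 \<Rightarrow> mat2" where
  "conj_exp s P = matrix_inv P ** expA s ** P"

definition \<P> :: "nat \<Rightarrow> real \<Rightarrow> param set" where
  "\<P> r s = {(\<eta>, P, z, \<xi>). invertible P \<and> (\<xi>, conj_exp s P) \<in> \<B> r}"

definition L_of :: "nat \<Rightarrow> real \<Rightarrow> param \<Rightarrow> osc set" where
  "L_of r s = (\<lambda>(\<eta>, P, z, \<xi>).
     Osc_inn \<eta> ` generate Osc (at_level 0 ` H_lin P ` \<Gamma> r \<union> {at_level s (H_lin P (z, \<xi>))}))"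

text \<open>The semidirect product: \<open>(\<zeta>, K) \<in> \<B> r\<close> acts on \<open>\<Gamma> r\<close> by \<open>H_inn \<zeta> \<circ> H_lin K\<close>, and composing these
  automorphisms gives the product in the second component.\<close>

definition \<Gamma>\<B> :: "nat \<Rightarrow> (heis \<times> (vec2 \<times> mat2)) monoid" where
  "\<Gamma>\<B> r = \<lparr>carrier = \<Gamma> r \<times> \<B> r,
          mult = (\<lambda>(\<gamma>, (\<zeta>, K)) (\<gamma>', (\<zeta>', K')).
                    (\<gamma> \<otimes>\<^bsub>Heis\<^esub> H_inn \<zeta> (H_lin K \<gamma>'), (\<zeta> + K *v \<zeta>', K ** K'))),
          one = ((0, 0), (0, mat 1))\<rparr>"

definition act :: "real \<Rightarrow> param \<Rightarrow> heis \<times> (vec2 \<times> mat2) \<Rightarrow> param" where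
  "act s = (\<lambda>(\<eta>, P, z, \<xi>) ((k, l), (\<zeta>, K)).
     (\<eta> + P *v \<zeta>, P ** K,
      H_lin (matrix_inv K)
        ((0, - \<zeta>) \<otimes>\<^bsub>Heis\<^esub> inv\<^bsub>Heis\<^esub> (k, l) \<otimes>\<^bsub>Heis\<^esub> (z, \<xi>) \<otimes>\<^bsub>Heis\<^esub> (0, conj_exp s P *v \<zeta>))))"

text \<open>The class \<open>orbit_rel r s `` {x}\<close> of \<open>x \<in> \<P> r s\<close> is the orbit of \<open>x\<close>.\<close>

definition orbit_rel :: "nat \<Rightarrow> real \<Rightarrow> param rel" where
  "orbit_rel r s = {(x, y). x \<in> \<P> r s \<and> (\<exists>g \<in> carrier (\<Gamma>\<B> r). y = act s x g)}"

end

theory Submission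
  imports Defs
begin

text \<open>
  Call a subgroup \<open>L\<close> of the oscillator group framed by \<open>(\<eta>, P)\<close> with invariants \<open>r\<close>, \<open>s\<close> if \<open>L \<inter> H\<close> is the image
  of \<open>\<Gamma> r\<close> under the automorphism of \<open>H\<close> with parameters \<open>(\<eta>, P)\<close>, and \<open>L\<close> projects onto \<open>s \<int>\<close>. The invariants of
  a framed subgroup are determined by it (\<open>framed_r_inv\<close>, which rests on \<open>\<Gamma>_iso_unique\<close>, and
  \<open>framed_s_inv\<close>). The proof shows that the lattices are exactly the framed subgroups, and that the
  frames of one subgroup form the claimed orbits.

  Lattices are framed (\<open>lattice_imp_framed\<close>). A finite invariant measure enters through one consequence,
  the pigeonhole principle \<open>recurrence\<close>: modulo \<open>L\<close>, two of infinitely many translates of a nonempty open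
  set must meet. Thus \<open>L\<close> has elements outside \<open>H\<close>, and its image in neither of the two affine quotient groups
  of the oscillator group consists of maps with a common fixed point. The latter forces \<open>\<omega>\<close> to be
  nonzero on the projection \<open>\<Lambda>\<close> of \<open>L \<inter> H\<close> to the plane (\<open>lattice_H_proj_nondegenerate\<close>). Commutators and
  discreteness then show that \<open>L\<close> meets the centre in some \<open>c \<int>\<close> with \<open>c > 0\<close>, and that \<open>\<omega>\<close> maps \<open>\<Lambda> \<times> \<Lambda>\<close> into \<open>c \<int>\<close>. A pair with minimal
  positive value of \<open>\<omega>\<close> is a \<open>\<int>\<close>-basis of \<open>\<Lambda>\<close>, and provides the frame. Since \<open>e\<^sup>t\<^sup>A\<close> preserves \<open>\<Lambda>\<close> for each
  level \<open>t\<close> of \<open>L\<close>, its trace \<open>2 cosh t\<close> is an integer; so the levels are discrete and their generator is in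
  \<open>SS\<close>.

  Framed subgroups are lattices (\<open>framed_is_lattice\<close>). They have an evident bounded fundamental domain,
  and Lebesgue measure is invariant under the translations of the oscillator group from either side;
  \<open>finite_invariant_measure_from_fundamental_domain\<close> turns this into a measure on the coset space.

  For the parametrisation, \<open>L_of r s (\<eta>, P, h)\<close> is generated by the image of \<open>\<Gamma> r\<close> and one element of level
  \<open>s\<close>, and conversely a framed subgroup is generated by its intersection with \<open>H\<close> and any of its elements
  of level \<open>s\<close>. Such an element normalises \<open>L \<inter> H\<close>, which in the coordinates of the frame is the condition
  defining \<open>\<P> r s\<close>. Two parameters give the same \<open>L\<close> iff they give the same \<open>L \<inter> H\<close> and the same elements of
  level \<open>s\<close>; written out, the former is a change of frame by \<open>\<B> r\<close> and the latter a change by \<open>\<Gamma> r\<close>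
  (\<open>L_of_act\<close>, \<open>L_of_eq_imp_act\<close>). So the orbit relation is the kernel of \<open>L_of r s\<close>.
\<close>

section \<open>The one-parameter group and the symplectic form\<close>

text \<open>The closed form of \<open>exp (t A)\<close>. It is a constant of its own so that the simplifier does not
  rewrite inside the argument of the exponential series.\<close>

definition boost :: "real \<Rightarrow> mat2" where
  "boost t = vector [vector [cosh t, sinh t], vector [sinh t, cosh t]]"

lemma expA_eq_boost: "expA t = boost t"
proof -
  let ?T = "\<lambda>n. vector [vector [if even n then t ^ n else 0, if even n then 0 else t ^ n],
                       vector [if even n then 0 else t ^ n, if even n then t ^ n else 0]] :: mat2"
  have pow: "((\<lambda>X. (t *\<^sub>R A_mat) ** X) ^^ n) (mat 1) = ?T n" for n
  proof (induction n)
    case 0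
    then show ?case by (simp add: vec_eq_iff forall_2 mat_def)
  next
    case (Suc n)
    then show ?case
      by (simp add: vec_eq_iff forall_2 A_mat_def matrix_matrix_mult_def sum_2)
  qed
  have "(\<lambda>n. (1 / fact n) *\<^sub>R ?T n) sums boost t"
    unfolding sums_def
  proof (intro vec_tendstoI)
    fix i j :: 2
    have "(\<lambda>n. ((1 / fact n) *\<^sub>R ?T n) $ i $ j) =
       (if i = j then (\<lambda>n. if even n then t ^ n /\<^sub>R fact n else 0)
                 else (\<lambda>n. if even n then 0 else t ^ n /\<^sub>R fact n))"
      using exhaust_2[of i] exhaust_2[of j] by (auto simp: fun_eq_iff divide_inverse_commute)
    then have "(\<lambda>n. ((1 / fact n) *\<^sub>R ?T n) $ i $ j) sums (boost t $ i $ j)"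
      using cosh_converges[of t] sinh_converges[of t] exhaust_2[of i] exhaust_2[of j]
      by (auto simp: boost_def)
    then show "(\<lambda>n. (\<Sum>k<n. (1 / fact k) *\<^sub>R ?T k) $ i $ j) \<longlonglongrightarrow> boost t $ i $ j"
      by (simp add: sums_def)
  qed
  then show ?thesis
    by (simp add: mat_exp_def pow sums_iff)
qed

lemma boost_components [simp]:
  "(boost t *v x) $ 1 = cosh t * x$1 + sinh t * x$2"
  "(boost t *v x) $ 2 = sinh t * x$1 + cosh t * x$2"
  by (simp_all add: boost_def matrix_vector_mult_def sum_2)

lemma boost_add: "boost (s + t) *v x = boost s *v (boost t *v x)"
  by (simp add: vec_eq_iff forall_2 cosh_add sinh_add algebra_simps)

lemma boost_0 [simp]: "boost 0 *v x = x"
  by (simp add: vec_eq_iff forall_2)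

lemma boost_cancel [simp]:
  "boost t *v (boost (- t) *v x) = x" "boost (- t) *v (boost t *v x) = x"
  by (simp_all flip: boost_add)

lemma det_boost [simp]: "det (boost t) = 1"
  using cosh_square_eq[of t] by (simp add: boost_def det_2 power2_eq_square)

lemma matrix_vector_mult_uminus: "P *v (- x) = - (P *v x)" for P :: mat2
  using matrix_vector_mult_diff_distrib[of P 0 x] by simp

lemma \<omega>_matrix: "\<omega> (P *v x) (P *v y) = det P * \<omega> x y"
  by (simp add: \<omega>_def det_2 matrix_vector_mult_def sum_2 algebra_simps)

lemma \<omega>_boost [simp]: "\<omega> (boost t *v x) (boost t *v y) = \<omega> x y"
  by (simp add: \<omega>_matrix)

lemma \<omega>_linear:
  "\<omega> (x + y) v = \<omega> x v + \<omega> y v" "\<omega> v (x + y) = \<omega> v x + \<omega> v y"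
  "\<omega> (x - y) v = \<omega> x v - \<omega> y v" "\<omega> v (x - y) = \<omega> v x - \<omega> v y"
  "\<omega> (- x) v = - \<omega> x v" "\<omega> v (- x) = - \<omega> v x"
  "\<omega> (c *\<^sub>R x) v = c * \<omega> x v" "\<omega> v (c *\<^sub>R x) = c * \<omega> v x"
  "\<omega> 0 v = 0" "\<omega> v 0 = 0" "\<omega> v v = 0"
  by (simp_all add: \<omega>_def algebra_simps)

lemma \<omega>_swap: "\<omega> y x = - \<omega> x y"
  by (simp add: \<omega>_def)

section \<open>The two groups\<close>

lemma carrier_Heis [simp]: "carrier Heis = UNIV" and carrier_Osc [simp]: "carrier Osc = UNIV"
  by (simp_all add: Heis_def Osc_def)

lemma mult_Heis [simp]:
  "(z, \<xi>) \<otimes>\<^bsub>Heis\<^esub> (z', \<xi>') = (z + z' + 1/2 * \<omega> \<xi> \<xi>', \<xi> + \<xi>')"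
  by (simp add: Heis_def)

lemma one_Heis [simp]: "\<one>\<^bsub>Heis\<^esub> = (0, 0)"
  by (simp add: Heis_def)

lemma mult_Osc [simp]:
  "(z, \<xi>, t) \<otimes>\<^bsub>Osc\<^esub> (z', \<xi>', t') =
     (z + z' + 1/2 * \<omega> \<xi> (boost t *v \<xi>'), \<xi> + boost t *v \<xi>', t + t')"
  by (simp add: Osc_def expA_eq_boost)

lemma one_Osc [simp]: "\<one>\<^bsub>Osc\<^esub> = (0, 0, 0)"
  by (simp add: Osc_def)

lemma group_Heis: "group Heis"
proof (rule groupI)
  fix x :: heis
  show "\<exists>y\<in>carrier Heis. y \<otimes>\<^bsub>Heis\<^esub> x = \<one>\<^bsub>Heis\<^esub>"
    by (cases x) (auto simp: \<omega>_linear intro!: exI[of _ "- fst x"] exI[of _ "- snd x"])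
qed (auto simp: \<omega>_linear field_simps)

interpretation Heis: group Heis
  by (rule group_Heis)

lemma group_Osc: "group Osc"
proof (rule groupI)
  fix x :: osc
  obtain z \<xi> t where x: "x = (z, \<xi>, t)" by (cases x)
  have "(- z, - (boost (- t) *v \<xi>), - t) \<otimes>\<^bsub>Osc\<^esub> x = \<one>\<^bsub>Osc\<^esub>"
    by (simp add: x \<omega>_linear)
  then show "\<exists>y\<in>carrier Osc. y \<otimes>\<^bsub>Osc\<^esub> x = \<one>\<^bsub>Osc\<^esub>"
    by (metis UNIV_I carrier_Osc)
next
  fix x y z :: osc
  show "x \<otimes>\<^bsub>Osc\<^esub> y \<otimes>\<^bsub>Osc\<^esub> z = x \<otimes>\<^bsub>Osc\<^esub> (y \<otimes>\<^bsub>Osc\<^esub> z)"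
    by (cases x; cases y; cases z) (simp add: boost_add \<omega>_linear matrix_vector_right_distrib field_simps)
qed (auto simp: \<omega>_linear)

interpretation Osc: group Osc
  by (rule group_Osc)

lemma inv_Heis [simp]: "inv\<^bsub>Heis\<^esub> (z, \<xi>) = (- z, - \<xi>)"
  by (rule Heis.inv_equality) (simp_all add: \<omega>_linear)

lemma inv_Osc [simp]: "inv\<^bsub>Osc\<^esub> (z, \<xi>, t) = (- z, - (boost (- t) *v \<xi>), - t)"
  by (rule Osc.inv_equality) (simp_all add: \<omega>_linear)

section \<open>Finite invariant measures on coset spaces\<close>

locale semitopological_group = group G
  for G :: "('a::second_countable_topology, 'b) monoid_scheme" (structure) +
  assumes carrier_UNIV [simp]: "carrier G = UNIV"
    and continuous_left: "continuous_on UNIV (\<lambda>x. g \<otimes> x)"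
    and continuous_right: "continuous_on UNIV (\<lambda>x. x \<otimes> g)"
begin

lemma sets_coset_borel: "sets (coset_borel G L) =
    sigma_sets (rcosets L) {U. U \<subseteq> rcosets L \<and> open {g. L #> g \<in> U}}"
  and space_coset_borel: "space (coset_borel G L) = rcosets L"
  by (auto simp: coset_borel_def sets_measure_of_conv space_measure_of_conv)

lemma open_right_image:
  assumes "open U" shows "open ((\<lambda>x. x \<otimes> g) ` U)"
proof -
  have "(\<lambda>x. x \<otimes> g) ` U = (\<lambda>x. x \<otimes> inv g) -` U"
    by (force simp: m_assoc)
  then show ?thesis
    using open_vimage[OF assms continuous_right] by simp
qed

lemma open_image_coset_borel:
  assumes L: "subgroup L G" and U: "open U"
  shows "(\<lambda>g. L #> g) ` U \<in> sets (coset_borel G L)"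
proof -
  have "{g. L #> g \<in> (\<lambda>g. L #> g) ` U} = (\<Union>l\<in>L. (\<lambda>x. l \<otimes> x) -` U)"
  proof (intro equalityI subsetI)
    fix g assume "g \<in> {g. L #> g \<in> (\<lambda>g. L #> g) ` U}"
    then obtain u where u: "u \<in> U" "L #> g = L #> u" by auto
    then have "u \<in> L #> g" using rcos_self[OF _ L, of u] by simp
    then show "g \<in> (\<Union>l\<in>L. (\<lambda>x. l \<otimes> x) -` U)"
      using u by (auto simp: r_coset_def)
  next
    fix g assume "g \<in> (\<Union>l\<in>L. (\<lambda>x. l \<otimes> x) -` U)"
    then obtain l where l: "l \<in> L" "l \<otimes> g \<in> U" by auto
    then have "l \<otimes> g \<in> L #> g" by (auto simp: r_coset_def)
    then have "L #> g = L #> (l \<otimes> g)"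
      using repr_independence[OF _ _ L] by simp
    then show "g \<in> {g. L #> g \<in> (\<lambda>g. L #> g) ` U}" using l by auto
  qed
  also have "open \<dots>"
    by (intro open_UN ballI open_vimage U continuous_left)
  finally show ?thesis
    unfolding sets_coset_borel by (intro sigma_sets.Basic) (auto simp: RCOSETS_def)
qed

lemma translate_coset_image:
  assumes "subgroup L G"
  shows "(\<lambda>C. C #> g) ` (\<lambda>g. L #> g) ` U = (\<lambda>g. L #> g) ` (\<lambda>x. x \<otimes> g) ` U"
  by (simp add: image_image coset_mult_assoc)

text \<open>The image of \<open>U\<close> in the coset space has positive measure, since countably many translates of it
  cover the space. As the total measure is finite, the images of the translates \<open>U g\<^sub>i\<close> cannot be pairwise
  disjoint. Besides discreteness, this is the only property of lattices that is used to
  classify them.\<close>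

lemma recurrence:
  fixes g :: "nat \<Rightarrow> 'a"
  assumes L: "subgroup L G" and \<mu>: "finite_invariant_measure G L \<mu>"
    and U: "open U" "U \<noteq> {}"
  obtains i j l u v where "i \<noteq> j" "l \<in> L" "u \<in> U" "v \<in> U" "l \<otimes> (v \<otimes> g j) = u \<otimes> g i"
proof -
  define \<pi> where "\<pi> = (\<lambda>g. L #> g)"
  interpret \<mu>: finite_measure \<mu>
    using \<mu> by (simp add: finite_invariant_measure_def)
  have sets: "sets \<mu> = sets (coset_borel G L)" and nz: "emeasure \<mu> (space \<mu>) \<noteq> 0"
    and inv: "\<And>g U. U \<in> sets \<mu> \<Longrightarrow> emeasure \<mu> ((\<lambda>C. C #> g) ` U) = emeasure \<mu> U"
    using \<mu> by (auto simp: finite_invariant_measure_def)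
  have space: "space \<mu> = range \<pi>"
    using sets_eq_imp_space_eq[OF sets] by (auto simp: space_coset_borel RCOSETS_def \<pi>_def)
  have meas: "\<pi> ` V \<in> sets \<mu>" if "open V" for V
    using open_image_coset_borel[OF L that] by (simp add: sets \<pi>_def)
  have transl: "emeasure \<mu> (\<pi> ` (\<lambda>x. x \<otimes> h) ` U) = emeasure \<mu> (\<pi> ` U)" for h
    using inv[OF meas[OF U(1)], of h] translate_coset_image[OF L, of h U] by (simp add: \<pi>_def)
  \<comment> \<open>countably many translates of \<open>U\<close> cover the group, so the image of \<open>U\<close> is not null\<close>
  have pos: "measure \<mu> (\<pi> ` U) > 0"
  proof (rule ccontr)
    assume "\<not> ?thesis"
    then have 0: "emeasure \<mu> (\<pi> ` U) = 0"
      by (simp add: \<mu>.emeasure_eq_measure ennreal_neg)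
    define F where "F = range (\<lambda>h. (\<lambda>x. x \<otimes> h) ` U)"
    obtain F' where F': "F' \<subseteq> F" "countable F'" "\<Union>F' = \<Union>F"
      using Lindelof[of F] open_right_image[OF U(1)] by (auto simp: F_def)
    obtain C where C: "countable C" "F' = (\<lambda>h. (\<lambda>x. x \<otimes> h) ` U) ` C"
      using F' by (metis F_def countable_subset_image)
    obtain u where u: "u \<in> U" using U by auto
    have "x \<in> \<Union>F" for x
      using u by (auto simp: F_def intro!: exI[of _ "inv u \<otimes> x"] image_eqI[of _ _ u] simp flip: m_assoc)
    then have "(\<Union>h\<in>C. \<pi> ` (\<lambda>x. x \<otimes> h) ` U) = space \<mu>"
      using F' C by (auto simp: space image_UN[symmetric] image_Union[symmetric])
    moreover have "(\<Union>h\<in>C. \<pi> ` (\<lambda>x. x \<otimes> h) ` U) \<in> null_sets \<mu>"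
      using 0 transl meas open_right_image[OF U(1)] C(1) by (intro null_sets_UN') auto
    ultimately show False using nz by auto
  qed
  have "\<exists>i j. i \<noteq> j \<and> \<pi> ` (\<lambda>x. x \<otimes> g i) ` U \<inter> \<pi> ` (\<lambda>x. x \<otimes> g j) ` U \<noteq> {}"
  proof (rule ccontr)
    assume "\<not> ?thesis"
    then have disj: "disjoint_family (\<lambda>i. \<pi> ` (\<lambda>x. x \<otimes> g i) ` U)"
      unfolding disjoint_family_on_def by blast
    obtain N :: nat where N: "real N * measure \<mu> (\<pi> ` U) > measure \<mu> (space \<mu>)"
      using reals_Archimedean3[OF pos] by blast
    have "real N * measure \<mu> (\<pi> ` U) = (\<Sum>i<N. measure \<mu> (\<pi> ` (\<lambda>x. x \<otimes> g i) ` U))"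
      using transl by (simp add: measure_def)
    also have "\<dots> = measure \<mu> (\<Union>i<N. \<pi> ` (\<lambda>x. x \<otimes> g i) ` U)"
      using disj meas open_right_image[OF U(1)]
      by (intro \<mu>.finite_measure_finite_Union[symmetric]) (auto simp: disjoint_family_on_def)
    also have "\<dots> \<le> measure \<mu> (space \<mu>)"
      by (rule \<mu>.bounded_measure)
    finally show False using N by simp
  qed
  then obtain i j u v where ij: "i \<noteq> j" "u \<in> U" "v \<in> U" "\<pi> (u \<otimes> g i) = \<pi> (v \<otimes> g j)"
    by blast
  have "u \<otimes> g i \<in> L #> (v \<otimes> g j)"
    using rcos_self[OF _ L, of "u \<otimes> g i"] ij by (simp add: \<pi>_def)
  then show thesis
    using ij by (auto simp: r_coset_def intro: that)
qed

text \<open>The measure of a set \<open>V\<close> of cosets is the Haar measure of the part of its preimage that lies in \<open>F\<close>.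
  For invariance, let \<open>A\<close> be the preimage of \<open>V\<close>, a set with \<open>L A = A\<close>. Cutting \<open>A g \<inter> F\<close> along the translates
  \<open>l F g\<close> and moving the pieces back by \<open>l\<close> and \<open>g\<close> reassembles \<open>A \<inter> F\<close>.\<close>

lemma finite_invariant_measure_from_fundamental_domain:
  assumes L: "subgroup L G" and countable: "countable L"
    and F: "F \<in> sets borel" "\<And>g. \<exists>!l. l \<in> L \<and> l \<otimes> g \<in> F"
    and M: "sets M = sets borel" "emeasure M F \<noteq> 0" "emeasure M F \<noteq> \<infinity>"
    and left: "\<And>g. distr M M (\<lambda>x. g \<otimes> x) = M" and right: "\<And>g. distr M M (\<lambda>x. x \<otimes> g) = M"
  shows "\<exists>\<mu>. finite_invariant_measure G L \<mu>"
proof -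
  define \<pi> where "\<pi> = (\<lambda>g. L #> g)"
  define \<mu> where "\<mu> = distr (restrict_space M F) (coset_borel G L) \<pi>"
  have spM: "space M = UNIV"
    using sets_eq_imp_space_eq[OF M(1)] by simp
  have meas_left [measurable]: "(\<lambda>x. g \<otimes> x) \<in> borel_measurable borel"
    and meas_right [measurable]: "(\<lambda>x. x \<otimes> g) \<in> borel_measurable borel" for g
    by (intro borel_measurable_continuous_onI continuous_left continuous_right)+
  have pi: "\<pi> \<in> measurable borel (coset_borel G L)"
    unfolding coset_borel_def
  proof (rule measurable_measure_of)
    fix U assume "U \<in> {U. U \<subseteq> rcosets L \<and>
         openin (top_of_set (carrier G)) {g \<in> carrier G. L #> g \<in> U}}"
    then have "open (\<pi> -` U)" by (simp add: \<pi>_def vimage_def)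
    then show "\<pi> -` U \<inter> space borel \<in> sets borel" by simp
  qed (auto simp: \<pi>_def RCOSETS_def)
  then have pi': "\<pi> \<in> measurable (restrict_space M F) (coset_borel G L)"
    using measurable_cong_sets[OF M(1) refl, of "coset_borel G L"]
    by (intro measurable_restrict_space1) auto
  have FM: "F \<in> sets M" using F M by simp
  have em: "emeasure \<mu> V = emeasure M (\<pi> -` V \<inter> F)" if "V \<in> sets (coset_borel G L)" for V
    using that FM spM
    by (simp add: \<mu>_def emeasure_distr[OF pi'] emeasure_restrict_space space_restrict_space Int_commute)
  have inv_left: "emeasure M {x. g \<otimes> x \<in> A} = emeasure M A" if "A \<in> sets borel" for A g
  proof -
    have "(\<lambda>x. g \<otimes> x) \<in> measurable M M"
      using meas_left[of g] measurable_cong_sets[OF M(1) M(1)] by blast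
    from emeasure_distr[OF this, of A] show ?thesis
      using that M(1) by (simp add: left spM vimage_def)
  qed
  have inv_right: "emeasure M {x. x \<otimes> g \<in> A} = emeasure M A" if "A \<in> sets borel" for A g
  proof -
    have "(\<lambda>x. x \<otimes> g) \<in> measurable M M"
      using meas_right[of g] measurable_cong_sets[OF M(1) M(1)] by blast
    from emeasure_distr[OF this, of A] show ?thesis
      using that M(1) by (simp add: right spM vimage_def)
  qed
  have tiling: "emeasure M A = (\<integral>\<^sup>+l. emeasure M {x \<in> A. \<sigma> l \<otimes> x \<otimes> h \<in> F} \<partial>count_space L)"
    if A: "A \<in> sets borel" and \<sigma>: "\<And>x. \<exists>!l. l \<in> L \<and> \<sigma> l \<otimes> x \<in> F" for A h \<sigma>
  proof -
    have "A = (\<Union>l\<in>L. {x \<in> A. \<sigma> l \<otimes> x \<otimes> h \<in> F})"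
    proof (intro equalityI subsetI)
      fix x assume "x \<in> A"
      moreover obtain l where "l \<in> L" "\<sigma> l \<otimes> (x \<otimes> h) \<in> F"
        using \<sigma>[of "x \<otimes> h"] by blast
      ultimately show "x \<in> (\<Union>l\<in>L. {x \<in> A. \<sigma> l \<otimes> x \<otimes> h \<in> F})"
        by (auto simp: m_assoc)
    qed blast
    moreover have "disjoint_family_on (\<lambda>l. {x \<in> A. \<sigma> l \<otimes> x \<otimes> h \<in> F}) L"
    proof -
      have "l = l'" if "l \<in> L" "l' \<in> L" "\<sigma> l \<otimes> x \<otimes> h \<in> F" "\<sigma> l' \<otimes> x \<otimes> h \<in> F" for l l' x
        using \<sigma>[of "x \<otimes> h"] that by (simp add: m_assoc) blast
      then show ?thesis unfolding disjoint_family_on_def by blast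
    qed
    moreover have "{x \<in> A. \<sigma> l \<otimes> x \<otimes> h \<in> F} \<in> sets M" for l
    proof -
      have "{x \<in> A. \<sigma> l \<otimes> x \<otimes> h \<in> F} = A \<inter> (\<lambda>x. \<sigma> l \<otimes> x \<otimes> h) -` F" by auto
      moreover have "(\<lambda>x. \<sigma> l \<otimes> x \<otimes> h) -` F \<inter> space borel \<in> sets borel"
        using F(1) by measurable
      ultimately show ?thesis using A M(1) by auto
    qed
    ultimately show ?thesis
      using emeasure_UN_countable[of L "\<lambda>l. {x \<in> A. \<sigma> l \<otimes> x \<otimes> h \<in> F}" M] countable by auto
  qed
  have F_inv: "\<exists>!l. l \<in> L \<and> inv l \<otimes> x \<in> F" for x
  proof -
    obtain l where l: "l \<in> L" "l \<otimes> x \<in> F" "\<And>l'. l' \<in> L \<Longrightarrow> l' \<otimes> x \<in> F \<Longrightarrow> l' = l"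
      using F(2)[of x] by blast
    show ?thesis
    proof (intro ex1I[of _ "inv l"] conjI)
      fix l' assume "l' \<in> L \<and> inv l' \<otimes> x \<in> F"
      then have "inv l' = l" using l(3) subgroup.m_inv_closed[OF L] by blast
      then show "l' = inv l" by (metis carrier_UNIV UNIV_I inv_inv)
    next
      show "inv l \<in> L" using l(1) by (rule subgroup.m_inv_closed[OF L])
      show "inv (inv l) \<otimes> x \<in> F" using l(2) by simp
    qed
  qed
  have invariant: "emeasure \<mu> ((\<lambda>C. C #> g) ` V) = emeasure \<mu> V"
    if V: "V \<in> sets (coset_borel G L)" for g V
  proof -
    define A where "A = \<pi> -` V"
    define V' where "V' = (\<lambda>C. C #> g) ` V"
    have Vsub: "V \<subseteq> rcosets L"
      using sets.sets_into_space[OF V] by (simp add: space_coset_borel)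
    have A: "A \<in> sets borel"
      using measurable_sets[OF pi V] by (simp add: A_def)
    have translate: "\<pi> x #> h = \<pi> (x \<otimes> h)" for x h
      by (simp add: \<pi>_def coset_mult_assoc subgroup.subset[OF L])
    have vim: "\<pi> -` V' = {x. x \<otimes> inv g \<in> A}"
    proof (intro equalityI subsetI)
      fix x assume "x \<in> \<pi> -` V'"
      then obtain y where "\<pi> y \<in> V" "\<pi> x = \<pi> y #> g"
        using Vsub by (auto simp: V'_def RCOSETS_def \<pi>_def)
      have "\<pi> (x \<otimes> inv g) = \<pi> (y \<otimes> g \<otimes> inv g)"
        using \<open>\<pi> x = \<pi> y #> g\<close> by (simp only: translate[symmetric])
      then have "\<pi> (x \<otimes> inv g) = \<pi> y"
        by (simp add: m_assoc)
      then show "x \<in> {x. x \<otimes> inv g \<in> A}" using \<open>\<pi> y \<in> V\<close> by (simp add: A_def)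
    next
      fix x assume "x \<in> {x. x \<otimes> inv g \<in> A}"
      then have "\<pi> (x \<otimes> inv g) #> g \<in> V'"
        by (simp add: A_def V'_def)
      then show "x \<in> \<pi> -` V'"
        by (simp add: translate m_assoc)
    qed
    have V': "V' \<in> sets (coset_borel G L)"
    proof -
      have "(\<lambda>C. C #> inv g) \<in> measurable (coset_borel G L) (coset_borel G L)"
      proof (subst (2) coset_borel_def, rule measurable_measure_of)
        fix W assume W: "W \<in> {U. U \<subseteq> rcosets L \<and>
           openin (top_of_set (carrier G)) {g \<in> carrier G. L #> g \<in> U}}"
        define W' where "W' = (\<lambda>C. C #> inv g) -` W \<inter> rcosets L"
        have "{x. L #> x \<in> W'} = (\<lambda>x. x \<otimes> inv g) -` {x. L #> x \<in> W}"
          by (auto simp: W'_def coset_mult_assoc subgroup.subset[OF L] RCOSETS_def)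
        moreover have "open \<dots>"
          using W by (intro open_vimage continuous_right) auto
        ultimately have "W' \<in> {U. U \<subseteq> rcosets L \<and> open {g. L #> g \<in> U}}"
          by (auto simp: W'_def)
        then show "(\<lambda>C. C #> inv g) -` W \<inter> space (coset_borel G L) \<in> sets (coset_borel G L)"
          unfolding sets_coset_borel space_coset_borel W'_def[symmetric] by (rule sigma_sets.Basic)
      qed (auto simp: space_coset_borel RCOSETS_def coset_mult_assoc subgroup.subset[OF L])
      from measurable_sets[OF this V]
      have "(\<lambda>C. C #> inv g) -` V \<inter> rcosets L \<in> sets (coset_borel G L)"
        by (simp add: space_coset_borel)
      moreover have "(\<lambda>C. C #> inv g) -` V \<inter> rcosets L = V'"
      proof (intro equalityI subsetI)
        fix C assume "C \<in> (\<lambda>C. C #> inv g) -` V \<inter> rcosets L"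
        then obtain x where x: "C = \<pi> x" "\<pi> x #> inv g \<in> V"
          by (auto simp: \<pi>_def RCOSETS_def)
        then have "x \<in> \<pi> -` V'"
          unfolding vim by (simp add: A_def translate)
        then show "C \<in> V'" using x by simp
      next
        fix C assume C: "C \<in> V'"
        then obtain x where x: "C = \<pi> x"
          using Vsub by (auto simp: V'_def RCOSETS_def \<pi>_def coset_mult_assoc subgroup.subset[OF L])
        then have "x \<in> {x. x \<otimes> inv g \<in> A}"
          using C vim by auto
        then show "C \<in> (\<lambda>C. C #> inv g) -` V \<inter> rcosets L"
          using x by (auto simp: A_def translate) (auto simp: \<pi>_def RCOSETS_def)
      qed
      ultimately show ?thesis by simp
    qed
    have Linv: "l \<otimes> x \<in> A \<longleftrightarrow> x \<in> A" if "l \<in> L" for l x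
    proof -
      have "l \<otimes> x \<in> L #> x" using that by (auto simp: r_coset_def)
      from repr_independence[OF this _ L] show ?thesis by (simp add: A_def \<pi>_def)
    qed
    have A': "{x. x \<otimes> inv g \<in> A} \<in> sets borel"
      using measurable_sets[OF meas_right A, of "inv g"] by (simp add: vimage_def)
    have "emeasure \<mu> V' = emeasure M ({x. x \<otimes> inv g \<in> A} \<inter> F)"
      by (simp add: em[OF V'] vim)
    also have "\<dots> = (\<integral>\<^sup>+l. emeasure M {x \<in> {x. x \<otimes> inv g \<in> A} \<inter> F. inv l \<otimes> x \<otimes> inv g \<in> F} \<partial>count_space L)"
      using A' F(1) by (intro tiling F_inv) auto
    also have "\<dots> = (\<integral>\<^sup>+l. emeasure M {x \<in> A \<inter> F. l \<otimes> x \<otimes> g \<in> F} \<partial>count_space L)"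
    proof (intro nn_integral_cong)
      fix l assume "l \<in> space (count_space L)"
      then have l: "l \<in> L" by simp
      define B where "B = {x \<in> {x. x \<otimes> inv g \<in> A} \<inter> F. inv l \<otimes> x \<otimes> inv g \<in> F}"
      have "B = {x. x \<otimes> inv g \<in> A} \<inter> F \<inter> (\<lambda>x. inv l \<otimes> x \<otimes> inv g) -` F" by (auto simp: B_def)
      moreover have "(\<lambda>x. inv l \<otimes> x \<otimes> inv g) -` F \<inter> space borel \<in> sets borel"
        using F(1) by measurable
      ultimately have B: "B \<in> sets borel" using A' F(1) by auto
      have B1: "{x. x \<otimes> g \<in> B} \<in> sets borel"
        using measurable_sets[OF meas_right B, of g] by (simp add: vimage_def)
      have "emeasure M B = emeasure M {x. l \<otimes> x \<in> {x. x \<otimes> g \<in> B}}"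
        using inv_left[OF B1] inv_right[OF B] by simp
      also have "{x. l \<otimes> x \<in> {x. x \<otimes> g \<in> B}} = {x \<in> A \<inter> F. l \<otimes> x \<otimes> g \<in> F}"
        using Linv[OF l] by (auto simp: B_def m_assoc) (simp_all flip: m_assoc)
      finally show "emeasure M {x \<in> {x. x \<otimes> inv g \<in> A} \<inter> F. inv l \<otimes> x \<otimes> inv g \<in> F} =
          emeasure M {x \<in> A \<inter> F. l \<otimes> x \<otimes> g \<in> F}" by (simp add: B_def)
    qed
    also have "\<dots> = emeasure M (A \<inter> F)"
      using A F by (intro tiling[where \<sigma> = "\<lambda>l. l", symmetric]) auto
    also have "\<dots> = emeasure \<mu> V"
      by (simp add: em[OF V] A_def)
    finally show ?thesis by (simp add: V'_def)
  qed
  have total: "emeasure \<mu> (rcosets L) = emeasure M F"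
  proof -
    have "\<pi> -` (rcosets L) = UNIV" by (auto simp: \<pi>_def RCOSETS_def)
    then show ?thesis
      using em[of "rcosets L"] sets.top[of "coset_borel G L"] by (simp add: space_coset_borel)
  qed
  have "sets \<mu> = sets (coset_borel G L)" "space \<mu> = rcosets L"
    by (simp_all add: \<mu>_def space_coset_borel)
  moreover have "finite_measure \<mu>"
    using total M(3) by (intro finite_measureI) (simp add: \<mu>_def space_coset_borel)
  ultimately have "finite_invariant_measure G L \<mu>"
    unfolding finite_invariant_measure_def using total M(2) invariant by auto
  then show ?thesis by blast
qed

end

section \<open>Haar measure on the oscillator group\<close>

lemma boost_apply: "boost t *v x = cosh t *\<^sub>R x + sinh t *\<^sub>R (A_mat *v x)"
proof -
  have "(A_mat *v x) $ 1 = x $ 2" "(A_mat *v x) $ 2 = x $ 1"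
    by (simp_all add: A_mat_def matrix_vector_mult_def sum_2)
  then show ?thesis by (simp add: vec_eq_iff forall_2)
qed

lemma continuous_on_boost [continuous_intros]:
  assumes "continuous_on S f" "continuous_on S g"
  shows "continuous_on S (\<lambda>x. boost (f x) *v g x)"
  unfolding boost_apply
  by (intro continuous_intros assms matrix_vector_mult_linear_continuous_on
            continuous_on_compose2[OF matrix_vector_mult_linear_continuous_on[of UNIV A_mat] assms(2)]) auto

lemma continuous_on_\<omega> [continuous_intros]:
  assumes "continuous_on S f" "continuous_on S g"
  shows "continuous_on S (\<lambda>x. \<omega> (f x) (g x))"
  unfolding \<omega>_def by (intro continuous_intros assms)

lemma mult_Osc_fst_snd: "x \<otimes>\<^bsub>Osc\<^esub> y =
   (fst x + fst y + 1/2 * \<omega> (fst (snd x)) (boost (snd (snd x)) *v fst (snd y)),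
    fst (snd x) + boost (snd (snd x)) *v fst (snd y), snd (snd x) + snd (snd y))"
  by (cases x; cases y) simp

interpretation Osc: semitopological_group Osc
  by unfold_locales (auto simp: mult_Osc_fst_snd intro!: continuous_intros)

lemma emeasure_vimage_lborel:
  assumes "f \<in> borel_measurable borel" "distr lborel lborel f = lborel" "A \<in> sets borel"
  shows "emeasure lborel (f -` A) = emeasure lborel A"
proof -
  have "emeasure lborel A = emeasure (distr lborel lborel f) A" using assms(2) by simp
  also have "\<dots> = emeasure lborel (f -` A)"
    using assms(1,3) by (subst emeasure_distr) auto
  finally show ?thesis by simp
qed

text \<open>Both kinds of translations of the oscillator group are iterated maps of this form, with
  translations and \<open>boost t\<close> as building blocks.\<close>

lemma lborel_distr_skew_product:
  fixes f :: "'b::euclidean_space \<Rightarrow> 'a::euclidean_space \<Rightarrow> 'a" and S :: "'b \<Rightarrow> 'b"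
  assumes f: "continuous_on UNIV (\<lambda>p. f (snd p) (fst p))" "\<And>y. distr lborel lborel (f y) = lborel"
    and S: "continuous_on UNIV S" "distr lborel lborel S = lborel"
  shows "distr lborel lborel (\<lambda>(x, y). (f y x, S y)) = lborel"
proof (rule measure_eqI)
  define T where "T = (\<lambda>(x, y). (f y x, S y))"
  have T: "T \<in> borel_measurable borel"
    unfolding T_def case_prod_beta
    by (intro borel_measurable_continuous_onI continuous_intros f(1)
         continuous_on_compose2[OF S(1)]) auto
  have fy: "f y \<in> borel_measurable borel" for y
  proof (rule borel_measurable_continuous_onI)
    have "continuous_on UNIV (\<lambda>x::'a. (x, y))" by (intro continuous_intros)
    from continuous_on_compose2[OF f(1) this] show "continuous_on UNIV (f y)" by simp
  qed
  have S': "S \<in> borel_measurable borel"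
    by (intro borel_measurable_continuous_onI S(1))
  show "sets (distr lborel lborel (\<lambda>(x, y). (f y x, S y))) = sets lborel" by simp
  fix A assume "A \<in> sets (distr lborel lborel (\<lambda>(x, y). (f y x, S y)))"
  then have A: "A \<in> sets borel" by simp
  have em: "emeasure lborel X = (\<integral>\<^sup>+y. emeasure lborel ((\<lambda>x. (x, y)) -` X) \<partial>lborel)"
    if "X \<in> sets borel" for X :: "('a \<times> 'b) set"
  proof -
    have "X \<in> sets (lborel \<Otimes>\<^sub>M lborel)" using that by (simp only: lborel_prod sets_lborel)
    from lborel_pair.emeasure_pair_measure_alt2[OF this] show ?thesis by (simp only: lborel_prod)
  qed
  have slice: "(\<lambda>x. (x, y)) -` A \<in> sets borel" for y :: 'b
  proof -
    have "(\<lambda>x. (x, y)) \<in> borel_measurable (borel :: 'a measure)"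
      by (intro borel_measurable_continuous_onI continuous_intros)
    from measurable_sets[OF this A] show ?thesis by simp
  qed
  have TA: "T -` A \<in> sets borel" using measurable_sets[OF T A] by simp
  have "emeasure (distr lborel lborel T) A = emeasure lborel (T -` A)"
    using T A by (subst emeasure_distr) auto
  also have "\<dots> = (\<integral>\<^sup>+y. emeasure lborel ((\<lambda>x. (x, y)) -` T -` A) \<partial>lborel)"
    by (rule em[OF TA])
  also have "\<dots> = (\<integral>\<^sup>+y. emeasure lborel ((\<lambda>x. (x, S y)) -` A) \<partial>lborel)"
  proof (intro nn_integral_cong)
    fix y :: 'b
    have "(\<lambda>x. (x, y)) -` T -` A = f y -` (\<lambda>x. (x, S y)) -` A" by (auto simp: T_def)
    then show "emeasure lborel ((\<lambda>x. (x, y)) -` T -` A) = emeasure lborel ((\<lambda>x. (x, S y)) -` A)"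
      using emeasure_vimage_lborel[OF fy f(2) slice] by simp
  qed
  also have "\<dots> = (\<integral>\<^sup>+y. emeasure lborel ((\<lambda>x. (x, y)) -` A) \<partial>distr lborel lborel S)"
  proof -
    have "A \<in> sets (lborel \<Otimes>\<^sub>M lborel)" using A by (simp only: lborel_prod sets_lborel)
    from lborel_pair.measurable_emeasure_Pair2[OF this]
    have "(\<lambda>y. emeasure lborel ((\<lambda>x. (x, y)) -` A)) \<in> borel_measurable lborel" .
    then show ?thesis using S' by (simp add: nn_integral_distr)
  qed
  also have "\<dots> = emeasure lborel A"
    by (simp add: S(2) em[OF A])
  finally show "emeasure (distr lborel lborel (\<lambda>(x, y). (f y x, S y))) A = emeasure lborel A"
    by (simp add: T_def)
qed

lemma lborel_distr_translation:
  fixes c :: "'a::euclidean_space"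
  shows "distr lborel lborel (\<lambda>x. x + c) = lborel" "distr lborel lborel (\<lambda>x. c + x) = lborel"
  using lborel_distr_plus[of c]
  by (simp_all add: add.commute[of _ c] cong: distr_cong)

lemma lborel_distr_boost: "distr lborel lborel (\<lambda>x. boost t *v x) = lborel"
proof (rule lborel_eqI[symmetric])
  fix l u :: vec2
  assume lu: "\<And>b. b \<in> Basis \<Longrightarrow> l \<bullet> b \<le> u \<bullet> b"
  have lin: "linear (\<lambda>x. boost (- t) *v x)" by simp
  have image: "(\<lambda>x. boost t *v x) -` box l u = (\<lambda>x. boost (- t) *v x) ` box l u"
    by (force simp: image_iff)
  have "(\<lambda>x. boost t *v x) \<in> borel_measurable borel"
    by (intro borel_measurable_continuous_onI continuous_intros)
  with image have "emeasure (distr lborel lborel (\<lambda>x. boost t *v x)) (box l u) =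
      emeasure lborel ((\<lambda>x. boost (- t) *v x) ` box l u)"
    by (subst emeasure_distr) auto
  also have "\<dots> = emeasure lebesgue ((\<lambda>x. boost (- t) *v x) ` box l u)"
  proof -
    have "open ((\<lambda>x. boost t *v x) -` box l u)"
      by (intro open_vimage continuous_intros open_box)
    then show ?thesis by (simp flip: image)
  qed
  also have "\<dots> = ennreal (measure lebesgue ((\<lambda>x. boost (- t) *v x) ` box l u))"
    using measurable_linear_image[OF lin lmeasurable_box] by (simp add: emeasure_eq_measure2)
  also have "\<dots> = ennreal (measure lebesgue (box l u))"
    using measure_linear_image[OF lin lmeasurable_box, of l u] by simp
  also have "\<dots> = (\<Prod>b\<in>Basis. (u - l) \<bullet> b)"
    using lu by simp
  finally show "emeasure (distr lborel lborel (\<lambda>x. boost t *v x)) (box l u) =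
      (\<Prod>b\<in>Basis. (u - l) \<bullet> b)" .
qed simp

lemma lborel_Osc_right_invariant: "distr lborel lborel (\<lambda>x. x \<otimes>\<^bsub>Osc\<^esub> g) = lborel"
proof -
  obtain z0 \<xi>0 t0 where g: "g = (z0, \<xi>0, t0)" by (cases g)
  define S where "S = (\<lambda>(\<xi>, t). (\<xi> + boost t *v \<xi>0, t + t0))"
  have S_cont: "continuous_on UNIV S"
    by (auto simp: S_def case_prod_beta intro!: continuous_intros)
  have S: "distr lborel lborel S = lborel"
    unfolding S_def
    by (rule lborel_distr_skew_product) (auto intro!: continuous_intros lborel_distr_translation)
  have "distr lborel lborel (\<lambda>(z, y). (z + (z0 + 1/2 * \<omega> (fst y) (boost (snd y) *v \<xi>0)), S y)) = lborel"
    by (intro lborel_distr_skew_product S S_cont)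
       (auto intro!: continuous_intros lborel_distr_translation)
  moreover have "(\<lambda>(z, y). (z + (z0 + 1/2 * \<omega> (fst y) (boost (snd y) *v \<xi>0)), S y)) = (\<lambda>x. x \<otimes>\<^bsub>Osc\<^esub> g)"
    by (auto simp: fun_eq_iff g S_def)
  ultimately show ?thesis by simp
qed

lemma lborel_Osc_left_invariant: "distr lborel lborel (\<lambda>x. g \<otimes>\<^bsub>Osc\<^esub> x) = lborel"
proof -
  obtain z0 \<xi>0 t0 where g: "g = (z0, \<xi>0, t0)" by (cases g)
  have "distr lborel lborel (\<lambda>\<xi>. \<xi>0 + boost t0 *v \<xi>) = lborel"
  proof -
    have "distr lborel lborel (\<lambda>\<xi>. \<xi>0 + boost t0 *v \<xi>) =
        distr (distr lborel lborel (\<lambda>\<xi>. boost t0 *v \<xi>)) lborel (\<lambda>\<xi>. \<xi>0 + \<xi>)"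
      by (subst distr_distr) (auto simp: o_def intro!: borel_measurable_continuous_onI continuous_intros)
    then show ?thesis by (simp only: lborel_distr_boost lborel_distr_translation)
  qed
  then have S: "distr lborel lborel (\<lambda>(\<xi>, t). (\<xi>0 + boost t0 *v \<xi>, t0 + t)) = lborel"
    by (intro lborel_distr_skew_product) (auto intro!: continuous_intros lborel_distr_translation)
  define S where "S = (\<lambda>(\<xi>, t). (\<xi>0 + boost t0 *v \<xi>, t0 + t))"
  have S_cont: "continuous_on UNIV S"
    by (auto simp: S_def case_prod_beta intro!: continuous_intros)
  have "distr lborel lborel (\<lambda>(z, y). (z + (z0 + 1/2 * \<omega> \<xi>0 (boost t0 *v fst y)), S y)) = lborel"
    by (intro lborel_distr_skew_product S_cont S[folded S_def])
       (auto intro!: continuous_intros lborel_distr_translation)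
  moreover have "(\<lambda>(z, y). (z + (z0 + 1/2 * \<omega> \<xi>0 (boost t0 *v fst y)), S y)) = (\<lambda>x. g \<otimes>\<^bsub>Osc\<^esub> x)"
    by (auto simp: fun_eq_iff g S_def)
  ultimately show ?thesis by simp
qed

section \<open>Automorphisms of the Heisenberg group and the groups \<Gamma>\<close>

definition aut :: "vec2 \<Rightarrow> mat2 \<Rightarrow> heis \<Rightarrow> heis" where
  "aut \<eta> P = H_inn \<eta> \<circ> H_lin P"

lemma aut_apply [simp]: "aut \<eta> P (z, \<xi>) = (det P * z + \<omega> \<eta> (P *v \<xi>), P *v \<xi>)"
  by (simp add: aut_def H_inn_def H_lin_def)

lemma H_lin_eq_aut: "H_lin P = aut 0 P"
  by (auto simp: H_lin_def \<omega>_linear)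

lemma aut_aut: "aut \<eta> P (aut \<zeta> K x) = aut (\<eta> + P *v \<zeta>) (P ** K) x"
  by (cases x)
     (simp add: det_mul \<omega>_linear \<omega>_matrix matrix_vector_right_distrib algebra_simps
           flip: matrix_vector_mul_assoc)

lemma aut_id [simp]: "aut 0 (mat 1) x = x"
  by (cases x) (simp add: \<omega>_linear)

lemma aut_mult: "aut \<eta> P (x \<otimes>\<^bsub>Heis\<^esub> y) = aut \<eta> P x \<otimes>\<^bsub>Heis\<^esub> aut \<eta> P y"
  by (cases x; cases y) (simp add: \<omega>_linear \<omega>_matrix matrix_vector_right_distrib algebra_simps)

lemma matrix_inv_cancel:
  fixes P :: mat2
  assumes "invertible P"
  shows "matrix_inv P ** P = mat 1" "P ** matrix_inv P = mat 1"
    "matrix_inv P *v (P *v x) = x" "P *v (matrix_inv P *v x) = x"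
proof -
  show 1: "matrix_inv P ** P = mat 1" "P ** matrix_inv P = mat 1"
    using someI_ex[OF assms[unfolded invertible_def]] by (simp_all add: matrix_inv_def)
  then show "matrix_inv P *v (P *v x) = x" "P *v (matrix_inv P *v x) = x"
    by (simp_all add: matrix_vector_mul_assoc)
qed

lemma invertible_matrix_inv:
  fixes P :: mat2
  assumes "invertible P" shows "invertible (matrix_inv P)"
  unfolding invertible_def using matrix_inv_cancel[OF assms] by blast

lemma aut_inverse:
  assumes "invertible P"
  shows "aut (- (matrix_inv P *v \<eta>)) (matrix_inv P) (aut \<eta> P x) = x"
    and "aut \<eta> P (aut (- (matrix_inv P *v \<eta>)) (matrix_inv P) x) = x"
proof -
  have neg: "P *v (- (matrix_inv P *v \<eta>)) = - \<eta>"
    by (simp add: matrix_vector_mult_uminus matrix_inv_cancel(4)[OF assms])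
  show "aut (- (matrix_inv P *v \<eta>)) (matrix_inv P) (aut \<eta> P x) = x"
    "aut \<eta> P (aut (- (matrix_inv P *v \<eta>)) (matrix_inv P) x) = x"
    by (simp_all add: aut_aut neg matrix_inv_cancel assms)
qed

lemma inj_aut: "invertible P \<Longrightarrow> inj (aut \<eta> P)"
  by (metis aut_inverse(1) injI)

lemma \<Gamma>_memI: "(1/2 * of_int a * of_int b + of_int m / real r, vector [of_int a, of_int b]) \<in> \<Gamma> r"
  by (auto simp: \<Gamma>_def intro!: exI[of _ m])

lemma \<Gamma>_memE:
  assumes "x \<in> \<Gamma> r"
  obtains a b m :: int
  where "x = (1/2 * of_int a * of_int b + of_int m / real r, vector [of_int a, of_int b])"
proof -
  obtain z \<xi> m where *: "x = (z, \<xi>)" "\<xi>$1 \<in> \<int>" "\<xi>$2 \<in> \<int>"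
    "z = 1/2 * \<xi>$1 * \<xi>$2 + 1 / real r * of_int (m::int)"
    using assms by (auto simp: \<Gamma>_def)
  then obtain a b :: int where "\<xi>$1 = of_int a" "\<xi>$2 = of_int b"
    by (auto elim!: Ints_cases)
  then have "x = (1/2 * of_int a * of_int b + of_int m / real r, vector [of_int a, of_int b])"
    using * by (simp add: vec_eq_iff forall_2)
  then show thesis by (rule that)
qed

lemma subgroup_\<Gamma>:
  assumes r: "r > 0" shows "subgroup (\<Gamma> r) Heis"
proof (rule Heis.subgroupI)
  show "\<Gamma> r \<noteq> {}" using \<Gamma>_memI by blast
next
  fix x assume "x \<in> \<Gamma> r"
  then obtain a b m where x: "x = (1/2 * of_int a * of_int b + of_int m / real r, vector [of_int a, of_int b])"
    by (rule \<Gamma>_memE)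
  have "inv\<^bsub>Heis\<^esub> x = (1/2 * of_int (-a) * of_int (-b) + of_int (- m - a * b * int r) / real r,
                      vector [of_int (- a), of_int (- b)])"
    using r by (simp add: x vec_eq_iff forall_2 field_simps)
  then show "inv\<^bsub>Heis\<^esub> x \<in> \<Gamma> r" by (metis \<Gamma>_memI)
next
  fix x y assume "x \<in> \<Gamma> r" "y \<in> \<Gamma> r"
  then obtain a b m a' b' m' where
    x: "x = (1/2 * of_int a * of_int b + of_int m / real r, vector [of_int a, of_int b])" and
    y: "y = (1/2 * of_int a' * of_int b' + of_int m' / real r, vector [of_int a', of_int b'])"
    by (metis \<Gamma>_memE)
  have "x \<otimes>\<^bsub>Heis\<^esub> y = (1/2 * of_int (a + a') * of_int (b + b') + of_int (m + m' - a' * b * int r) / real r,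
                      vector [of_int (a + a'), of_int (b + b')])"
    using r by (simp add: x y \<omega>_def vec_eq_iff forall_2 field_simps)
  then show "x \<otimes>\<^bsub>Heis\<^esub> y \<in> \<Gamma> r" by (metis \<Gamma>_memI)
qed auto

lemma \<B>_iff: "(\<xi>, B) \<in> \<B> r \<longleftrightarrow> invertible B \<and> aut \<xi> B ` \<Gamma> r = \<Gamma> r"
  by (simp add: \<B>_def aut_def)

text \<open>An abstract isomorphism maps the centre \<open>(1/r) \<int>\<close> of \<open>\<Gamma> r\<close> into that of \<open>\<Gamma> r'\<close>, and additively:
  \<open>(k/r, 0)\<close> goes to \<open>(k m/r', 0)\<close> for a fixed \<open>m\<close>. The element \<open>(1, 0)\<close> of \<open>\<Gamma> r'\<close> is a commutator, so
  it is the image of a commutator \<open>(n, 0)\<close> of \<open>\<Gamma> r\<close>; hence \<open>n r m = r'\<close>.\<close>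

lemma \<Gamma>_iso_dvd:
  assumes r: "r > 0" "r' > 0"
    and iso: "Heis\<lparr>carrier := \<Gamma> r\<rparr> \<cong> Heis\<lparr>carrier := \<Gamma> r'\<rparr>"
  shows "r dvd r'"
proof -
  interpret S: subgroup "\<Gamma> r" Heis by (rule subgroup_\<Gamma>[OF r(1)])
  obtain h where h: "\<And>x y. x \<in> \<Gamma> r \<Longrightarrow> y \<in> \<Gamma> r \<Longrightarrow> h (x \<otimes>\<^bsub>Heis\<^esub> y) = h x \<otimes>\<^bsub>Heis\<^esub> h y"
    and bij: "bij_betw h (\<Gamma> r) (\<Gamma> r')"
    using iso by (auto simp: is_iso_def iso_def hom_def)
  define a :: heis where "a = (0, vector [1, 0])"
  define b :: heis where "b = (0, vector [0, 1])"
  have ab: "a \<in> \<Gamma> r'" "b \<in> \<Gamma> r'"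
    using \<Gamma>_memI[of 1 0 0 r'] \<Gamma>_memI[of 0 1 0 r'] by (simp_all add: a_def b_def)
  obtain x y where xy: "x \<in> \<Gamma> r" "y \<in> \<Gamma> r" "h x = a" "h y = b"
    using ab bij by (metis bij_betw_imp_surj_on imageE)
  have zc: "(of_int k / real r, 0) \<in> \<Gamma> r" for k :: int
  proof -
    have "vector [0, 0] = (0 :: vec2)" by (simp add: vec_eq_iff forall_2)
    then show ?thesis using \<Gamma>_memI[of 0 0 k r] by simp
  qed
  have im: "h v \<in> \<Gamma> r'" if "v \<in> \<Gamma> r" for v
    using bij that by (auto simp: bij_betw_def)
  \<comment> \<open>the centre is mapped into the centre\<close>
  have center: "snd (h (of_int k / real r, 0)) = 0" for k :: int
  proof -
    define c where "c = h (of_int k / real r, 0)"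
    have "c \<otimes>\<^bsub>Heis\<^esub> h v = h v \<otimes>\<^bsub>Heis\<^esub> c" if "v \<in> \<Gamma> r" for v
      unfolding c_def h[OF zc that, symmetric] h[OF that zc, symmetric]
      by (cases v) (simp add: \<omega>_linear add.commute)
    from this[OF xy(1)] this[OF xy(2)] have "c \<otimes>\<^bsub>Heis\<^esub> a = a \<otimes>\<^bsub>Heis\<^esub> c" "c \<otimes>\<^bsub>Heis\<^esub> b = b \<otimes>\<^bsub>Heis\<^esub> c"
      by (simp_all add: xy)
    then show ?thesis
      by (cases c) (simp add: a_def b_def \<omega>_def vec_eq_iff forall_2 c_def[symmetric])
  qed
  define f where "f k = fst (h (of_int k / real r, 0))" for k :: int
  have hf: "h (of_int k / real r, 0) = (f k, 0)" for k
    using center by (simp add: f_def prod_eq_iff)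
  have f_add: "f (k + l) = f k + f l" for k l
  proof -
    have "(of_int (k + l) / real r, 0::vec2) = (of_int k / real r, 0) \<otimes>\<^bsub>Heis\<^esub> (of_int l / real r, 0)"
      by (simp add: add_divide_distrib \<omega>_linear)
    then show ?thesis
      using h[OF zc[of k] zc[of l]] hf[of k] hf[of l] hf[of "k + l"] by (simp add: \<omega>_linear)
  qed
  have f_nat: "f (int n) = of_nat n * f 1" for n
    using f_add[of 0 0] by (induction n) (simp_all add: f_add algebra_simps)
  have f_lin: "f k = of_int k * f 1" for k
  proof (cases k rule: int_cases2)
    case (nonneg n) then show ?thesis using f_nat by simp
  next
    case (nonpos n)
    then show ?thesis using f_nat[of n] f_add[of "int n" "- int n"] f_add[of 0 0] by simp
  qed
  obtain m where m: "f 1 = of_int m / real r'"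
  proof -
    have "(f 1, 0) \<in> \<Gamma> r'" using im[OF zc[of 1]] hf[of 1] by simp
    then obtain a b m where "(f 1, 0) = (1/2 * of_int a * of_int b + of_int m / real r',
        (vector [of_int a, of_int b] :: vec2))"
      by (rule \<Gamma>_memE)
    then have "f 1 = 1/2 * of_int a * of_int b + of_int m / real r'"
      "(0 :: vec2) = vector [of_int a, of_int b]" by simp_all
    then have "f 1 = of_int m / real r'" by (simp add: vec_eq_iff forall_2)
    then show thesis by (rule that)
  qed
  obtain n :: int where n: "\<omega> (snd x) (snd y) = of_int n"
  proof -
    obtain a b k a' b' k' where
      "x = (1/2 * of_int a * of_int b + of_int k / real r, vector [of_int a, of_int b])"
      "y = (1/2 * of_int a' * of_int b' + of_int k' / real r, vector [of_int a', of_int b'])"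
      using xy(1,2) by (metis \<Gamma>_memE)
    then have "\<omega> (snd x) (snd y) = of_int (a * b' - a' * b)" by (simp add: \<omega>_def)
    then show thesis by (rule that)
  qed
  \<comment> \<open>\<open>(1, 0)\<close> is the commutator of \<open>h x\<close> and \<open>h y\<close>, hence the image of that of \<open>x\<close> and \<open>y\<close>\<close>
  have "x \<otimes>\<^bsub>Heis\<^esub> y = (of_int n, 0) \<otimes>\<^bsub>Heis\<^esub> (y \<otimes>\<^bsub>Heis\<^esub> x)"
    unfolding n[symmetric] by (cases x; cases y) (simp add: \<omega>_def field_simps)
  moreover have "(of_int n :: real) = of_int (n * int r) / real r" using r(1) by simp
  ultimately have "x \<otimes>\<^bsub>Heis\<^esub> y = (of_int (n * int r) / real r, 0) \<otimes>\<^bsub>Heis\<^esub> (y \<otimes>\<^bsub>Heis\<^esub> x)"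
    by (simp only:)
  then have "h x \<otimes>\<^bsub>Heis\<^esub> h y = (f (n * int r), 0) \<otimes>\<^bsub>Heis\<^esub> (h y \<otimes>\<^bsub>Heis\<^esub> h x)"
    by (simp only: h[OF xy(1,2), symmetric] h[OF xy(2,1), symmetric] hf[symmetric]
        h[OF zc S.m_closed[OF xy(2,1)], symmetric])
  then have "f (n * int r) = 1"
    by (simp add: xy a_def b_def \<omega>_def)
  then have "of_int (n * int r) * (of_int m / real r') = 1"
    unfolding f_lin[of "n * int r"] m .
  then have "real_of_int (n * int r * m) = real_of_int (int r')"
    using r(2) by (simp add: divide_eq_eq)
  then have "n * int r * m = int r'"
    by (simp only: of_int_eq_iff)
  moreover have "int r dvd n * int r * m" by simp
  ultimately have "int r dvd int r'" by simp
  then show ?thesis by simp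
qed

lemma \<Gamma>_iso_unique:
  assumes "r > 0" "r' > 0" and "Heis\<lparr>carrier := \<Gamma> r\<rparr> \<cong> Heis\<lparr>carrier := \<Gamma> r'\<rparr>"
  shows "r = r'"
proof (rule dvd_antisym)
  show "r dvd r'" using assms by (rule \<Gamma>_iso_dvd)
  have "Heis\<lparr>carrier := \<Gamma> r'\<rparr> \<cong> Heis\<lparr>carrier := \<Gamma> r\<rparr>"
    using assms(3) group.iso_sym[OF Heis.subgroup_imp_group[OF subgroup_\<Gamma>[OF assms(1)]]] by blast
  then show "r' dvd r" using assms(1,2) by (intro \<Gamma>_iso_dvd)
qed

section \<open>Level sets of the projection and stable letters\<close>

lemma p_Osc_apply [simp]: "p_Osc (z, \<xi>, t) = t"
  by (simp add: p_Osc_def)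

lemma p_Osc_at_level [simp]: "p_Osc (at_level t x) = t"
  by (cases x) (simp add: at_level_def)

lemma p_Osc_mult [simp]: "p_Osc (x \<otimes>\<^bsub>Osc\<^esub> y) = p_Osc x + p_Osc y"
  by (cases x; cases y) simp

lemma p_Osc_inv [simp]: "p_Osc (inv\<^bsub>Osc\<^esub> x) = - p_Osc x"
  by (cases x) simp

lemma p_Osc_nat_pow: "p_Osc (x [^]\<^bsub>Osc\<^esub> (n::nat)) = of_nat n * p_Osc x"
  by (induction n) (simp_all add: algebra_simps)

lemma p_Osc_int_pow [simp]: "p_Osc (x [^]\<^bsub>Osc\<^esub> (k::int)) = of_int k * p_Osc x"
proof (cases k rule: int_cases2)
  case (nonneg n)
  then show ?thesis by (simp only: int_pow_int p_Osc_nat_pow of_int_of_nat_eq)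
next
  case (nonpos n)
  have "x [^]\<^bsub>Osc\<^esub> (- int n) = inv\<^bsub>Osc\<^esub> (x [^]\<^bsub>Osc\<^esub> n)"
    by (rule Osc.int_pow_neg_int) simp
  then show ?thesis
    unfolding nonpos by (simp only: p_Osc_inv p_Osc_nat_pow of_int_minus of_int_of_nat_eq minus_mult_left)
qed

lemma mem_H_in_Osc: "x \<in> H_in_Osc \<longleftrightarrow> p_Osc x = 0"
  by (cases x) (auto simp: H_in_Osc_def at_level_def)

lemma at_level_mult: "at_level 0 x \<otimes>\<^bsub>Osc\<^esub> at_level t y = at_level t (x \<otimes>\<^bsub>Heis\<^esub> y)"
  by (cases x; cases y) (simp add: at_level_def)

lemma inj_at_level: "inj (at_level t)"
  by (auto simp: inj_on_def at_level_def)

lemma conj_exp_boost: "conj_exp s P = matrix_inv P ** boost s ** P"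
  by (simp add: conj_exp_def expA_eq_boost)

lemma Osc_inn_apply: "Osc_inn \<eta> (z, \<xi>, t) =
   (z + \<omega> \<eta> \<xi> - 1/2 * \<omega> \<eta> (boost t *v \<eta>) + 1/2 * \<omega> \<xi> (\<eta> - boost t *v \<eta>), \<xi> + \<eta> - boost t *v \<eta>, t)"
  by (simp add: Osc_inn_def at_level_def H_inn_def expA_eq_boost)

lemma Osc_inn_eq_conjugation:
  "Osc_inn \<eta> x = (0, \<eta>, 0) \<otimes>\<^bsub>Osc\<^esub> x \<otimes>\<^bsub>Osc\<^esub> inv\<^bsub>Osc\<^esub> (0, \<eta>, 0)"
proof -
  show ?thesis
  proof (cases x)
    case (fields z \<xi> t)
    then show ?thesis
      using \<omega>_swap[of \<xi> \<eta>] \<omega>_swap[of "boost t *v \<eta>" \<eta>]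
      by (simp add: Osc_inn_apply matrix_vector_mult_uminus \<omega>_linear field_simps)
  qed
qed

lemma Osc_inn_mult: "Osc_inn \<eta> (x \<otimes>\<^bsub>Osc\<^esub> y) = Osc_inn \<eta> x \<otimes>\<^bsub>Osc\<^esub> Osc_inn \<eta> y"
proof -
  have "c \<otimes>\<^bsub>Osc\<^esub> (x \<otimes>\<^bsub>Osc\<^esub> y) \<otimes>\<^bsub>Osc\<^esub> inv\<^bsub>Osc\<^esub> c =
     c \<otimes>\<^bsub>Osc\<^esub> x \<otimes>\<^bsub>Osc\<^esub> inv\<^bsub>Osc\<^esub> c \<otimes>\<^bsub>Osc\<^esub> (c \<otimes>\<^bsub>Osc\<^esub> y \<otimes>\<^bsub>Osc\<^esub> inv\<^bsub>Osc\<^esub> c)" for c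
    using Osc.inv_solve_left by (simp add: Osc.m_assoc)
  then show ?thesis unfolding Osc_inn_eq_conjugation by blast
qed

lemma Osc_inn_cancel: "Osc_inn \<eta> (Osc_inn (- \<eta>) x) = x"
proof -
  define c :: osc where "c = (0, \<eta>, 0)"
  have "(0, - \<eta>, 0) = inv\<^bsub>Osc\<^esub> c" by (simp add: c_def)
  then have "Osc_inn \<eta> (Osc_inn (- \<eta>) x) =
      c \<otimes>\<^bsub>Osc\<^esub> (inv\<^bsub>Osc\<^esub> c \<otimes>\<^bsub>Osc\<^esub> x \<otimes>\<^bsub>Osc\<^esub> inv\<^bsub>Osc\<^esub> (inv\<^bsub>Osc\<^esub> c)) \<otimes>\<^bsub>Osc\<^esub> inv\<^bsub>Osc\<^esub> c"
    unfolding Osc_inn_eq_conjugation c_def by simp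
  also have "\<dots> = (c \<otimes>\<^bsub>Osc\<^esub> inv\<^bsub>Osc\<^esub> c) \<otimes>\<^bsub>Osc\<^esub> x \<otimes>\<^bsub>Osc\<^esub> (c \<otimes>\<^bsub>Osc\<^esub> inv\<^bsub>Osc\<^esub> c)"
    by (simp only: Osc.m_assoc Osc.inv_inv carrier_Osc UNIV_I)
  also have "\<dots> = x"
    by (simp only: Osc.r_inv Osc.l_one Osc.r_one carrier_Osc UNIV_I)
  finally show ?thesis .
qed

lemma inj_Osc_inn: "inj (Osc_inn \<eta>)"
  using Osc_inn_cancel[of "- \<eta>"] by (intro injI) (metis minus_minus)

lemma p_Osc_Osc_inn [simp]: "p_Osc (Osc_inn \<eta> x) = p_Osc x"
  by (simp add: Osc_inn_eq_conjugation)

lemma Osc_inn_at_level_0: "Osc_inn \<eta> (at_level 0 (H_lin P x)) = at_level 0 (aut \<eta> P x)"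
  by (cases x) (simp add: H_lin_eq_aut at_level_def Osc_inn_apply \<omega>_linear)

text \<open>The generator of \<open>L_of r s (\<eta>, P, h)\<close> outside \<open>H\<close>. The name is that of an HNN extension:
  conjugation by it acts on the generators inside \<open>H\<close>.\<close>

definition stable_letter :: "vec2 \<Rightarrow> mat2 \<Rightarrow> real \<Rightarrow> heis \<Rightarrow> osc" where
  "stable_letter \<eta> P s h = Osc_inn \<eta> (at_level s (H_lin P h))"

lemma p_Osc_stable_letter [simp]: "p_Osc (stable_letter \<eta> P s h) = s"
  by (simp add: stable_letter_def)

lemma L_of_eq_generate:
  "L_of r s (\<eta>, P, h) =
     generate Osc (at_level 0 ` aut \<eta> P ` \<Gamma> r \<union> {stable_letter \<eta> P s h})"
proof -
  obtain z \<xi> where h: "h = (z, \<xi>)" by (cases h)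
  interpret F: group_hom Osc Osc "Osc_inn \<eta>"
  proof unfold_locales
    show "Osc_inn \<eta> \<in> hom Osc Osc"
      by (rule homI) (simp_all only: Osc_inn_mult carrier_Osc UNIV_I)
  qed
  show ?thesis
    by (simp add: L_of_def h F.generate_img[symmetric] image_Un image_image
          Osc_inn_at_level_0 stable_letter_def)
qed

lemma P_conj_exp:
  assumes "invertible P"
  shows "P *v (conj_exp s P *v x) = boost s *v (P *v x)"
  by (simp add: conj_exp_boost matrix_inv_cancel[OF assms] flip: matrix_vector_mul_assoc)

lemma invertible_conj_exp:
  assumes "invertible P" shows "invertible (conj_exp s P)"
proof -
  have "invertible (boost s)" by (simp add: invertible_det_nz)
  then show ?thesis
    unfolding conj_exp_boost by (intro invertible_mult invertible_matrix_inv assms)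
qed

lemma det_conj_exp [simp]:
  assumes "invertible P" shows "det (conj_exp s P) = 1"
proof -
  have "det (matrix_inv P ** P) = 1" by (simp only: matrix_inv_cancel(1)[OF assms] det_I)
  then show ?thesis by (simp add: conj_exp_boost det_mul)
qed

text \<open>In the coordinates \<open>aut \<eta> P\<close> on \<open>H\<close>, conjugation by the stable letter of \<open>(z, \<xi>)\<close> is the automorphism
  with parameters \<open>(\<xi>, P\<^sup>-\<^sup>1 e\<^sup>s\<^sup>A P)\<close>. This is why membership in \<open>\<P> r s\<close> is phrased through \<open>\<B> r\<close>.\<close>

lemma stable_letter_commute:
  assumes P: "invertible P"
  shows "stable_letter \<eta> P s (z, \<xi>) \<otimes>\<^bsub>Osc\<^esub> at_level 0 (aut \<eta> P \<gamma>) =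
         at_level 0 (aut \<eta> P (aut \<xi> (conj_exp s P) \<gamma>)) \<otimes>\<^bsub>Osc\<^esub> stable_letter \<eta> P s (z, \<xi>)"
proof -
  have "at_level s (H_lin P (z, \<xi>)) \<otimes>\<^bsub>Osc\<^esub> at_level 0 (H_lin P \<gamma>) =
        at_level 0 (H_lin P (aut \<xi> (conj_exp s P) \<gamma>)) \<otimes>\<^bsub>Osc\<^esub> at_level s (H_lin P (z, \<xi>))"
    by (cases \<gamma>)
       (simp add: at_level_def H_lin_def P P_conj_exp[OF P] \<omega>_swap[of "boost s *v _"] \<omega>_matrix[symmetric] field_simps)
  then show ?thesis
    by (simp add: stable_letter_def Osc_inn_at_level_0[symmetric] Osc_inn_mult[symmetric])
qed

lemma stable_letter_matrix_mult:
  "stable_letter \<eta> (P ** K) s h = stable_letter \<eta> P s (H_lin K h)"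
  by (cases h) (simp add: stable_letter_def H_lin_def det_mul matrix_vector_mul_assoc mult.assoc)

text \<open>This lemma and its two neighbours explain the formula for the action. If the frame \<open>(\<eta>, P)\<close> is changed
  by \<open>(\<zeta>, K)\<close>, then the stable letter of \<open>h\<close> in the new frame is, in the old one, the stable letter of
  \<open>(0, \<zeta>) (H_lin K h) (0, - B \<zeta>)\<close>; and multiplying a stable letter by an element of \<open>L \<inter> H\<close> with coordinates \<open>\<gamma>\<close>
  replaces \<open>h\<close> by \<open>\<gamma> h\<close>.\<close>

lemma stable_letter_shift:
  assumes P: "invertible P"
  shows "stable_letter (\<eta> + P *v \<zeta>) P s h =
    stable_letter \<eta> P s ((0, \<zeta>) \<otimes>\<^bsub>Heis\<^esub> h \<otimes>\<^bsub>Heis\<^esub> (0, - (conj_exp s P *v \<zeta>)))"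
proof -
  obtain z \<xi> where h: "h = (z, \<xi>)" by (cases h)
  have "det P * \<omega> \<zeta> \<xi> = \<omega> (P *v \<zeta>) (P *v \<xi>)"
    "det P * \<omega> \<zeta> (conj_exp s P *v \<zeta>) = \<omega> (P *v \<zeta>) (boost s *v (P *v \<zeta>))"
    "det P * \<omega> \<xi> (conj_exp s P *v \<zeta>) = \<omega> (P *v \<xi>) (boost s *v (P *v \<zeta>))"
    by (simp_all add: \<omega>_matrix[of P, symmetric] P_conj_exp[OF P])
  then have "det P * (z + \<omega> \<zeta> \<xi> / 2 + \<omega> (\<zeta> + \<xi>) (- (conj_exp s P *v \<zeta>)) / 2) =
     det P * z + \<omega> (P *v \<zeta>) (P *v \<xi>) / 2
      - (\<omega> (P *v \<zeta>) (boost s *v (P *v \<zeta>)) + \<omega> (P *v \<xi>) (boost s *v (P *v \<zeta>))) / 2"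
    by (simp add: \<omega>_linear algebra_simps add_divide_distrib diff_divide_distrib)
  then show ?thesis
    using \<omega>_swap[of "P *v \<xi>" \<eta>] \<omega>_swap[of "P *v \<zeta>" \<eta>] \<omega>_swap[of "boost s *v (P *v \<zeta>)" \<eta>]
      \<omega>_swap[of "P *v \<xi>" "P *v \<zeta>"]
    by (simp add: h stable_letter_def H_lin_def at_level_def Osc_inn_apply matrix_vector_mult_uminus P_conj_exp[OF P]
          matrix_vector_right_distrib matrix_vector_mult_diff_distrib)
       (simp add: \<omega>_linear algebra_simps add_divide_distrib diff_divide_distrib)
qed

lemma at_level_0_mult_stable_letter:
  "at_level 0 (aut \<eta> P \<gamma>) \<otimes>\<^bsub>Osc\<^esub> stable_letter \<eta> P s h = stable_letter \<eta> P s (\<gamma> \<otimes>\<^bsub>Heis\<^esub> h)"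
proof -
  have "H_lin P (\<gamma> \<otimes>\<^bsub>Heis\<^esub> h) = H_lin P \<gamma> \<otimes>\<^bsub>Heis\<^esub> H_lin P h"
    by (simp add: H_lin_eq_aut aut_mult)
  then show ?thesis
    by (simp add: stable_letter_def Osc_inn_at_level_0[symmetric] Osc_inn_mult[symmetric]
         at_level_mult)
qed

lemma inj_stable_letter:
  assumes "invertible P" shows "inj (stable_letter \<eta> P s)"
proof -
  have "stable_letter \<eta> P s = Osc_inn \<eta> \<circ> at_level s \<circ> aut 0 P"
    by (simp add: fun_eq_iff stable_letter_def H_lin_eq_aut)
  then show ?thesis
    by (simp only: inj_compose inj_Osc_inn inj_at_level inj_aut[OF assms])
qed

lemma stable_letter_surj:
  assumes "invertible P" "p_Osc g = s"
  obtains h where "g = stable_letter \<eta> P s h"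
proof -
  obtain x where x: "Osc_inn (- \<eta>) g = at_level s x"
  proof -
    have "p_Osc (Osc_inn (- \<eta>) g) = s" using assms by simp
    then show thesis
      using that by (cases "Osc_inn (- \<eta>) g") (auto simp: at_level_def split: prod.splits)
  qed
  have "g = stable_letter \<eta> P s (aut (- (matrix_inv P *v 0)) (matrix_inv P) x)"
    unfolding stable_letter_def H_lin_eq_aut aut_inverse(2)[OF assms(1)] x[symmetric] Osc_inn_cancel ..
  then show thesis by (rule that)
qed

text \<open>The elements that normalise \<open>N\<close> form a subgroup, so all integer powers of \<open>g\<close> normalise \<open>N\<close>.\<close>

lemma (in group) generate_normalized_extension:
  assumes N: "subgroup N G" and g: "g \<in> carrier G"
    and norm: "\<And>n. n \<in> carrier G \<Longrightarrow> g \<otimes> n \<otimes> inv g \<in> N \<longleftrightarrow> n \<in> N"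
  shows "generate G (N \<union> {g}) = {n \<otimes> g [^] (k::int) | n k. n \<in> N}"
proof (rule generateI[symmetric])
  define T where "T = {x \<in> carrier G. \<forall>n \<in> carrier G. x \<otimes> n \<otimes> inv x \<in> N \<longleftrightarrow> n \<in> N}"
  have T: "subgroup T G"
  proof (rule subgroupI)
    show "T \<subseteq> carrier G" by (auto simp: T_def)
    have "\<one> \<in> T" by (auto simp: T_def)
    then show "T \<noteq> {}" by blast
  next
    fix x assume x: "x \<in> T"
    have "inv x \<otimes> n \<otimes> x \<in> N \<longleftrightarrow> n \<in> N" if n: "n \<in> carrier G" for n
    proof -
      have "x \<otimes> (inv x \<otimes> n \<otimes> x) \<otimes> inv x = n"
        using x n by (simp add: T_def m_assoc) (simp flip: m_assoc)
      moreover have "inv x \<otimes> n \<otimes> x \<in> carrier G" using x n by (simp add: T_def)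
      ultimately show ?thesis using x unfolding T_def by force
    qed
    then show "inv x \<in> T" using x by (simp add: T_def)
  next
    fix x y assume xy: "x \<in> T" "y \<in> T"
    have "x \<otimes> y \<otimes> n \<otimes> inv (x \<otimes> y) \<in> N \<longleftrightarrow> n \<in> N" if n: "n \<in> carrier G" for n
    proof -
      have "x \<otimes> y \<otimes> n \<otimes> inv (x \<otimes> y) = x \<otimes> (y \<otimes> n \<otimes> inv y) \<otimes> inv x"
        using xy n by (simp add: T_def m_assoc inv_mult_group)
      moreover have "y \<otimes> n \<otimes> inv y \<in> carrier G" using xy n by (simp add: T_def)
      ultimately show ?thesis using xy n unfolding T_def by force
    qed
    then show "x \<otimes> y \<in> T" using xy by (simp add: T_def)
  qed
  have "g \<in> T" using g norm by (simp add: T_def)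
  then have gT: "g [^] (k::int) \<in> T" for k
    by (rule subgroup_int_pow_closed[OF T])
  have conj: "g [^] k \<otimes> n \<otimes> inv (g [^] k) \<in> N" if "n \<in> N" for n and k :: int
    using gT[of k] that subgroup.mem_carrier[OF N that] by (simp add: T_def)
  let ?W = "{n \<otimes> g [^] (k::int) | n k. n \<in> N}"
  have Nc: "n \<in> carrier G" if "n \<in> N" for n using subgroup.mem_carrier[OF N that] .
  show "subgroup ?W G"
  proof (rule subgroupI)
    show "?W \<subseteq> carrier G" using Nc g by auto
    show "?W \<noteq> {}" using subgroup.one_closed[OF N] by blast
  next
    fix x assume "x \<in> ?W"
    then obtain n k where x: "x = n \<otimes> g [^] (k::int)" "n \<in> N" by blast
    have "inv x = (g [^] (- k) \<otimes> inv n \<otimes> inv (g [^] (- k))) \<otimes> g [^] (- k)"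
      using x Nc g by (simp add: inv_mult_group int_pow_neg m_assoc)
    then show "inv x \<in> ?W" using conj[OF subgroup.m_inv_closed[OF N x(2)], of "- k"] by blast
  next
    fix x y assume "x \<in> ?W" "y \<in> ?W"
    then obtain n k n' k' where x: "x = n \<otimes> g [^] (k::int)" "n \<in> N" and
      y: "y = n' \<otimes> g [^] (k'::int)" "n' \<in> N" by blast
    have "x \<otimes> y = (n \<otimes> (g [^] k \<otimes> n' \<otimes> inv (g [^] k))) \<otimes> g [^] (k + k')"
      using x y Nc g by (simp add: m_assoc int_pow_mult[symmetric]) (simp add: int_pow_mult flip: m_assoc)
    then show "x \<otimes> y \<in> ?W" using conj[OF y(2), of k] subgroup.m_closed[OF N x(2)] by blast
  qed
  show "N \<union> {g} \<subseteq> ?W"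
  proof -
    have "n = n \<otimes> g [^] (0::int)" if "n \<in> N" for n using Nc[OF that] by simp
    moreover have "g = \<one> \<otimes> g [^] (1::int)" using g by (simp add: int_pow_1)
    ultimately show ?thesis using subgroup.one_closed[OF N] by blast
  qed
  fix K assume K: "subgroup K G" "N \<union> {g} \<subseteq> K"
  then show "?W \<subseteq> K"
    using subgroup.m_closed[OF K(1)] subgroup_int_pow_closed[OF K(1)] by blast
qed

section \<open>Framed subgroups and the parametrisation\<close>

text \<open>The frame \<open>(\<eta>, P)\<close> identifies \<open>\<Gamma> r\<close> with \<open>L \<inter> H\<close>. It is not determined by \<open>L\<close>; the remaining freedom
  is \<open>\<B> r\<close>.\<close>

definition framed :: "vec2 \<Rightarrow> mat2 \<Rightarrow> nat \<Rightarrow> real \<Rightarrow> osc set \<Rightarrow> bool" where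
  "framed \<eta> P r s L \<longleftrightarrow> r > 0 \<and> s > 0 \<and> invertible P \<and> subgroup L Osc \<and>
     L \<inter> H_in_Osc = at_level 0 ` aut \<eta> P ` \<Gamma> r \<and> p_Osc ` L = {s * of_int n | n::int. True}"

lemma framed_r_inv:
  assumes "framed \<eta> P r s L" shows "r_inv L = r"
proof -
  have r: "r > 0" and P: "invertible P" and H: "L \<inter> H_in_Osc = at_level 0 ` aut \<eta> P ` \<Gamma> r"
    using assms by (auto simp: framed_def)
  have "at_level 0 \<circ> aut \<eta> P \<in> iso (Heis\<lparr>carrier := \<Gamma> r\<rparr>) (Osc\<lparr>carrier := L \<inter> H_in_Osc\<rparr>)"
  proof (rule isoI)
    show "at_level 0 \<circ> aut \<eta> P \<in> hom (Heis\<lparr>carrier := \<Gamma> r\<rparr>) (Osc\<lparr>carrier := L \<inter> H_in_Osc\<rparr>)"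
      by (rule homI) (simp_all add: H at_level_mult aut_mult)
    have "inj (at_level 0 \<circ> aut \<eta> P)" by (intro inj_compose inj_at_level inj_aut P)
    then show "bij_betw (at_level 0 \<circ> aut \<eta> P) (carrier (Heis\<lparr>carrier := \<Gamma> r\<rparr>))
        (carrier (Osc\<lparr>carrier := L \<inter> H_in_Osc\<rparr>))"
      by (auto simp: bij_betw_def H image_comp intro: inj_on_subset)
  qed
  then have iso: "Heis\<lparr>carrier := \<Gamma> r\<rparr> \<cong> Osc\<lparr>carrier := L \<inter> H_in_Osc\<rparr>"
    by (auto simp: is_iso_def)
  have grp: "group (Heis\<lparr>carrier := \<Gamma> r\<rparr>)"
    by (rule Heis.subgroup_imp_group[OF subgroup_\<Gamma>[OF r]])
  show ?thesis
    unfolding r_inv_def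
  proof (rule the_equality)
    show "r > 0 \<and> Osc\<lparr>carrier := L \<inter> H_in_Osc\<rparr> \<cong> Heis\<lparr>carrier := \<Gamma> r\<rparr>"
      using r group.iso_sym[OF grp iso] by simp
  next
    fix r' assume "r' > 0 \<and> Osc\<lparr>carrier := L \<inter> H_in_Osc\<rparr> \<cong> Heis\<lparr>carrier := \<Gamma> r'\<rparr>"
    then have "r' > 0" "Heis\<lparr>carrier := \<Gamma> r\<rparr> \<cong> Heis\<lparr>carrier := \<Gamma> r'\<rparr>"
      using iso_trans[OF iso] by blast+
    then show "r' = r"
      using \<Gamma>_iso_unique[OF r, of r'] by blast
  qed
qed

lemma framed_s_inv:
  assumes "framed \<eta> P r s L" shows "s_inv L = s"
proof -
  have s: "s > 0" and p: "p_Osc ` L = {s * of_int n | n::int. True}"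
    using assms by (auto simp: framed_def)
  show ?thesis
    unfolding s_inv_def
  proof (rule the_equality)
    fix s' assume s': "s' > 0 \<and> p_Osc ` L = {s' * of_int n | n::int. True}"
    have 1: "s = s'" if "s = s' * of_int n" "s' = s * of_int m" for n m :: int
    proof -
      have "s * of_int (m * n) = s * of_int m * of_int n" by simp
      also have "\<dots> = s * of_int 1"
        unfolding that(2)[symmetric] that(1)[symmetric] by simp
      finally have "m * n = 1" using s by (simp only: mult_cancel_left of_int_eq_iff) simp
      moreover have "n > 0"
      proof -
        have "0 < s' * real_of_int n" using s unfolding that(1)[symmetric] .
        then show ?thesis using s' by (simp add: zero_less_mult_iff)
      qed
      ultimately have "n = 1" by (simp add: zmult_eq_1_iff)
      then show ?thesis using that(1) by simp
    qed
    have eq: "{s * of_int n | n::int. True} = {s' * of_int n | n::int. True}"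
      using p s' by simp
    have "s * of_int 1 \<in> {s * of_int n | n::int. True}" by blast
    then obtain n where n: "s * of_int 1 = s' * of_int n" unfolding eq by blast
    have "s' * of_int 1 \<in> {s' * of_int n | n::int. True}" by blast
    then obtain m where m: "s' * of_int 1 = s * of_int m" unfolding eq[symmetric] by blast
    have "s = s'"
      using n m by (intro 1[of n m]) (simp_all only: of_int_1 mult_1_right)
    then show "s' = s" ..
  qed (use s p in simp)
qed

lemma framed_eq_generate:
  assumes L: "framed \<eta> P r s L" and g: "g \<in> L" "p_Osc g = s"
  shows "L = generate Osc (at_level 0 ` aut \<eta> P ` \<Gamma> r \<union> {g})"
proof -
  let ?N = "at_level 0 ` aut \<eta> P ` \<Gamma> r"
  have sub: "subgroup L Osc" and H: "L \<inter> H_in_Osc = ?N" and p: "p_Osc ` L = {s * of_int n | n::int. True}"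
    using L by (auto simp: framed_def)
  have gen: "subgroup (generate Osc (?N \<union> {g})) Osc"
    by (rule Osc.generate_is_subgroup) simp
  show ?thesis
  proof (rule antisym)
    show "generate Osc (?N \<union> {g}) \<subseteq> L"
      using H g by (intro Osc.generate_subgroup_incl[OF _ sub]) blast
  next
    show "L \<subseteq> generate Osc (?N \<union> {g})"
    proof
      fix x assume x: "x \<in> L"
      then obtain n :: int where n: "p_Osc x = s * of_int n" using p by blast
      define y where "y = x \<otimes>\<^bsub>Osc\<^esub> inv\<^bsub>Osc\<^esub> (g [^]\<^bsub>Osc\<^esub> n)"
      have gn: "g [^]\<^bsub>Osc\<^esub> n \<in> L" using g(1) by (rule Osc.subgroup_int_pow_closed[OF sub])
      have "y \<in> L"
        unfolding y_def using x gn subgroup.m_closed[OF sub] subgroup.m_inv_closed[OF sub] by blast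
      moreover have "p_Osc y = 0" by (simp add: y_def n g(2))
      ultimately have "y \<in> ?N" using H mem_H_in_Osc by blast
      moreover have "x = y \<otimes>\<^bsub>Osc\<^esub> (g [^]\<^bsub>Osc\<^esub> n)"
        unfolding y_def by (simp only: Osc.m_assoc Osc.l_inv Osc.r_one carrier_Osc UNIV_I)
      moreover have "g [^]\<^bsub>Osc\<^esub> n \<in> generate Osc (?N \<union> {g})"
        by (rule Osc.subgroup_int_pow_closed[OF gen]) (simp add: generate.incl)
      ultimately show "x \<in> generate Osc (?N \<union> {g})"
        using subgroup.m_closed[OF gen] generate.incl[of y "?N \<union> {g}" Osc] by simp
    qed
  qed
qed

text \<open>By \<open>stable_letter_commute\<close>, both sides say that \<open>aut \<xi> B\<close> maps \<open>\<Gamma> r\<close> onto itself.\<close>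

lemma normalizes_iff_\<B>:
  assumes P: "invertible P"
  shows "(\<forall>n. stable_letter \<eta> P s (z, \<xi>) \<otimes>\<^bsub>Osc\<^esub> n \<otimes>\<^bsub>Osc\<^esub> inv\<^bsub>Osc\<^esub> stable_letter \<eta> P s (z, \<xi>) \<in> at_level 0 ` aut \<eta> P ` \<Gamma> r
             \<longleftrightarrow> n \<in> at_level 0 ` aut \<eta> P ` \<Gamma> r) \<longleftrightarrow> (\<xi>, conj_exp s P) \<in> \<B> r"
proof -
  define E where "E = at_level 0 \<circ> aut \<eta> P"
  define C where "C = aut \<xi> (conj_exp s P)"
  let ?g = "stable_letter \<eta> P s (z, \<xi>)"
  have injE: "inj E" unfolding E_def by (intro inj_compose inj_at_level inj_aut P)
  have B: "invertible (conj_exp s P)" by (rule invertible_conj_exp[OF P])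
  have conj: "?g \<otimes>\<^bsub>Osc\<^esub> E \<gamma> \<otimes>\<^bsub>Osc\<^esub> inv\<^bsub>Osc\<^esub> ?g = E (C \<gamma>)" for \<gamma>
    unfolding E_def C_def o_apply stable_letter_commute[OF P]
    by (simp only: Osc.m_assoc Osc.r_inv Osc.r_one carrier_Osc UNIV_I)
  have E: "at_level 0 ` aut \<eta> P ` \<Gamma> r = E ` \<Gamma> r" by (simp add: E_def image_comp)
  have range: "n \<in> range E" if "p_Osc n = 0" for n
  proof -
    define x where "x = (fst n, fst (snd n))"
    have "n = at_level 0 x" using that by (cases n) (simp add: at_level_def x_def)
    then have "n = E (aut (- (matrix_inv P *v \<eta>)) (matrix_inv P) x)"
      by (simp add: E_def aut_inverse[OF P])
    then show ?thesis by blast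
  qed
  have pE: "p_Osc (E \<gamma>) = 0" for \<gamma> by (simp add: E_def)
  have "(\<forall>n. ?g \<otimes>\<^bsub>Osc\<^esub> n \<otimes>\<^bsub>Osc\<^esub> inv\<^bsub>Osc\<^esub> ?g \<in> E ` \<Gamma> r \<longleftrightarrow> n \<in> E ` \<Gamma> r) \<longleftrightarrow>
        (\<forall>\<gamma>. C \<gamma> \<in> \<Gamma> r \<longleftrightarrow> \<gamma> \<in> \<Gamma> r)"
  proof
    assume *: "\<forall>n. ?g \<otimes>\<^bsub>Osc\<^esub> n \<otimes>\<^bsub>Osc\<^esub> inv\<^bsub>Osc\<^esub> ?g \<in> E ` \<Gamma> r \<longleftrightarrow> n \<in> E ` \<Gamma> r"
    show "\<forall>\<gamma>. C \<gamma> \<in> \<Gamma> r \<longleftrightarrow> \<gamma> \<in> \<Gamma> r"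
      using *[rule_format, of "E _", unfolded conj] by (simp add: inj_image_mem_iff[OF injE])
  next
    assume *: "\<forall>\<gamma>. C \<gamma> \<in> \<Gamma> r \<longleftrightarrow> \<gamma> \<in> \<Gamma> r"
    show "\<forall>n. ?g \<otimes>\<^bsub>Osc\<^esub> n \<otimes>\<^bsub>Osc\<^esub> inv\<^bsub>Osc\<^esub> ?g \<in> E ` \<Gamma> r \<longleftrightarrow> n \<in> E ` \<Gamma> r"
    proof
      fix n
      show "?g \<otimes>\<^bsub>Osc\<^esub> n \<otimes>\<^bsub>Osc\<^esub> inv\<^bsub>Osc\<^esub> ?g \<in> E ` \<Gamma> r \<longleftrightarrow> n \<in> E ` \<Gamma> r"
      proof (cases "p_Osc n = 0")
        case True
        then obtain \<gamma> where "n = E \<gamma>" using range by blast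
        then show ?thesis using * by (simp only: conj inj_image_mem_iff[OF injE])
      next
        case False
        then have "p_Osc (?g \<otimes>\<^bsub>Osc\<^esub> n \<otimes>\<^bsub>Osc\<^esub> inv\<^bsub>Osc\<^esub> ?g) \<noteq> 0" by simp
        then show ?thesis using False pE by (metis imageE)
      qed
    qed
  qed
  also have "\<dots> \<longleftrightarrow> C ` \<Gamma> r = \<Gamma> r"
  proof
    assume *: "\<forall>\<gamma>. C \<gamma> \<in> \<Gamma> r \<longleftrightarrow> \<gamma> \<in> \<Gamma> r"
    have "\<gamma> \<in> C ` \<Gamma> r" if "\<gamma> \<in> \<Gamma> r" for \<gamma>
      using aut_inverse(2)[OF B, of \<xi> \<gamma>] * that unfolding C_def by (metis image_eqI)
    then show "C ` \<Gamma> r = \<Gamma> r" using * by blast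
  next
    assume *: "C ` \<Gamma> r = \<Gamma> r"
    have "inj C" unfolding C_def by (rule inj_aut[OF B])
    then show "\<forall>\<gamma>. C \<gamma> \<in> \<Gamma> r \<longleftrightarrow> \<gamma> \<in> \<Gamma> r"
      using * inj_image_mem_iff by metis
  qed
  finally show ?thesis unfolding E C_def \<B>_iff using B by simp
qed

lemma L_of_framed:
  assumes r: "r > 0" and s: "s > 0" and x: "(\<eta>, P, h) \<in> \<P> r s"
  shows "framed \<eta> P r s (L_of r s (\<eta>, P, h))"
    and "{x \<in> L_of r s (\<eta>, P, h). p_Osc x = s} = stable_letter \<eta> P s ` (\<lambda>\<gamma>. \<gamma> \<otimes>\<^bsub>Heis\<^esub> h) ` \<Gamma> r"
proof -
  obtain z \<xi> where h: "h = (z, \<xi>)" by (cases h)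
  have P: "invertible P" and B: "(\<xi>, conj_exp s P) \<in> \<B> r"
    using x by (auto simp: \<P>_def h)
  let ?N = "at_level 0 ` aut \<eta> P ` \<Gamma> r" and ?g = "stable_letter \<eta> P s h"
  have E: "?N = (at_level 0 \<circ> aut \<eta> P) ` \<Gamma> r" by (simp add: image_comp)
  have N: "subgroup ?N Osc"
  proof -
    interpret F: group_hom Heis Osc "at_level 0 \<circ> aut \<eta> P"
    proof unfold_locales
      show "at_level 0 \<circ> aut \<eta> P \<in> hom Heis Osc"
        by (rule homI) (simp_all only: o_apply at_level_mult aut_mult carrier_Osc UNIV_I)
    qed
    show ?thesis unfolding E by (rule F.subgroup_img_is_subgroup[OF subgroup_\<Gamma>[OF r]])
  qed
  have L: "L_of r s (\<eta>, P, h) = {n \<otimes>\<^bsub>Osc\<^esub> ?g [^]\<^bsub>Osc\<^esub> (k::int) | n k. n \<in> ?N}"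
    unfolding L_of_eq_generate
  proof (rule Osc.generate_normalized_extension[OF N])
    show "?g \<otimes>\<^bsub>Osc\<^esub> n \<otimes>\<^bsub>Osc\<^esub> inv\<^bsub>Osc\<^esub> ?g \<in> ?N \<longleftrightarrow> n \<in> ?N" for n
      using B normalizes_iff_\<B>[OF P, of \<eta> s z \<xi> r] unfolding h by blast
  qed simp
  have pN: "p_Osc n = 0" if "n \<in> ?N" for n using that by auto
  have level: "x \<in> L_of r s (\<eta>, P, h) \<and> p_Osc x = s * of_int k \<longleftrightarrow>
      (\<exists>n \<in> ?N. x = n \<otimes>\<^bsub>Osc\<^esub> ?g [^]\<^bsub>Osc\<^esub> (k::int))" for x k
  proof
    assume x: "x \<in> L_of r s (\<eta>, P, h) \<and> p_Osc x = s * of_int k"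
    then obtain n k' where n: "n \<in> ?N" "x = n \<otimes>\<^bsub>Osc\<^esub> ?g [^]\<^bsub>Osc\<^esub> (k'::int)" unfolding L by blast
    then have "k' = k" using x pN[OF n(1)] s by simp
    then show "\<exists>n \<in> ?N. x = n \<otimes>\<^bsub>Osc\<^esub> ?g [^]\<^bsub>Osc\<^esub> k" using n by blast
  next
    assume "\<exists>n \<in> ?N. x = n \<otimes>\<^bsub>Osc\<^esub> ?g [^]\<^bsub>Osc\<^esub> k"
    then obtain n where n: "n \<in> ?N" "x = n \<otimes>\<^bsub>Osc\<^esub> ?g [^]\<^bsub>Osc\<^esub> k" by blast
    then have "p_Osc x = s * of_int k" using pN[OF n(1)] by simp
    then show "x \<in> L_of r s (\<eta>, P, h) \<and> p_Osc x = s * of_int k" using n unfolding L by blast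
  qed
  have "L_of r s (\<eta>, P, h) \<inter> H_in_Osc = ?N"
  proof (rule Set.set_eqI)
    fix x
    show "x \<in> L_of r s (\<eta>, P, h) \<inter> H_in_Osc \<longleftrightarrow> x \<in> ?N"
      using level[of x 0] unfolding Int_iff mem_H_in_Osc
      by (simp only: of_int_0 mult_zero_right int_pow_0 Osc.r_one carrier_Osc UNIV_I) blast
  qed
  moreover have "p_Osc ` L_of r s (\<eta>, P, h) = {s * of_int n | n::int. True}"
  proof -
    have "\<one>\<^bsub>Osc\<^esub> \<in> ?N" by (rule subgroup.one_closed[OF N])
    have "s * of_int k \<in> p_Osc ` L_of r s (\<eta>, P, h)" for k
    proof -
      let ?x = "\<one>\<^bsub>Osc\<^esub> \<otimes>\<^bsub>Osc\<^esub> ?g [^]\<^bsub>Osc\<^esub> k"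
      have "?x \<in> L_of r s (\<eta>, P, h) \<and> p_Osc ?x = s * of_int k"
        using \<open>\<one>\<^bsub>Osc\<^esub> \<in> ?N\<close> unfolding level by blast
      then show ?thesis by (metis image_eqI)
    qed
    moreover have "p_Osc x \<in> {s * of_int n | n::int. True}" if "x \<in> L_of r s (\<eta>, P, h)" for x
    proof -
      obtain n k where n: "n \<in> ?N" "x = n \<otimes>\<^bsub>Osc\<^esub> ?g [^]\<^bsub>Osc\<^esub> (k::int)" using \<open>x \<in> _\<close> unfolding L by blast
      then have "p_Osc x = s * of_int k" using pN[OF n(1)] by simp
      then show ?thesis by blast
    qed
    ultimately show ?thesis by blast
  qed
  moreover have "subgroup (L_of r s (\<eta>, P, h)) Osc"
    unfolding L_of_eq_generate by (rule Osc.generate_is_subgroup) simp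
  ultimately show "framed \<eta> P r s (L_of r s (\<eta>, P, h))"
    using r s P by (simp add: framed_def)
  have "{x \<in> L_of r s (\<eta>, P, h). p_Osc x = s} = (\<lambda>n. n \<otimes>\<^bsub>Osc\<^esub> ?g) ` ?N"
  proof (rule Set.set_eqI)
    fix x
    show "x \<in> {x \<in> L_of r s (\<eta>, P, h). p_Osc x = s} \<longleftrightarrow> x \<in> (\<lambda>n. n \<otimes>\<^bsub>Osc\<^esub> ?g) ` ?N"
      using level[of x 1] unfolding mem_Collect_eq
      by (simp only: of_int_1 mult_1_right Osc.int_pow_1 carrier_Osc UNIV_I) blast
  qed
  also have "\<dots> = stable_letter \<eta> P s ` (\<lambda>\<gamma>. \<gamma> \<otimes>\<^bsub>Heis\<^esub> h) ` \<Gamma> r"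
    by (simp only: image_image at_level_0_mult_stable_letter)
  finally show "{x \<in> L_of r s (\<eta>, P, h). p_Osc x = s} = stable_letter \<eta> P s ` (\<lambda>\<gamma>. \<gamma> \<otimes>\<^bsub>Heis\<^esub> h) ` \<Gamma> r" .
qed

text \<open>A framed subgroup normalises its intersection with \<open>H\<close>, so each of its elements of level \<open>s\<close> yields
  a parameter. Applied to two frames of the same subgroup this gives the invariance of \<open>L_of\<close> under the
  action, without any computation in \<open>\<B> r\<close>.\<close>

lemma framed_eq_L_of:
  assumes "framed \<eta> P r s L" and h: "stable_letter \<eta> P s h \<in> L"
  shows "(\<eta>, P, h) \<in> \<P> r s" "L = L_of r s (\<eta>, P, h)"
proof -
  have P: "invertible P" and L: "subgroup L Osc" and H: "L \<inter> H_in_Osc = at_level 0 ` aut \<eta> P ` \<Gamma> r"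
    using assms by (auto simp: framed_def)
  define g where "g = stable_letter \<eta> P s h"
  have g: "g \<in> L" "p_Osc g = s" using h by (simp_all add: g_def)
  obtain z \<xi> where h': "h = (z, \<xi>)" by (cases h)
  have "g \<otimes>\<^bsub>Osc\<^esub> n \<otimes>\<^bsub>Osc\<^esub> inv\<^bsub>Osc\<^esub> g \<in> L \<inter> H_in_Osc \<longleftrightarrow> n \<in> L \<inter> H_in_Osc" for n
  proof -
    have "n = inv\<^bsub>Osc\<^esub> g \<otimes>\<^bsub>Osc\<^esub> (g \<otimes>\<^bsub>Osc\<^esub> n \<otimes>\<^bsub>Osc\<^esub> inv\<^bsub>Osc\<^esub> g) \<otimes>\<^bsub>Osc\<^esub> g"
    proof -
      have "inv\<^bsub>Osc\<^esub> g \<otimes>\<^bsub>Osc\<^esub> (g \<otimes>\<^bsub>Osc\<^esub> n \<otimes>\<^bsub>Osc\<^esub> inv\<^bsub>Osc\<^esub> g) \<otimes>\<^bsub>Osc\<^esub> g =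
         (inv\<^bsub>Osc\<^esub> g \<otimes>\<^bsub>Osc\<^esub> g) \<otimes>\<^bsub>Osc\<^esub> n \<otimes>\<^bsub>Osc\<^esub> (inv\<^bsub>Osc\<^esub> g \<otimes>\<^bsub>Osc\<^esub> g)"
        by (simp only: Osc.m_assoc carrier_Osc UNIV_I)
      then show ?thesis
        by (simp only: Osc.l_inv Osc.r_one Osc.l_one carrier_Osc UNIV_I)
    qed
    then have "g \<otimes>\<^bsub>Osc\<^esub> n \<otimes>\<^bsub>Osc\<^esub> inv\<^bsub>Osc\<^esub> g \<in> L \<longleftrightarrow> n \<in> L"
      using g(1) subgroup.m_closed[OF L] subgroup.m_inv_closed[OF L] by metis
    then show ?thesis by (simp add: mem_H_in_Osc)
  qed
  then have "(\<xi>, conj_exp s P) \<in> \<B> r"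
    using normalizes_iff_\<B>[OF P, of \<eta> s z \<xi> r] unfolding H g_def h' by blast
  then show "(\<eta>, P, h) \<in> \<P> r s" using P by (simp add: \<P>_def h')
  show "L = L_of r s (\<eta>, P, h)"
    unfolding L_of_eq_generate g_def[symmetric] by (rule framed_eq_generate[OF assms(1) g])
qed

lemma framed_obtain_param:
  assumes "framed \<eta> P r s L"
  obtains h where "(\<eta>, P, h) \<in> \<P> r s" "L = L_of r s (\<eta>, P, h)"
proof -
  have P: "invertible P" and p: "p_Osc ` L = {s * of_int n | n::int. True}"
    using assms by (auto simp: framed_def)
  have "s * of_int 1 \<in> p_Osc ` L" unfolding p by blast
  then obtain g where g: "g \<in> L" "p_Osc g = s" by auto
  obtain h where h: "g = stable_letter \<eta> P s h"
    using stable_letter_surj[OF P g(2)] .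
  then have "stable_letter \<eta> P s h \<in> L" using g(1) by simp
  from framed_eq_L_of[OF assms this] show thesis by (rule that)
qed

lemma image_aut_aut: "aut (\<eta> + P *v \<zeta>) (P ** K) ` X = aut \<eta> P ` aut \<zeta> K ` X"
  by (simp add: image_image aut_aut)

lemma L_of_act:
  assumes r: "r > 0" and s: "s > 0" and x: "x \<in> \<P> r s" and g: "g \<in> carrier (\<Gamma>\<B> r)"
  shows "act s x g \<in> \<P> r s" "L_of r s (act s x g) = L_of r s x"
proof -
  obtain \<eta> P z \<xi> where x': "x = (\<eta>, P, (z, \<xi>))" by (cases x)
  obtain k l \<zeta> K where g': "g = ((k, l), (\<zeta>, K))" by (cases g) auto
  have kl: "(k, l) \<in> \<Gamma> r" and K: "invertible K" "aut \<zeta> K ` \<Gamma> r = \<Gamma> r"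
    using g by (auto simp: \<Gamma>\<B>_def g' \<B>_iff)
  define B where "B = conj_exp s P"
  define w where "w = (0, - \<zeta>) \<otimes>\<^bsub>Heis\<^esub> inv\<^bsub>Heis\<^esub> (k, l) \<otimes>\<^bsub>Heis\<^esub> (z, \<xi>) \<otimes>\<^bsub>Heis\<^esub> (0, B *v \<zeta>)"
  have act: "act s x g = (\<eta> + P *v \<zeta>, P ** K, H_lin (matrix_inv K) w)"
    by (simp add: x' g' act_def w_def B_def)
  let ?L = "L_of r s x"
  have framed: "framed \<eta> P r s ?L"
    using L_of_framed(1)[OF r s] x by (simp add: x')
  then have P: "invertible P" and L: "subgroup ?L Osc"
    and N: "?L \<inter> H_in_Osc = at_level 0 ` aut \<eta> P ` \<Gamma> r"
    by (auto simp: framed_def)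
  have "framed (\<eta> + P *v \<zeta>) (P ** K) r s ?L"
    using framed K by (simp add: framed_def image_aut_aut invertible_mult)
  moreover have "stable_letter (\<eta> + P *v \<zeta>) (P ** K) s (H_lin (matrix_inv K) w) \<in> ?L"
  proof -
    have "H_lin K (H_lin (matrix_inv K) w) = w"
      by (simp add: H_lin_eq_aut aut_aut matrix_inv_cancel[OF K(1)])
    then have "stable_letter (\<eta> + P *v \<zeta>) (P ** K) s (H_lin (matrix_inv K) w) =
        stable_letter (\<eta> + P *v \<zeta>) P s w"
      by (simp add: stable_letter_matrix_mult)
    also have "\<dots> = stable_letter \<eta> P s ((0, \<zeta>) \<otimes>\<^bsub>Heis\<^esub> w \<otimes>\<^bsub>Heis\<^esub> (0, - (B *v \<zeta>)))"
      by (simp add: stable_letter_shift[OF P] B_def)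
    also have "(0, \<zeta>) \<otimes>\<^bsub>Heis\<^esub> w \<otimes>\<^bsub>Heis\<^esub> (0, - (B *v \<zeta>)) = inv\<^bsub>Heis\<^esub> (k, l) \<otimes>\<^bsub>Heis\<^esub> (z, \<xi>)"
      by (simp add: w_def \<omega>_def field_simps)
    also have "stable_letter \<eta> P s \<dots> = at_level 0 (aut \<eta> P (inv\<^bsub>Heis\<^esub> (k, l))) \<otimes>\<^bsub>Osc\<^esub> stable_letter \<eta> P s (z, \<xi>)"
      by (rule at_level_0_mult_stable_letter[symmetric])
    also have "\<dots> \<in> ?L"
    proof (rule subgroup.m_closed[OF L])
      show "at_level 0 (aut \<eta> P (inv\<^bsub>Heis\<^esub> (k, l))) \<in> ?L"
        using N subgroup.m_inv_closed[OF subgroup_\<Gamma>[OF r] kl] by blast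
      show "stable_letter \<eta> P s (z, \<xi>) \<in> ?L"
        unfolding x' L_of_eq_generate by (rule generate.incl) simp
    qed
    finally show ?thesis .
  qed
  ultimately show "act s x g \<in> \<P> r s" "L_of r s (act s x g) = L_of r s x"
    unfolding act by (rule framed_eq_L_of, rule framed_eq_L_of(2)[symmetric])
qed

text \<open>Equal subgroups have the same intersection with \<open>H\<close>, which makes the change of frame an element
  \<open>(\<zeta>, K)\<close> of \<open>\<B> r\<close>. They also have the same elements of level \<open>s\<close>, so the two stable letters differ by an
  element of \<open>L \<inter> H\<close>; the \<open>\<Gamma> r\<close>-component of the acting element is the inverse of that element, in the
  coordinates of the first frame.\<close>

lemma L_of_eq_imp_act:
  assumes r: "r > 0" and s: "s > 0" and x: "x \<in> \<P> r s" and y: "y \<in> \<P> r s"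
    and eq: "L_of r s x = L_of r s y"
  shows "\<exists>g \<in> carrier (\<Gamma>\<B> r). y = act s x g"
proof -
  obtain \<eta> P z \<xi> where x': "x = (\<eta>, P, (z, \<xi>))" by (cases x)
  obtain \<eta>' P' h' where y': "y = (\<eta>', P', h')" by (cases y)
  let ?L = "L_of r s x"
  have fx: "framed \<eta> P r s ?L" and level: "{v \<in> ?L. p_Osc v = s} =
      stable_letter \<eta> P s ` (\<lambda>\<gamma>. \<gamma> \<otimes>\<^bsub>Heis\<^esub> (z, \<xi>)) ` \<Gamma> r"
    using L_of_framed[OF r s] x by (simp_all only: x')
  have fy: "framed \<eta>' P' r s ?L"
    using L_of_framed(1)[OF r s] y unfolding eq y' by blast
  have P: "invertible P" and P': "invertible P'" using fx fy by (auto simp: framed_def)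
  define \<zeta> where "\<zeta> = matrix_inv P *v (\<eta>' - \<eta>)"
  define K where "K = matrix_inv P ** P'"
  have \<eta>': "\<eta>' = \<eta> + P *v \<zeta>" by (simp add: \<zeta>_def matrix_inv_cancel[OF P])
  have PK: "P' = P ** K" by (simp add: K_def matrix_mul_assoc matrix_inv_cancel[OF P])
  have K: "invertible K" unfolding K_def by (intro invertible_mult invertible_matrix_inv P P')
  have "at_level 0 ` aut \<eta> P ` aut \<zeta> K ` \<Gamma> r = at_level 0 ` aut \<eta> P ` \<Gamma> r"
    using fx fy unfolding framed_def \<eta>' PK image_aut_aut by metis
  then have "aut \<zeta> K ` \<Gamma> r = \<Gamma> r"
    by (simp only: inj_image_eq_iff[OF inj_at_level] inj_image_eq_iff[OF inj_aut[OF P]])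
  then have B: "(\<zeta>, K) \<in> \<B> r" using K by (simp add: \<B>_iff)
  define B where "B = conj_exp s P"
  have "stable_letter \<eta>' P' s h' \<in> ?L"
    unfolding eq y' L_of_eq_generate by (rule generate.incl) simp
  then have "stable_letter \<eta>' P' s h' \<in> {v \<in> ?L. p_Osc v = s}" by simp
  then obtain \<gamma> where \<gamma>: "\<gamma> \<in> \<Gamma> r" "stable_letter \<eta>' P' s h' = stable_letter \<eta> P s (\<gamma> \<otimes>\<^bsub>Heis\<^esub> (z, \<xi>))"
    unfolding level by blast
  have "stable_letter \<eta>' P' s h' =
      stable_letter \<eta> P s ((0, \<zeta>) \<otimes>\<^bsub>Heis\<^esub> H_lin K h' \<otimes>\<^bsub>Heis\<^esub> (0, - (B *v \<zeta>)))"
    unfolding \<eta>' PK stable_letter_matrix_mult stable_letter_shift[OF P] B_def ..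
  then have *: "(0, \<zeta>) \<otimes>\<^bsub>Heis\<^esub> H_lin K h' \<otimes>\<^bsub>Heis\<^esub> (0, - (B *v \<zeta>)) = \<gamma> \<otimes>\<^bsub>Heis\<^esub> (z, \<xi>)"
    using \<gamma>(2) injD[OF inj_stable_letter[OF P]] by metis
  obtain k l where kl: "inv\<^bsub>Heis\<^esub> \<gamma> = (k, l)" by (cases "inv\<^bsub>Heis\<^esub> \<gamma>")
  have "H_lin K h' = (0, - \<zeta>) \<otimes>\<^bsub>Heis\<^esub> ((0, \<zeta>) \<otimes>\<^bsub>Heis\<^esub> H_lin K h' \<otimes>\<^bsub>Heis\<^esub> (0, - (B *v \<zeta>))) \<otimes>\<^bsub>Heis\<^esub> (0, B *v \<zeta>)"
    by (cases "H_lin K h'") (simp add: \<omega>_def field_simps)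
  also have "\<dots> = (0, - \<zeta>) \<otimes>\<^bsub>Heis\<^esub> (\<gamma> \<otimes>\<^bsub>Heis\<^esub> (z, \<xi>)) \<otimes>\<^bsub>Heis\<^esub> (0, B *v \<zeta>)"
    by (simp only: *)
  also have "\<dots> = (0, - \<zeta>) \<otimes>\<^bsub>Heis\<^esub> inv\<^bsub>Heis\<^esub> (k, l) \<otimes>\<^bsub>Heis\<^esub> (z, \<xi>) \<otimes>\<^bsub>Heis\<^esub> (0, B *v \<zeta>)"
    by (simp only: kl[symmetric] Heis.inv_inv Heis.m_assoc carrier_Heis UNIV_I)
  finally have w: "H_lin K h' = (0, - \<zeta>) \<otimes>\<^bsub>Heis\<^esub> inv\<^bsub>Heis\<^esub> (k, l) \<otimes>\<^bsub>Heis\<^esub> (z, \<xi>) \<otimes>\<^bsub>Heis\<^esub> (0, B *v \<zeta>)" .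
  have "h' = H_lin (matrix_inv K) (H_lin K h')"
    by (simp add: H_lin_eq_aut aut_aut matrix_inv_cancel[OF K])
  then have "y = act s x ((k, l), (\<zeta>, K))"
    unfolding y' x' act_def w \<eta>' PK B_def by simp
  moreover have "((k, l), (\<zeta>, K)) \<in> carrier (\<Gamma>\<B> r)"
    using B subgroup.m_inv_closed[OF subgroup_\<Gamma>[OF r] \<gamma>(1)] by (simp add: \<Gamma>\<B>_def kl)
  ultimately show ?thesis by blast
qed

section \<open>Framed subgroups are lattices\<close>

lemma countable_discrete:
  fixes S :: "'a::second_countable_topology set"
  assumes "discrete S" shows "countable S"
proof -
  obtain B :: "'a set set" where B: "countable B" "topological_basis B"
    using ex_countable_basis by blast
  have "S \<subseteq> (\<lambda>U. THE x. U \<inter> S = {x}) ` B"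
  proof
    fix x assume x: "x \<in> S"
    then obtain T where T: "open T" "T \<inter> S = {x}"
      using assms by (meson discreteD isolated_inE)
    then obtain U where U: "U \<in> B" "x \<in> U" "U \<subseteq> T"
      using topological_basisE[OF B(2) T(1), of x] by blast
    then have "U \<inter> S = {x}" using T x by blast
    then have "(THE x. U \<inter> S = {x}) = x" by auto
    then show "x \<in> (\<lambda>U. THE x. U \<inter> S = {x}) ` B" using U(1) by force
  qed
  then show ?thesis using B(1) by (meson countable_image countable_subset)
qed

lemma (in semitopological_group) discrete_subgroupI:
  assumes L: "subgroup L G" and U: "open U" "U \<inter> L = {\<one>}"
  shows "discrete L"
proof (rule discreteI)
  fix x assume x: "x \<in> L"
  show "x isolated_in L"
  proof (rule isolated_inI[OF x])
    show "open ((\<lambda>y. inv x \<otimes> y) -` U)" by (intro open_vimage U continuous_left)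
    show "(\<lambda>y. inv x \<otimes> y) -` U \<inter> L = {x}"
    proof (intro equalityI subsetI)
      fix y assume y: "y \<in> (\<lambda>y. inv x \<otimes> y) -` U \<inter> L"
      then have "inv x \<otimes> y \<in> U \<inter> L"
        using x subgroup.m_closed[OF L] subgroup.m_inv_closed[OF L] by blast
      then have "inv x \<otimes> y = \<one>" using U by blast
      then have "x \<otimes> (inv x \<otimes> y) = x" by simp
      then show "y \<in> {x}" by (simp flip: m_assoc)
    next
      fix y assume "y \<in> {x}"
      then show "y \<in> (\<lambda>y. inv x \<otimes> y) -` U \<inter> L" using x U by auto
    qed
  qed
qed

lemma invertible_matrix_preimage:
  fixes P :: mat2
  assumes "invertible P"
  obtains m where "\<xi> = P *v m"
  using matrix_inv_cancel(4)[OF assms] by metis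

lemma framed_level_zero:
  assumes L: "framed \<eta> P r s L" and x: "x \<in> L" "\<bar>p_Osc x\<bar> < s"
  shows "p_Osc x = 0"
proof -
  have s: "s > 0" and p: "p_Osc ` L = {s * of_int n | n::int. True}"
    using L by (auto simp: framed_def)
  have "p_Osc x \<in> p_Osc ` L" using x(1) by (rule imageI)
  then obtain n :: int where n: "p_Osc x = s * of_int n" unfolding p by auto
  then have "\<bar>real_of_int n\<bar> < 1" using x(2) s by (simp add: abs_mult)
  then have "n = 0" by linarith
  then show ?thesis using n by simp
qed

lemma framed_central_part:
  assumes L: "framed \<eta> P r s L" and x: "(z, P *v m, t) \<in> L"
    and t: "\<bar>t\<bar> < s" and m: "\<bar>m$1\<bar> < 1" "\<bar>m$2\<bar> < 1"
  obtains k :: int where "z = det P * of_int k / real r" "m = 0" "t = 0"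
proof -
  have P: "invertible P" and H: "L \<inter> H_in_Osc = at_level 0 ` aut \<eta> P ` \<Gamma> r"
    using L by (auto simp: framed_def)
  have t0: "t = 0" using framed_level_zero[OF L x] t by simp
  then have "(z, P *v m, t) \<in> at_level 0 ` aut \<eta> P ` \<Gamma> r"
    using x unfolding H[symmetric] by (simp add: mem_H_in_Osc)
  then obtain v where v: "v \<in> \<Gamma> r" "(z, P *v m) = aut \<eta> P v"
    by (auto simp: at_level_def t0)
  obtain a b k where k: "v = (1/2 * of_int a * of_int b + of_int k / real r, vector [of_int a, of_int b])"
    using v(1) by (rule \<Gamma>_memE)
  have "P *v m = P *v vector [of_int a, of_int b]" using v(2) k by simp
  then have m': "m = vector [of_int a, of_int b]"
    by (metis matrix_inv_cancel(3)[OF P])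
  then have "\<bar>real_of_int a\<bar> < 1" "\<bar>real_of_int b\<bar> < 1" using m by simp_all
  then have "a = 0" "b = 0" by linarith+
  moreover have "vector [0, 0] = (0 :: vec2)" by (simp add: vec_eq_iff forall_2)
  ultimately have "m = 0" "z = det P * of_int k / real r"
    using m' v(2) k by (simp_all add: \<omega>_linear)
  then show thesis using t0 that by blast
qed

lemma framed_discrete:
  assumes L: "framed \<eta> P r s L"
  shows "discrete L"
proof (rule Osc.discrete_subgroupI)
  have r: "r > 0" and s: "s > 0" and P: "invertible P" and sub: "subgroup L Osc"
    using L by (auto simp: framed_def)
  define c where "c = \<bar>det P\<bar> / real r"
  have c: "c > 0" using r P[unfolded invertible_det_nz] by (simp add: c_def)
  define Q where "Q = matrix_inv P"
  define U :: "osc set" where "U = {(z, \<xi>, t). \<bar>z\<bar> < c \<and> \<bar>(Q *v \<xi>)$1\<bar> < 1 \<and> \<bar>(Q *v \<xi>)$2\<bar> < 1 \<and> \<bar>t\<bar> < s}"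
  have "U = {x. \<bar>fst x\<bar> < c} \<inter> {x. \<bar>(Q *v fst (snd x))$1\<bar> < 1} \<inter>
     {x. \<bar>(Q *v fst (snd x))$2\<bar> < 1} \<inter> {x. \<bar>snd (snd x)\<bar> < s}"
    by (auto simp: U_def)
  also have "open \<dots>"
    by (intro open_Int open_Collect_less continuous_intros
        continuous_on_compose2[OF matrix_vector_mult_linear_continuous_on[of UNIV Q]]) auto
  finally show "open U" .
  show "U \<inter> L = {\<one>\<^bsub>Osc\<^esub>}"
  proof (intro equalityI subsetI)
    fix x assume x: "x \<in> U \<inter> L"
    obtain z \<xi> t where x': "x = (z, \<xi>, t)" by (cases x)
    obtain m where m: "\<xi> = P *v m" using invertible_matrix_preimage[OF P] .
    have Qm: "Q *v \<xi> = m" by (simp add: m Q_def matrix_inv_cancel[OF P])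
    obtain k :: int where k: "z = det P * of_int k / real r" "m = 0" "t = 0"
      using framed_central_part[OF L, of z m t] x by (auto simp: x' U_def Qm m[symmetric])
    have "\<bar>z\<bar> = c * \<bar>of_int k\<bar>" by (simp add: k c_def abs_mult)
    then have "c * \<bar>of_int k\<bar> < c * 1" using x by (simp add: x' U_def)
    then have "\<bar>real_of_int k\<bar> < 1" using c by (simp only: mult_less_cancel_left_pos)
    then have "k = 0" by linarith
    then show "x \<in> {\<one>\<^bsub>Osc\<^esub>}" by (simp add: x' k m)
  qed (use c s subgroup.one_closed[OF sub] in \<open>auto simp: U_def\<close>)
  show "subgroup L Osc" by (rule sub)
qed

text \<open>A fundamental domain: \<open>t \<in> [0, s)\<close>, the coordinates of \<open>\<xi>\<close> with respect to the columns of \<open>P\<close> in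
  \<open>[0, 1)\<close>, and \<open>z \<in> [0, c)\<close>, where \<open>c \<int>\<close> is the intersection of the subgroup with the centre. An element is
  moved into it by correcting first \<open>t\<close>, then \<open>\<xi>\<close>, then \<open>z\<close>.\<close>

lemma framed_is_lattice:
  assumes L: "framed \<eta> P r s L"
  shows "is_lattice Osc L"
proof -
  have r: "r > 0" and s: "s > 0" and P: "invertible P" and sub: "subgroup L Osc"
    and H: "L \<inter> H_in_Osc = at_level 0 ` aut \<eta> P ` \<Gamma> r"
    and p: "p_Osc ` L = {s * of_int n | n::int. True}"
    using L by (auto simp: framed_def)
  have disc: "discrete L" by (rule framed_discrete[OF L])
  define c where "c = \<bar>det P\<bar> / real r"
  have c: "c > 0" using r P[unfolded invertible_det_nz] by (simp add: c_def)
  define Q where "Q = matrix_inv P"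
  have QP: "Q *v (P *v m) = m" for m by (simp add: Q_def matrix_inv_cancel[OF P])
  define F :: "osc set" where "F = {(z, \<xi>, t). 0 \<le> z \<and> z < c \<and> 0 \<le> (Q *v \<xi>)$1 \<and> (Q *v \<xi>)$1 < 1 \<and>
     0 \<le> (Q *v \<xi>)$2 \<and> (Q *v \<xi>)$2 < 1 \<and> 0 \<le> t \<and> t < s}"
  have F_iff: "(z, P *v m, t) \<in> F \<longleftrightarrow>
      0 \<le> z \<and> z < c \<and> 0 \<le> m$1 \<and> m$1 < 1 \<and> 0 \<le> m$2 \<and> m$2 < 1 \<and> 0 \<le> t \<and> t < s" for z m t
    by (simp add: F_def QP)
  have cont_Q: "continuous_on UNIV (\<lambda>x::osc. (Q *v fst (snd x)) $ i)" for i
    by (intro continuous_intros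
        continuous_on_compose2[OF matrix_vector_mult_linear_continuous_on[of UNIV Q]]) auto
  have F_borel: "F \<in> sets borel"
  proof -
    have [measurable]: "(\<lambda>x::osc. (Q *v fst (snd x)) $ i) \<in> borel_measurable borel" for i
      by (intro borel_measurable_continuous_onI cont_Q)
    have [measurable]: "(\<lambda>x::osc. fst x) \<in> borel_measurable borel" "(\<lambda>x::osc. snd (snd x)) \<in> borel_measurable borel"
      by (intro borel_measurable_continuous_onI continuous_intros)+
    have "F = {x \<in> space borel. 0 \<le> fst x \<and> fst x < c \<and> 0 \<le> (Q *v fst (snd x)) $ 1 \<and> (Q *v fst (snd x)) $ 1 < 1 \<and>
      0 \<le> (Q *v fst (snd x)) $ 2 \<and> (Q *v fst (snd x)) $ 2 < 1 \<and> 0 \<le> snd (snd x) \<and> snd (snd x) < s}"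
      by (auto simp: F_def)
    also have "\<dots> \<in> sets borel" by measurable
    finally show ?thesis .
  qed
  have "F \<subseteq> {0..c} \<times> ((\<lambda>m. P *v m) ` cbox 0 1 \<times> {0..s})"
  proof
    fix x assume x: "x \<in> F"
    obtain z \<xi> t where x': "x = (z, \<xi>, t)" by (cases x)
    obtain m where m: "\<xi> = P *v m" using invertible_matrix_preimage[OF P] .
    show "x \<in> {0..c} \<times> ((\<lambda>m. P *v m) ` cbox 0 1 \<times> {0..s})"
      using x by (auto simp: x' m F_iff mem_box_cart forall_2 intro!: imageI)
  qed
  moreover have "compact ({0..c} \<times> ((\<lambda>m. P *v m) ` cbox 0 1 \<times> {0..s}))"
    by (intro compact_Times compact_continuous_image matrix_vector_mult_linear_continuous_on) auto
  ultimately have "bounded F"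
    using bounded_subset compact_imp_bounded by blast
  then have F_fin: "emeasure lborel F \<noteq> \<infinity>"
    using emeasure_bounded_finite[of F] by simp
  have F_pos: "emeasure lborel F \<noteq> 0"
  proof
    assume "emeasure lborel F = 0"
    then have "F \<in> null_sets lborel" using F_borel by auto
    then have neg: "negligible F"
      by (simp add: negligible_iff_null_sets null_sets_completionI)
    define V :: "osc set" where "V = {x. 0 < fst x} \<inter> {x. fst x < c} \<inter> {x. 0 < (Q *v fst (snd x)) $ 1} \<inter>
      {x. (Q *v fst (snd x)) $ 1 < 1} \<inter> {x. 0 < (Q *v fst (snd x)) $ 2} \<inter> {x. (Q *v fst (snd x)) $ 2 < 1}
      \<inter> {x. 0 < snd (snd x)} \<inter> {x. snd (snd x) < s}"
    have "open V" unfolding V_def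
      by (intro open_Int open_Collect_less cont_Q continuous_intros)
    moreover have "V \<subseteq> F" by (auto simp: V_def F_def)
    moreover have "(c / 2, P *v (vector [1/2, 1/2]), s / 2) \<in> V"
      using c s by (simp add: V_def QP)
    ultimately show False
      using neg negligible_subset open_not_negligible by blast
  qed
  have tiling: "\<exists>!l. l \<in> L \<and> l \<otimes>\<^bsub>Osc\<^esub> g \<in> F" for g
  proof (rule ex_ex1I)
    obtain z \<xi> t where g: "g = (z, \<xi>, t)" by (cases g)
    have "s * of_int (- \<lfloor>t / s\<rfloor>) \<in> p_Osc ` L" unfolding p by blast
    then obtain l1 where l1: "l1 \<in> L" "p_Osc l1 = s * of_int (- \<lfloor>t / s\<rfloor>)" by auto
    obtain z1 \<xi>1 t1 where g1: "l1 \<otimes>\<^bsub>Osc\<^esub> g = (z1, \<xi>1, t1)" by (cases "l1 \<otimes>\<^bsub>Osc\<^esub> g")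
    have "t1 = p_Osc (l1 \<otimes>\<^bsub>Osc\<^esub> g)" by (simp only: g1 p_Osc_apply)
    then have "t1 = t - s * of_int \<lfloor>t / s\<rfloor>" using l1(2) by (simp add: g)
    then have "t1 = s * frac (t / s)" using s by (simp add: frac_def right_diff_distrib)
    then have t1: "0 \<le> t1" "t1 < s" using s frac_lt_1[of "t / s"] by simp_all
    obtain m where m: "\<xi>1 = P *v m" using invertible_matrix_preimage[OF P] .
    define a b where "a = - \<lfloor>m$1\<rfloor>" and "b = - \<lfloor>m$2\<rfloor>"
    define v where "v k = aut \<eta> P (1/2 * of_int a * of_int b + of_int k / real r, vector [of_int a, of_int b])" for k :: int
    have v: "at_level 0 (v k) \<in> L" for k
      using H \<Gamma>_memI[of a b k r] unfolding v_def by blast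
    define z2 where "z2 = fst (v 0) + z1 + 1/2 * \<omega> (snd (v 0)) \<xi>1"
    define m2 where "m2 = vector [of_int a, of_int b] + m"
    have vg: "at_level 0 (v k) \<otimes>\<^bsub>Osc\<^esub> (z1, \<xi>1, t1) = (det P * of_int k / real r + z2, P *v m2, t1)" for k
      by (simp add: v_def at_level_def z2_def m2_def m matrix_vector_right_distrib algebra_simps)
    have m2: "0 \<le> m2$1" "m2$1 < 1" "0 \<le> m2$2" "m2$2 < 1"
      by (simp_all add: m2_def a_def b_def) linarith+
    \<comment> \<open>the generator \<open>det P / r\<close> of the central part may be \<open>- c\<close>, hence the sign\<close>
    define k where "k = (if det P > 0 then 1 else -1) * (- \<lfloor>z2 / c\<rfloor>)"
    have "det P * of_int k / real r = - c * of_int \<lfloor>z2 / c\<rfloor>"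
      using P[unfolded invertible_det_nz] by (auto simp: k_def c_def)
    then have "det P * of_int k / real r + z2 = c * frac (z2 / c)"
      using c by (simp add: frac_def field_simps)
    then have "0 \<le> det P * of_int k / real r + z2" "det P * of_int k / real r + z2 < c"
      using c frac_lt_1[of "z2 / c"] by simp_all
    then have "at_level 0 (v k) \<otimes>\<^bsub>Osc\<^esub> (l1 \<otimes>\<^bsub>Osc\<^esub> g) \<in> F"
      unfolding g1 vg using m2 t1 by (simp only: F_iff)
    moreover have "at_level 0 (v k) \<otimes>\<^bsub>Osc\<^esub> l1 \<in> L"
      using v l1(1) by (rule subgroup.m_closed[OF sub])
    ultimately show "\<exists>l. l \<in> L \<and> l \<otimes>\<^bsub>Osc\<^esub> g \<in> F"
      by (intro exI[of _ "at_level 0 (v k) \<otimes>\<^bsub>Osc\<^esub> l1"]) (simp only: Osc.m_assoc carrier_Osc UNIV_I)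
  next
    fix l l' assume l: "l \<in> L \<and> l \<otimes>\<^bsub>Osc\<^esub> g \<in> F" and l': "l' \<in> L \<and> l' \<otimes>\<^bsub>Osc\<^esub> g \<in> F"
    define d where "d = l' \<otimes>\<^bsub>Osc\<^esub> inv\<^bsub>Osc\<^esub> l"
    have d: "d \<in> L" unfolding d_def
      using l l' subgroup.m_closed[OF sub] subgroup.m_inv_closed[OF sub] by blast
    have d_mult: "d \<otimes>\<^bsub>Osc\<^esub> (l \<otimes>\<^bsub>Osc\<^esub> g) = l' \<otimes>\<^bsub>Osc\<^esub> g"
    proof -
      have "d \<otimes>\<^bsub>Osc\<^esub> (l \<otimes>\<^bsub>Osc\<^esub> g) = l' \<otimes>\<^bsub>Osc\<^esub> (inv\<^bsub>Osc\<^esub> l \<otimes>\<^bsub>Osc\<^esub> l) \<otimes>\<^bsub>Osc\<^esub> g"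
        by (simp only: d_def Osc.m_assoc carrier_Osc UNIV_I)
      then show ?thesis by (simp only: Osc.l_inv Osc.r_one carrier_Osc UNIV_I)
    qed
    obtain z1 \<xi>1 t1 where g1: "l \<otimes>\<^bsub>Osc\<^esub> g = (z1, \<xi>1, t1)" by (cases "l \<otimes>\<^bsub>Osc\<^esub> g")
    obtain z2 \<xi>2 t2 where g2: "l' \<otimes>\<^bsub>Osc\<^esub> g = (z2, \<xi>2, t2)" by (cases "l' \<otimes>\<^bsub>Osc\<^esub> g")
    obtain m1 where m1: "\<xi>1 = P *v m1" using invertible_matrix_preimage[OF P] .
    obtain m2 where m2: "\<xi>2 = P *v m2" using invertible_matrix_preimage[OF P] .
    have F1: "0 \<le> z1 \<and> z1 < c \<and> 0 \<le> m1$1 \<and> m1$1 < 1 \<and> 0 \<le> m1$2 \<and> m1$2 < 1 \<and> 0 \<le> t1 \<and> t1 < s"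
      using l by (simp only: g1 m1 F_iff)
    have F2: "0 \<le> z2 \<and> z2 < c \<and> 0 \<le> m2$1 \<and> m2$1 < 1 \<and> 0 \<le> m2$2 \<and> m2$2 < 1 \<and> 0 \<le> t2 \<and> t2 < s"
      using l' by (simp only: g2 m2 F_iff)
    obtain z \<xi> t where d': "d = (z, \<xi>, t)" by (cases d)
    have eq: "z + z1 + 1/2 * \<omega> \<xi> (boost t *v (P *v m1)) = z2"
      "\<xi> + boost t *v (P *v m1) = P *v m2" "t + t1 = t2"
      using d_mult unfolding g1 g2 d' m1 m2 by simp_all
    have "\<bar>t\<bar> < s" using eq(3) F1 F2 by linarith
    then have t0: "t = 0" using framed_level_zero[OF L d] by (simp add: d')
    have "\<xi> = P *v (m2 - m1)"
      using eq(2) by (simp add: t0 matrix_vector_mult_diff_distrib algebra_simps)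
    then obtain k :: int where k: "z = det P * of_int k / real r" "m2 - m1 = 0"
      using framed_central_part[OF L, of z "m2 - m1" t] d F1 F2 s by (auto simp: d' t0 abs_less_iff)
    have "\<bar>z2 - z1\<bar> < c * 1" using F1 F2 by (simp add: abs_less_iff)
    moreover have "z2 - z1 = z"
      using eq(1) \<open>\<xi> = _\<close> k(2) by (simp add: \<omega>_linear)
    moreover have "\<bar>z\<bar> = c * \<bar>of_int k\<bar>" by (simp add: k(1) c_def abs_mult)
    ultimately have "c * \<bar>of_int k\<bar> < c * 1" by simp
    then have "\<bar>real_of_int k\<bar> < 1" using c by (simp only: mult_less_cancel_left_pos)
    then have "k = 0" by linarith
    then have "d = \<one>\<^bsub>Osc\<^esub>" using \<open>\<xi> = _\<close> k by (simp add: d' t0)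
    then have "l' = l"
      unfolding d_def by (metis Osc.inv_solve_right Osc.l_one UNIV_I carrier_Osc)
    then show "l = l'" ..
  qed
  show ?thesis
    unfolding is_lattice_def
    using sub disc Osc.finite_invariant_measure_from_fundamental_domain[OF sub
        countable_discrete[OF disc] F_borel tiling sets_lborel F_pos F_fin
        lborel_Osc_left_invariant lborel_Osc_right_invariant]
    by blast
qed

section \<open>Every lattice is framed\<close>

lemma additive_subgroup_int_multiple:
  fixes S :: "'a::real_vector set"
  assumes "0 \<in> S" "\<And>x y. x \<in> S \<Longrightarrow> y \<in> S \<Longrightarrow> x - y \<in> S" and x: "x \<in> S"
  shows "of_int k *\<^sub>R x \<in> S"
proof -
  have neg: "- y \<in> S" if "y \<in> S" for y using assms(2)[OF assms(1) that] by simp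
  have add: "y + x \<in> S" if "y \<in> S" for y using assms(2)[OF that neg[OF x]] by simp
  have nat: "of_nat n *\<^sub>R x \<in> S" for n
    by (induction n) (auto simp: assms(1) scaleR_add_left add.commute dest: add)
  show ?thesis
    using nat neg[OF nat] by (cases k rule: int_cases2) auto
qed

text \<open>A positive element \<open>x\<close> with \<open>\<lfloor>x / e\<rfloor>\<close> minimal is the least positive element: two elements with the
  same value of \<open>\<lfloor>x / e\<rfloor>\<close> differ by less than \<open>e\<close>.\<close>

lemma discrete_real_subgroup_cyclic:
  fixes S :: "real set"
  assumes S: "0 \<in> S" "\<And>x y. x \<in> S \<Longrightarrow> y \<in> S \<Longrightarrow> x - y \<in> S"
    and e: "e > 0" "\<And>x. x \<in> S \<Longrightarrow> \<bar>x\<bar> < e \<Longrightarrow> x = 0"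
    and x0: "x0 \<in> S" "x0 \<noteq> 0"
  obtains c where "c > 0" "S = {c * of_int n | n::int. True}"
proof -
  have "\<bar>x0\<bar> \<in> S" using S(1) S(2)[OF S(1) x0(1)] x0(1) by (auto simp: abs_if)
  then have "\<exists>x. x \<in> S \<and> x > 0" using x0(2) by (intro exI[of _ "\<bar>x0\<bar>"]) simp
  then obtain c where c: "c \<in> S" "c > 0"
    and min: "\<And>y. y \<in> S \<and> y > 0 \<Longrightarrow> nat \<lfloor>c / e\<rfloor> \<le> nat \<lfloor>y / e\<rfloor>"
    using ex_has_least_nat[of "\<lambda>x. x \<in> S \<and> x > 0" _ "\<lambda>x. nat \<lfloor>x / e\<rfloor>"] by blast
  have least: "c \<le> y" if y: "y \<in> S" "y > 0" for y
  proof (rule ccontr)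
    assume "\<not> c \<le> y"
    then have "y / e < c / e" using e(1) by (simp add: divide_strict_right_mono)
    moreover have "0 \<le> \<lfloor>c / e\<rfloor>" "0 \<le> \<lfloor>y / e\<rfloor>" using c y e(1) by simp_all
    then have "\<lfloor>c / e\<rfloor> \<le> \<lfloor>y / e\<rfloor>"
      using min[of y] y nat_le_eq_zle[of "\<lfloor>c / e\<rfloor>" "\<lfloor>y / e\<rfloor>"] by blast
    ultimately have "c / e - y / e < 1" by linarith
    then have "c - y < e" using e(1) by (simp add: field_simps)
    then have "\<bar>c - y\<bar> < e" using \<open>\<not> c \<le> y\<close> by simp
    then have "c - y = 0" using e(2) S(2)[OF c(1) y(1)] by blast
    then show False using \<open>\<not> c \<le> y\<close> by simp
  qed
  have mult: "c * of_int n \<in> S" for n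
    using additive_subgroup_int_multiple[OF S c(1), of n] by (simp add: mult.commute)
  have "\<exists>n::int. x = c * of_int n" if x: "x \<in> S" for x
  proof -
    have "x - c * of_int \<lfloor>x / c\<rfloor> \<in> S" by (rule S(2)[OF x mult])
    moreover have "x - c * of_int \<lfloor>x / c\<rfloor> = c * frac (x / c)"
      using c(2) by (simp add: frac_def right_diff_distrib)
    moreover have "c * frac (x / c) < c" using c(2) frac_lt_1[of "x / c"] by simp
    ultimately have "\<not> c * frac (x / c) > 0" using least[of "c * frac (x / c)"] by (metis not_le)
    then have "c * frac (x / c) = 0" using c(2) frac_ge_0[of "x / c"] by (simp add: zero_less_mult_iff)
    then have "x = c * of_int \<lfloor>x / c\<rfloor>" using \<open>x - _ = c * frac (x / c)\<close> by linarith
    then show ?thesis by blast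
  qed
  then have "S = {c * of_int n | n::int. True}" using mult by blast
  then show thesis using c(2) that by blast
qed

text \<open>Recurrence along \<open>(0, 0, 3 n)\<close>, for \<open>U\<close> given by \<open>\<bar>t\<bar> < 1\<close>: an element that maps one translate into
  another has level at least \<open>3 - 2\<close> in absolute value.\<close>

lemma lattice_not_in_H:
  assumes L: "subgroup L Osc" and \<mu>: "finite_invariant_measure Osc L \<mu>"
  obtains \<gamma> where "\<gamma> \<in> L" "p_Osc \<gamma> \<noteq> 0"
proof -
  define U :: "osc set" where "U = {x. \<bar>snd (snd x)\<bar> < 1}"
  have "open U" unfolding U_def by (intro open_Collect_less continuous_intros)
  moreover have "(0, 0, 0) \<in> U" by (simp add: U_def)
  ultimately obtain i j l u v where ij: "i \<noteq> j" "l \<in> L" "u \<in> U" "v \<in> U"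
    and eq: "l \<otimes>\<^bsub>Osc\<^esub> (v \<otimes>\<^bsub>Osc\<^esub> (0, 0, 3 * real j)) = u \<otimes>\<^bsub>Osc\<^esub> (0, 0, 3 * real i)"
    using Osc.recurrence[OF L \<mu>, of U "\<lambda>n. (0, 0, 3 * real n)"] by blast
  have "p_Osc (l \<otimes>\<^bsub>Osc\<^esub> (v \<otimes>\<^bsub>Osc\<^esub> (0, 0, 3 * real j))) = p_Osc (u \<otimes>\<^bsub>Osc\<^esub> (0, 0, 3 * real i))"
    by (simp only: eq)
  then have "p_Osc l = p_Osc u - p_Osc v + 3 * (real i - real j)" by simp
  moreover have "\<bar>p_Osc u\<bar> < 1" "\<bar>p_Osc v\<bar> < 1"
    using ij by (auto simp: U_def p_Osc_def case_prod_beta)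
  moreover have "real i - real j \<ge> 1 \<or> real i - real j \<le> - 1" using ij(1) by linarith
  ultimately have "p_Osc l \<noteq> 0" by (auto simp: abs_less_iff)
  then show thesis using ij(2) that by blast
qed

text \<open>For \<open>\<sigma> = 1\<close> and \<open>\<sigma> = -1\<close> these are the two eigencoordinates of \<open>A\<close>. Hence \<open>(z, \<xi>, t)\<close> acts
  on the line by the affine map with slope \<open>e\<^sup>\<sigma>\<^sup>t\<close> and constant term \<open>eigen \<sigma> \<xi>\<close>, and this is a group action.\<close>

definition eigen :: "real \<Rightarrow> vec2 \<Rightarrow> real" where
  "eigen \<sigma> \<xi> = \<xi>$1 + \<sigma> * \<xi>$2"

lemma eigen_add [simp]: "eigen \<sigma> (x + y) = eigen \<sigma> x + eigen \<sigma> y"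
  by (simp add: eigen_def algebra_simps)

lemma eigen_boost:
  assumes "\<sigma> = 1 \<or> \<sigma> = - 1"
  shows "eigen \<sigma> (boost t *v x) = exp (\<sigma> * t) * eigen \<sigma> x"
proof -
  have e: "exp t = cosh t + sinh t" "exp (- t) = cosh t - sinh t"
    by (simp_all add: cosh_plus_sinh cosh_minus_sinh)
  show ?thesis using assms by (auto simp: eigen_def e algebra_simps)
qed

text \<open>The hypothesis says that \<open>c\<close> is a common fixed point of the affine maps given by the elements of \<open>L\<close>, so
  that their constant terms are bounded as long as \<open>\<bar>t\<bar> < 2\<close>. But recurrence along \<open>(0, (M n, 0), 0)\<close> yields such
  elements with arbitrarily large constant terms.\<close>

lemma lattice_no_affine_fixed_point:
  assumes L: "subgroup L Osc" and \<mu>: "finite_invariant_measure Osc L \<mu>"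
    and \<sigma>: "\<sigma> = 1 \<or> \<sigma> = - 1"
    and conj: "\<And>z \<xi> t. (z, \<xi>, t) \<in> L \<Longrightarrow> eigen \<sigma> \<xi> = c * (1 - exp (\<sigma> * t))"
  shows False
proof -
  \<comment> \<open>\<open>M\<close> outweighs the bound on all other terms even after multiplication by \<open>exp (- 1) \<le> exp (\<sigma> * tu)\<close>\<close>
  define M where "M = exp 1 * ((1 + \<bar>c\<bar>) * (1 + exp 2) + 1)"
  define U :: "osc set" where "U = {x. \<bar>eigen \<sigma> (fst (snd x))\<bar> < 1} \<inter> {x. \<bar>snd (snd x)\<bar> < 1}"
  have "open U" unfolding U_def eigen_def by (intro open_Int open_Collect_less continuous_intros)
  moreover have "(0, 0, 0) \<in> U" by (simp add: U_def eigen_def)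
  ultimately obtain i j l u v where ij: "i \<noteq> j" "l \<in> L" "u \<in> U" "v \<in> U"
    and eq: "l \<otimes>\<^bsub>Osc\<^esub> (v \<otimes>\<^bsub>Osc\<^esub> (0, vector [M * real j, 0], 0)) = u \<otimes>\<^bsub>Osc\<^esub> (0, vector [M * real i, 0], 0)"
    using Osc.recurrence[OF L \<mu>, of U "\<lambda>n. (0, vector [M * real n, 0], 0)"] by blast
  obtain z \<xi> t where l: "l = (z, \<xi>, t)" by (cases l)
  obtain zu \<xi>u tu where u: "u = (zu, \<xi>u, tu)" by (cases u)
  obtain zv \<xi>v tv where v: "v = (zv, \<xi>v, tv)" by (cases v)
  have bounds: "\<bar>eigen \<sigma> \<xi>u\<bar> < 1" "\<bar>eigen \<sigma> \<xi>v\<bar> < 1" "\<bar>tu\<bar> < 1" "\<bar>tv\<bar> < 1"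
    using ij by (simp_all add: U_def u v)
  have t: "t = tu - tv" using eq by (simp add: l u v)
  have "\<xi> + boost t *v (\<xi>v + boost tv *v vector [M * real j, 0]) = \<xi>u + boost tu *v vector [M * real i, 0]"
    using eq by (simp add: l u v)
  then have "eigen \<sigma> (\<xi> + boost t *v (\<xi>v + boost tv *v vector [M * real j, 0])) =
      eigen \<sigma> (\<xi>u + boost tu *v vector [M * real i, 0])" by simp
  moreover have "eigen \<sigma> (vector [x, 0]) = x" for x by (simp add: eigen_def)
  ultimately have "eigen \<sigma> \<xi> + exp (\<sigma> * t) * (eigen \<sigma> \<xi>v + exp (\<sigma> * tv) * (M * real j)) =
      eigen \<sigma> \<xi>u + exp (\<sigma> * tu) * (M * real i)"
    by (simp add: eigen_boost[OF \<sigma>])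
  moreover have "exp (\<sigma> * t) * exp (\<sigma> * tv) = exp (\<sigma> * tu)"
    by (simp add: t right_diff_distrib flip: exp_add)
  ultimately have *: "exp (\<sigma> * tu) * (M * (real i - real j)) =
      c * (1 - exp (\<sigma> * t)) + exp (\<sigma> * t) * eigen \<sigma> \<xi>v - eigen \<sigma> \<xi>u"
    using conj[of z \<xi> t] ij(2) l by (simp add: algebra_simps)
  have t2: "exp (\<sigma> * t) \<le> exp 2"
    using \<sigma> bounds(3,4) by (auto simp: t)
  have "\<bar>1 - exp (\<sigma> * t)\<bar> \<le> 1 + exp 2"
    using t2 exp_gt_zero[of "\<sigma> * t"] by linarith
  then have "\<bar>c * (1 - exp (\<sigma> * t))\<bar> \<le> \<bar>c\<bar> * (1 + exp 2)"
    unfolding abs_mult by (intro mult_left_mono) auto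
  moreover have "\<bar>exp (\<sigma> * t) * eigen \<sigma> \<xi>v\<bar> \<le> exp 2 * 1"
    unfolding abs_mult using t2 bounds(2) by (intro mult_mono) auto
  ultimately have upper: "\<bar>exp (\<sigma> * tu) * (M * (real i - real j))\<bar> \<le> (1 + \<bar>c\<bar>) * (1 + exp 2)"
    unfolding * using bounds(1) by (simp add: algebra_simps)
  have M: "M > 0" unfolding M_def by (intro mult_pos_pos add_nonneg_pos) auto
  have "exp (- 1) * (M * 1) \<le> exp (\<sigma> * tu) * (M * \<bar>real i - real j\<bar>)"
  proof (intro mult_mono mult_left_mono)
    show "exp (- 1) \<le> exp (\<sigma> * tu)" using \<sigma> bounds(3) by auto
    show "1 \<le> \<bar>real i - real j\<bar>" using ij(1) by linarith
  qed (use M in auto)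
  also have "\<dots> = \<bar>exp (\<sigma> * tu) * (M * (real i - real j))\<bar>"
    using M by (simp add: abs_mult)
  also note upper
  also have "exp (- 1) * (M * 1) = (1 + \<bar>c\<bar>) * (1 + exp 2) + 1"
    by (simp add: M_def exp_minus)
  finally show False by simp
qed

definition H_proj :: "osc set \<Rightarrow> vec2 set" where
  "H_proj L = {\<xi>. \<exists>z. (z, \<xi>, 0) \<in> L}"

lemma H_proj_zero:
  assumes "subgroup L Osc" shows "0 \<in> H_proj L"
  using subgroup.one_closed[OF assms] by (auto simp: H_proj_def)

lemma H_proj_diff:
  assumes L: "subgroup L Osc" and "\<xi> \<in> H_proj L" "\<xi>' \<in> H_proj L"
  shows "\<xi> - \<xi>' \<in> H_proj L"
proof -
  obtain z z' where z: "(z, \<xi>, 0) \<in> L" "(z', \<xi>', 0) \<in> L" using assms by (auto simp: H_proj_def)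
  have "(z, \<xi>, 0) \<otimes>\<^bsub>Osc\<^esub> inv\<^bsub>Osc\<^esub> (z', \<xi>', 0) \<in> L"
    using z subgroup.m_closed[OF L] subgroup.m_inv_closed[OF L] by blast
  then show ?thesis by (auto simp: H_proj_def)
qed

lemma H_proj_boost:
  assumes L: "subgroup L Osc" and \<xi>: "\<xi> \<in> H_proj L" and l: "l \<in> L"
  shows "boost (p_Osc l) *v \<xi> \<in> H_proj L"
proof -
  obtain z where z: "(z, \<xi>, 0) \<in> L" using \<xi> by (auto simp: H_proj_def)
  obtain w \<zeta> t where l': "l = (w, \<zeta>, t)" by (cases l)
  have "boost t *v (- (boost (- t) *v \<zeta>)) = - \<zeta>"
    by (simp add: matrix_vector_mult_uminus)
  moreover have "l \<otimes>\<^bsub>Osc\<^esub> (z, \<xi>, 0) \<otimes>\<^bsub>Osc\<^esub> inv\<^bsub>Osc\<^esub> l \<in> L"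
    using z l subgroup.m_closed[OF L] subgroup.m_inv_closed[OF L] by blast
  ultimately show ?thesis by (auto simp: H_proj_def l')
qed

lemma \<omega>_boost_self: "\<omega> x (boost t *v x) = sinh t * (eigen 1 x * eigen (- 1) x)"
  by (simp add: \<omega>_def eigen_def algebra_simps)

text \<open>Take \<open>\<gamma> \<in> L\<close> of level \<open>t\<^sub>0 \<noteq> 0\<close>. If \<open>\<omega>\<close> vanishes on the projection of \<open>L \<inter> H\<close>, then, since the projection
  is invariant under \<open>boost t\<^sub>0\<close>, it lies in an eigenline of \<open>A\<close>, so one eigencoordinate vanishes on it. All
  commutators of \<open>L\<close> lie in \<open>L \<inter> H\<close>, so the image of \<open>L\<close> in the corresponding affine group is abelian. The
  slope of the image of \<open>\<gamma>\<close> is not \<open>1\<close>, so it has exactly one fixed point. The whole image of \<open>L\<close> fixes this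
  point, which \<open>lattice_no_affine_fixed_point\<close> excludes.\<close>

lemma lattice_H_proj_nondegenerate:
  assumes L: "subgroup L Osc" and \<mu>: "finite_invariant_measure Osc L \<mu>"
  obtains x y where "x \<in> H_proj L" "y \<in> H_proj L" "\<omega> x y > 0"
proof -
  obtain \<gamma> where \<gamma>: "\<gamma> \<in> L" "p_Osc \<gamma> \<noteq> 0" using lattice_not_in_H[OF L \<mu>] .
  obtain z0 \<xi>0 t0 where \<gamma>': "\<gamma> = (z0, \<xi>0, t0)" by (cases \<gamma>)
  have t0: "t0 \<noteq> 0" using \<gamma>(2) by (simp add: \<gamma>')
  have "\<exists>x \<in> H_proj L. \<exists>y \<in> H_proj L. \<omega> x y \<noteq> 0"
  proof (rule ccontr)
    assume "\<not> ?thesis"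
    then have degenerate: "\<omega> x y = 0" if "x \<in> H_proj L" "y \<in> H_proj L" for x y
      using that by blast
    have eigenvector: "eigen 1 x = 0 \<or> eigen (- 1) x = 0" if "x \<in> H_proj L" for x
      using degenerate[OF that H_proj_boost[OF L that \<gamma>(1)]] t0 by (simp add: \<gamma>' \<omega>_boost_self)
    obtain \<sigma> where \<sigma>: "\<sigma> = 1 \<or> \<sigma> = - 1" "\<And>x. x \<in> H_proj L \<Longrightarrow> eigen \<sigma> x = 0"
    proof (cases "\<forall>x \<in> H_proj L. eigen 1 x = 0")
      case True
      then show thesis using that[of 1] by simp
    next
      case False
      then obtain x where x: "x \<in> H_proj L" "eigen 1 x \<noteq> 0" by blast
      then have x12: "x$1 = x$2" using eigenvector[OF x(1)] by (simp add: eigen_def)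
      have "eigen (- 1) y = 0" if "y \<in> H_proj L" for y
      proof -
        have "x$1 * (y$2 - y$1) = 0"
          using degenerate[OF x(1) that] x12 by (simp add: \<omega>_def algebra_simps)
        then show ?thesis using x(2) x12 by (simp add: eigen_def)
      qed
      then show thesis using that[of "- 1"] by simp
    qed
    define c where "c = eigen \<sigma> \<xi>0 / (1 - exp (\<sigma> * t0))"
    have nz: "1 - exp (\<sigma> * t0) \<noteq> 0" using \<sigma>(1) t0 by auto
    show False
    proof (rule lattice_no_affine_fixed_point[OF L \<mu> \<sigma>(1), where c = c])
      fix z \<xi> t assume l: "(z, \<xi>, t) \<in> L"
      define \<kappa> where "\<kappa> = \<gamma> \<otimes>\<^bsub>Osc\<^esub> (z, \<xi>, t) \<otimes>\<^bsub>Osc\<^esub> inv\<^bsub>Osc\<^esub> ((z, \<xi>, t) \<otimes>\<^bsub>Osc\<^esub> \<gamma>)"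
      have "\<kappa> \<in> L" unfolding \<kappa>_def
        using \<gamma>(1) l subgroup.m_closed[OF L] subgroup.m_inv_closed[OF L] by blast
      have eq: "\<kappa> \<otimes>\<^bsub>Osc\<^esub> ((z, \<xi>, t) \<otimes>\<^bsub>Osc\<^esub> \<gamma>) = \<gamma> \<otimes>\<^bsub>Osc\<^esub> (z, \<xi>, t)"
        unfolding \<kappa>_def by (simp only: Osc.m_assoc Osc.m_closed Osc.l_inv Osc.r_one carrier_Osc UNIV_I)
      obtain zk \<xi>k tk where k: "\<kappa> = (zk, \<xi>k, tk)" by (cases \<kappa>)
      have tk: "tk = 0" using eq by (simp add: k \<gamma>')
      then have "eigen \<sigma> \<xi>k = 0" using \<open>\<kappa> \<in> L\<close> \<sigma>(2) by (auto simp: k H_proj_def)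
      moreover have "\<xi>k + (\<xi> + boost t *v \<xi>0) = \<xi>0 + boost t0 *v \<xi>"
        using eq by (simp add: k \<gamma>' tk)
      then have "eigen \<sigma> (\<xi>k + (\<xi> + boost t *v \<xi>0)) = eigen \<sigma> (\<xi>0 + boost t0 *v \<xi>)"
        by simp
      ultimately have "eigen \<sigma> \<xi> * (1 - exp (\<sigma> * t0)) = eigen \<sigma> \<xi>0 * (1 - exp (\<sigma> * t))"
        by (simp add: eigen_boost[OF \<sigma>(1)] algebra_simps)
      then show "eigen \<sigma> \<xi> = c * (1 - exp (\<sigma> * t))"
        using nz by (simp add: c_def field_simps)
    qed
  qed
  then obtain x y where xy: "x \<in> H_proj L" "y \<in> H_proj L" "\<omega> x y \<noteq> 0" by blast
  show thesis
  proof (cases "\<omega> x y > 0")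
    case True then show ?thesis using xy that by blast
  next
    case False
    then have "\<omega> y x > 0" using xy(3) \<omega>_swap[of y x] by simp
    then show ?thesis using xy that by blast
  qed
qed

lemma \<omega>_H_proj_central:
  assumes L: "subgroup L Osc" and "x \<in> H_proj L" "y \<in> H_proj L"
  shows "(\<omega> x y, 0, 0) \<in> L"
proof -
  obtain z w where zw: "(z, x, 0) \<in> L" "(w, y, 0) \<in> L" using assms by (auto simp: H_proj_def)
  have "(z, x, 0) \<otimes>\<^bsub>Osc\<^esub> (w, y, 0) \<otimes>\<^bsub>Osc\<^esub> inv\<^bsub>Osc\<^esub> ((w, y, 0) \<otimes>\<^bsub>Osc\<^esub> (z, x, 0)) \<in> L"
    using zw subgroup.m_closed[OF L] subgroup.m_inv_closed[OF L] by blast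
  also have "(z, x, 0) \<otimes>\<^bsub>Osc\<^esub> (w, y, 0) \<otimes>\<^bsub>Osc\<^esub> inv\<^bsub>Osc\<^esub> ((w, y, 0) \<otimes>\<^bsub>Osc\<^esub> (z, x, 0)) = (\<omega> x y, 0, 0)"
    by (simp add: \<omega>_def algebra_simps)
  finally show ?thesis .
qed

lemma lattice_center_cyclic:
  assumes L: "subgroup L Osc" and disc: "discrete L" and \<mu>: "finite_invariant_measure Osc L \<mu>"
  obtains c where "c > 0" "{z. (z, 0, 0) \<in> L} = {c * of_int n | n::int. True}"
proof -
  have "\<one>\<^bsub>Osc\<^esub> isolated_in L"
    using disc subgroup.one_closed[OF L] by (rule discreteD)
  then obtain e where e: "e > 0" "\<And>y. y \<in> L \<Longrightarrow> dist (0, 0, 0) y < e \<Longrightarrow> y = (0, 0, 0)"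
    unfolding isolated_in_dist_Ex_iff by auto
  obtain x y where xy: "x \<in> H_proj L" "y \<in> H_proj L" "\<omega> x y > 0"
    using lattice_H_proj_nondegenerate[OF L \<mu>] .
  show thesis
  proof (rule discrete_real_subgroup_cyclic[of "{z. (z, 0, 0) \<in> L}" e "\<omega> x y"])
    show "0 \<in> {z. (z, 0, 0) \<in> L}" using subgroup.one_closed[OF L] by simp
    show "a - b \<in> {z. (z, 0, 0) \<in> L}" if "a \<in> {z. (z, 0, 0) \<in> L}" "b \<in> {z. (z, 0, 0) \<in> L}" for a b
    proof -
      have "(a, 0, 0) \<otimes>\<^bsub>Osc\<^esub> inv\<^bsub>Osc\<^esub> (b, 0, 0) \<in> L"
        using that subgroup.m_closed[OF L] subgroup.m_inv_closed[OF L] by blast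
      then show ?thesis by (simp add: \<omega>_linear)
    qed
    show "a = 0" if "a \<in> {z. (z, 0, 0) \<in> L}" "\<bar>a\<bar> < e" for a
      using e(2)[of "(a, 0, 0)"] that by (simp add: dist_Pair_Pair dist_real_def)
    show "\<omega> x y \<in> {z. (z, 0, 0) \<in> L}" using \<omega>_H_proj_central[OF L xy(1,2)] by simp
  qed (use e(1) xy(3) that in auto)
qed

lemma cramer: "\<omega> a b *\<^sub>R x = \<omega> x b *\<^sub>R a + \<omega> a x *\<^sub>R b"
  by (simp add: vec_eq_iff forall_2 \<omega>_def algebra_simps)

text \<open>By \<open>\<omega>_H_proj_central\<close>, \<open>\<omega>\<close> takes values in \<open>c \<int>\<close> on the projection. Hence there is a pair \<open>a\<close>, \<open>b\<close> for
  which \<open>\<omega> a b\<close> is positive and minimal. If the coefficient of \<open>x\<close> at \<open>a\<close> (Cramer's rule) had a fractional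
  part \<open>q > 0\<close>, then subtracting an integer multiple of \<open>a\<close> from \<open>x\<close> would give the smaller value \<open>q \<omega> a b\<close>.\<close>

lemma lattice_H_proj_basis:
  assumes L: "subgroup L Osc" and disc: "discrete L" and \<mu>: "finite_invariant_measure Osc L \<mu>"
  obtains a b c r where "a \<in> H_proj L" "b \<in> H_proj L" "c > 0" "r > 0" "\<omega> a b = c * real r"
    "{z. (z, 0, 0) \<in> L} = {c * of_int n | n::int. True}"
    "\<forall>x \<in> H_proj L. \<exists>m n::int. x = of_int m *\<^sub>R a + of_int n *\<^sub>R b"
proof -
  obtain c where c: "c > 0" "{z. (z, 0, 0) \<in> L} = {c * of_int n | n::int. True}"
    using lattice_center_cyclic[OF L disc \<mu>] .
  have \<omega>_int: "\<exists>n::int. \<omega> x y = c * of_int n" if "x \<in> H_proj L" "y \<in> H_proj L" for x y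
    using \<omega>_H_proj_central[OF L that] c(2) by blast
  define Q where "Q v \<longleftrightarrow> fst v \<in> H_proj L \<and> snd v \<in> H_proj L \<and> \<omega> (fst v) (snd v) > 0" for v
  define f where "f v = nat \<lfloor>\<omega> (fst v) (snd v) / c\<rfloor>" for v
  obtain x0 y0 where "x0 \<in> H_proj L" "y0 \<in> H_proj L" "\<omega> x0 y0 > 0"
    using lattice_H_proj_nondegenerate[OF L \<mu>] .
  then have "Q (x0, y0)" by (simp add: Q_def)
  then obtain v where v: "Q v" "\<And>v'. Q v' \<Longrightarrow> f v \<le> f v'"
    using ex_has_least_nat[of Q _ f] by blast
  define a b where "a = fst v" and "b = snd v"
  have a: "a \<in> H_proj L" and b: "b \<in> H_proj L" and pos: "\<omega> a b > 0"
    using v(1) by (simp_all add: Q_def a_def b_def)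
  have fc: "\<omega> x y = c * real (f (x, y))" if xy: "x \<in> H_proj L" "y \<in> H_proj L" "\<omega> x y > 0" for x y
  proof -
    obtain n :: int where n: "\<omega> x y = c * of_int n" using \<omega>_int xy by blast
    then have "n > 0" using xy(3) c(1) by (simp add: zero_less_mult_iff)
    then show ?thesis using c(1) by (simp add: f_def n)
  qed
  have least: "\<omega> a b \<le> \<omega> x y" if xy: "x \<in> H_proj L" "y \<in> H_proj L" "\<omega> x y > 0" for x y
  proof -
    have "f (a, b) \<le> f (x, y)" using v(2)[of "(x, y)"] xy by (simp add: Q_def a_def b_def)
    then show ?thesis using fc[OF a b pos] fc[OF xy] c(1) by simp
  qed
  have int_mult: "of_int k *\<^sub>R x \<in> H_proj L" if "x \<in> H_proj L" for k x
    using additive_subgroup_int_multiple[OF H_proj_zero[OF L] H_proj_diff[OF L] that] .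
  have integral: "q = of_int \<lfloor>q\<rfloor>" if "x \<in> H_proj L" "y \<in> H_proj L" "\<omega> x y = frac q * \<omega> a b" for q x y
  proof (rule ccontr)
    assume "q \<noteq> of_int \<lfloor>q\<rfloor>"
    then have "frac q \<noteq> 0" by (simp add: frac_def)
    then have "frac q > 0" using frac_ge_0[of q] by linarith
    then have "\<omega> x y > 0" using pos that(3) by simp
    then have "\<omega> a b \<le> frac q * \<omega> a b" using least that by metis
    moreover have "frac q * \<omega> a b < 1 * \<omega> a b"
      using frac_lt_1[of q] pos by (intro mult_strict_right_mono)
    ultimately show False by simp
  qed
  have span: "\<exists>m n::int. x = of_int m *\<^sub>R a + of_int n *\<^sub>R b" if x: "x \<in> H_proj L" for x
  proof -
    define p q where "p = \<omega> x b / \<omega> a b" and "q = \<omega> a x / \<omega> a b"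
    have "p = of_int \<lfloor>p\<rfloor>"
    proof (rule integral)
      show "x - of_int \<lfloor>p\<rfloor> *\<^sub>R a \<in> H_proj L" by (intro H_proj_diff[OF L] x int_mult a)
      show "\<omega> (x - of_int \<lfloor>p\<rfloor> *\<^sub>R a) b = frac p * \<omega> a b"
        using pos by (simp add: \<omega>_linear frac_def left_diff_distrib p_def)
    qed (rule b)
    moreover have "q = of_int \<lfloor>q\<rfloor>"
    proof (rule integral[OF a])
      show "x - of_int \<lfloor>q\<rfloor> *\<^sub>R b \<in> H_proj L" by (intro H_proj_diff[OF L] x int_mult b)
      show "\<omega> a (x - of_int \<lfloor>q\<rfloor> *\<^sub>R b) = frac q * \<omega> a b"
        using pos by (simp add: \<omega>_linear frac_def left_diff_distrib q_def)
    qed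
    moreover have "x = p *\<^sub>R a + q *\<^sub>R b"
    proof -
      have "\<omega> a b *\<^sub>R x = \<omega> a b *\<^sub>R (p *\<^sub>R a + q *\<^sub>R b)"
        using pos by (simp add: cramer[of a b x] p_def q_def scaleR_add_right)
      then show ?thesis using pos by simp
    qed
    ultimately show ?thesis by metis
  qed
  have "real (f (a, b)) > 0" using fc[OF a b pos] pos c(1) by (simp add: zero_less_mult_iff)
  then show thesis using that[OF a b c(1) _ fc[OF a b pos] c(2)] span by simp
qed

lemma trace_boost: "\<omega> (boost t *v a) b + \<omega> a (boost t *v b) = 2 * cosh t * \<omega> a b"
  by (simp add: \<omega>_def algebra_simps)

lemma Heis_int_pow: "(0, \<xi>) [^]\<^bsub>Heis\<^esub> (k::int) = (0, of_int k *\<^sub>R \<xi>)"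
proof -
  have nat: "(0, \<xi>) [^]\<^bsub>Heis\<^esub> n = (0, real n *\<^sub>R \<xi>)" for n :: nat
    by (induction n) (simp_all add: \<omega>_linear scaleR_add_left add.commute)
  show ?thesis
  proof (cases k rule: int_cases2)
    case (nonneg n)
    then show ?thesis by (simp only: int_pow_int nat of_int_of_nat_eq)
  next
    case (nonpos n)
    have "(0, \<xi>) [^]\<^bsub>Heis\<^esub> (- int n) = inv\<^bsub>Heis\<^esub> ((0, \<xi>) [^]\<^bsub>Heis\<^esub> n)"
      by (rule Heis.int_pow_neg_int) simp
    then show ?thesis unfolding nonpos by (simp add: nat)
  qed
qed

text \<open>The frame: \<open>a\<close> and \<open>b\<close> are the columns of \<open>P\<close>, and \<open>\<eta>\<close> is chosen such that \<open>aut \<eta> P\<close> maps \<open>(0, e\<^sub>1)\<close>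
  and \<open>(0, e\<^sub>2)\<close> to lifts of \<open>a\<close> and \<open>b\<close> in \<open>L\<close>. The central parts agree because \<open>det P / r = \<omega> a b / r = c\<close>.\<close>

lemma lattice_H_part:
  assumes L: "subgroup L Osc" and a: "a \<in> H_proj L" and b: "b \<in> H_proj L"
    and c: "c > 0" and r: "r > 0" and ab: "\<omega> a b = c * real r"
    and center: "{z. (z, 0, 0) \<in> L} = {c * of_int n | n::int. True}"
    and span: "\<forall>x \<in> H_proj L. \<exists>m n::int. x = of_int m *\<^sub>R a + of_int n *\<^sub>R b"
  obtains \<eta> P where "invertible P" "L \<inter> H_in_Osc = at_level 0 ` aut \<eta> P ` \<Gamma> r"
proof -
  obtain z1 z2 where z: "(z1, a, 0) \<in> L" "(z2, b, 0) \<in> L"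
    using a b by (auto simp: H_proj_def)
  define P :: mat2 where "P = vector [vector [a$1, b$1], vector [a$2, b$2]]"
  define \<eta> where "\<eta> = (1 / \<omega> a b) *\<^sub>R (z2 *\<^sub>R a - z1 *\<^sub>R b)"
  have D: "\<omega> a b > 0" using c r ab by simp
  have det: "det P = \<omega> a b" by (simp add: P_def det_2 \<omega>_def)
  then have P: "invertible P" using D by (simp add: invertible_det_nz)
  have Pv: "P *v vector [x, y] = x *\<^sub>R a + y *\<^sub>R b" for x y
    by (simp add: P_def vec_eq_iff forall_2 matrix_vector_mult_def sum_2)
  have \<eta>: "\<omega> \<eta> a = z1" "\<omega> \<eta> b = z2"
    using D \<omega>_swap[of b a] by (simp_all add: \<eta>_def \<omega>_linear)
  define S where "S = {v. at_level 0 (aut \<eta> P v) \<in> L}"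
  have S: "subgroup S Heis"
  proof (rule Heis.subgroupI)
    have "at_level 0 (aut \<eta> P (0, 0)) = \<one>\<^bsub>Osc\<^esub>" by (simp add: at_level_def \<omega>_linear)
    then have "(0, 0) \<in> S" using subgroup.one_closed[OF L] by (simp only: S_def mem_Collect_eq)
    then show "S \<noteq> {}" by blast
  next
    fix x y assume xy: "x \<in> S" "y \<in> S"
    show "x \<otimes>\<^bsub>Heis\<^esub> y \<in> S"
      using xy subgroup.m_closed[OF L] unfolding S_def mem_Collect_eq aut_mult at_level_mult[symmetric] by blast
  next
    fix x assume x: "x \<in> S"
    have "at_level 0 (aut \<eta> P (inv\<^bsub>Heis\<^esub> x)) = inv\<^bsub>Osc\<^esub> (at_level 0 (aut \<eta> P x))"
    proof (rule Osc.inv_equality[symmetric])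
      have "at_level 0 (aut \<eta> P (inv\<^bsub>Heis\<^esub> x)) \<otimes>\<^bsub>Osc\<^esub> at_level 0 (aut \<eta> P x) =
          at_level 0 (aut \<eta> P (inv\<^bsub>Heis\<^esub> x \<otimes>\<^bsub>Heis\<^esub> x))"
        by (simp only: at_level_mult aut_mult)
      also have "\<dots> = \<one>\<^bsub>Osc\<^esub>"
        by (simp only: Heis.l_inv carrier_Heis UNIV_I) (simp add: at_level_def \<omega>_linear)
      finally show "at_level 0 (aut \<eta> P (inv\<^bsub>Heis\<^esub> x)) \<otimes>\<^bsub>Osc\<^esub> at_level 0 (aut \<eta> P x) = \<one>\<^bsub>Osc\<^esub>" .
    qed simp_all
    then show "inv\<^bsub>Heis\<^esub> x \<in> S"
      using x subgroup.m_inv_closed[OF L] unfolding S_def mem_Collect_eq by (simp only:)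
  qed simp
  have gens: "(0, vector [1, 0]) \<in> S" "(0, vector [0, 1]) \<in> S"
    using z by (simp_all add: S_def at_level_def Pv \<eta>)
  have "(of_int k / real r, 0) \<in> S" for k
  proof -
    have "(c * of_int k, 0, 0) \<in> L" using center by blast
    moreover have "\<omega> a b * (of_int k / real r) = c * of_int k" using r by (simp add: ab)
    ultimately show ?thesis by (simp add: S_def at_level_def det \<omega>_linear)
  qed
  moreover have "(0, of_int m *\<^sub>R \<xi>) \<in> S" if "(0, \<xi>) \<in> S" for m :: int and \<xi>
    using Heis.subgroup_int_pow_closed[OF S that, of m] by (simp add: Heis_int_pow)
  moreover have "(1/2 * of_int m * of_int n + of_int k / real r, vector [of_int m, of_int n]) =
     (0, of_int m *\<^sub>R vector [1, 0]) \<otimes>\<^bsub>Heis\<^esub> (0, of_int n *\<^sub>R vector [0, 1]) \<otimes>\<^bsub>Heis\<^esub> (of_int k / real r, 0)"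
    for m n k :: int
    by (simp add: \<omega>_def vec_eq_iff forall_2)
  ultimately have mem_S: "(1/2 * of_int m * of_int n + of_int k / real r, vector [of_int m, of_int n]) \<in> S"
    for m n k :: int
    using gens subgroup.m_closed[OF S] by metis
  have "L \<inter> H_in_Osc = at_level 0 ` aut \<eta> P ` \<Gamma> r"
  proof (intro equalityI subsetI)
    fix x assume "x \<in> at_level 0 ` aut \<eta> P ` \<Gamma> r"
    then obtain v where v: "v \<in> \<Gamma> r" "x = at_level 0 (aut \<eta> P v)" by blast
    then have "v \<in> S" using mem_S by (metis \<Gamma>_memE)
    then show "x \<in> L \<inter> H_in_Osc" by (simp add: S_def v mem_H_in_Osc)
  next
    fix x assume x: "x \<in> L \<inter> H_in_Osc"
    then obtain z \<xi> where x': "x = (z, \<xi>, 0)" by (cases x) (auto simp: mem_H_in_Osc)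
    then have "\<xi> \<in> H_proj L" using x by (auto simp: H_proj_def)
    then obtain m n :: int where mn: "\<xi> = of_int m *\<^sub>R a + of_int n *\<^sub>R b" using span by blast
    define v where "v k = (1/2 * of_int m * of_int n + of_int k / real r, vector [of_int m, of_int n] :: vec2)" for k :: int
    define w where "w = fst (aut \<eta> P (v 0))"
    have v0: "at_level 0 (aut \<eta> P (v 0)) = (w, \<xi>, 0)"
      by (simp add: w_def v_def at_level_def Pv mn)
    have "at_level 0 (aut \<eta> P (v 0)) \<in> L"
      using mem_S[of m n 0] unfolding S_def v_def mem_Collect_eq .
    then have "(w, \<xi>, 0) \<in> L" by (simp only: v0)
    then have "(z, \<xi>, 0) \<otimes>\<^bsub>Osc\<^esub> inv\<^bsub>Osc\<^esub> (w, \<xi>, 0) \<in> L"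
      using x x' subgroup.m_closed[OF L] subgroup.m_inv_closed[OF L] by blast
    then have "(z - w, 0, 0) \<in> L" by (simp add: \<omega>_linear)
    then obtain k :: int where k: "z - w = c * of_int k" using center by blast
    have "at_level 0 (aut \<eta> P (v k)) = (w + c * of_int k, \<xi>, 0)"
      using r by (simp add: w_def v_def at_level_def Pv mn det ab field_simps)
    then have "x = at_level 0 (aut \<eta> P (v k))" using k by (simp add: x')
    moreover have "v k \<in> \<Gamma> r" unfolding v_def by (rule \<Gamma>_memI)
    ultimately show "x \<in> at_level 0 ` aut \<eta> P ` \<Gamma> r" by blast
  qed
  then show thesis using P that by blast
qed

text \<open>For \<open>t\<close> in the projection of \<open>L\<close> to \<open>\<real>\<close>, \<open>boost t\<close> is given by an integer matrix in the basis \<open>a\<close>, \<open>b\<close>, so its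
  trace \<open>2 cosh t\<close> is an integer. This makes the projection discrete and puts its generator into \<open>SS\<close>.\<close>

lemma lattice_imp_framed:
  assumes "is_lattice Osc L"
  obtains \<eta> P r s where "framed \<eta> P r s L" "s \<in> SS"
proof -
  obtain \<mu> where L: "subgroup L Osc" and disc: "discrete L" and \<mu>: "finite_invariant_measure Osc L \<mu>"
    using assms by (auto simp: is_lattice_def)
  obtain a b c r where a: "a \<in> H_proj L" and b: "b \<in> H_proj L" and cr: "c > 0" "r > 0" and ab: "\<omega> a b = c * real r"
    and center: "{z. (z, 0, 0) \<in> L} = {c * of_int n | n::int. True}"
    and span: "\<forall>x \<in> H_proj L. \<exists>m n::int. x = of_int m *\<^sub>R a + of_int n *\<^sub>R b"
    using lattice_H_proj_basis[OF L disc \<mu>] .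
  obtain \<eta> P where P: "invertible P" and H: "L \<inter> H_in_Osc = at_level 0 ` aut \<eta> P ` \<Gamma> r"
    using lattice_H_part[OF L a b cr ab center span] .
  have pos: "\<omega> a b > 0" using cr ab by simp
  have trace: "\<exists>n::int. 2 * cosh (p_Osc l) = of_int n" if l: "l \<in> L" for l
  proof -
    let ?t = "p_Osc l"
    obtain m n where 1: "boost ?t *v a = of_int m *\<^sub>R a + of_int n *\<^sub>R b"
      using span H_proj_boost[OF L a l] by blast
    obtain m' n' where 2: "boost ?t *v b = of_int m' *\<^sub>R a + of_int n' *\<^sub>R b"
      using span H_proj_boost[OF L b l] by blast
    have "2 * cosh ?t * \<omega> a b = of_int (m + n') * \<omega> a b"
      unfolding trace_boost[symmetric] 1 2 by (simp add: \<omega>_linear algebra_simps)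
    then have "2 * cosh ?t = of_int (m + n')" using pos by simp
    then show ?thesis by blast
  qed
  have "isCont cosh (0::real)" by (intro continuous_intros) 
  then obtain d where d: "d > 0" "\<And>t::real. \<bar>t\<bar> < d \<Longrightarrow> \<bar>cosh t - 1\<bar> < 1/2"
    unfolding continuous_at_eps_delta
    by (metis cosh_0 dist_real_def diff_zero zero_less_divide_1_iff zero_less_numeral)
  obtain \<gamma> where \<gamma>: "\<gamma> \<in> L" "p_Osc \<gamma> \<noteq> 0" using lattice_not_in_H[OF L \<mu>] .
  obtain s where s: "s > 0" "p_Osc ` L = {s * of_int n | n::int. True}"
  proof (rule discrete_real_subgroup_cyclic[of "p_Osc ` L" d "p_Osc \<gamma>"])
    have "p_Osc \<one>\<^bsub>Osc\<^esub> \<in> p_Osc ` L" using subgroup.one_closed[OF L] by (rule imageI)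
    then show "0 \<in> p_Osc ` L" by simp
    show "x - y \<in> p_Osc ` L" if "x \<in> p_Osc ` L" "y \<in> p_Osc ` L" for x y
    proof -
      obtain l l' where l: "l \<in> L" "l' \<in> L" "x = p_Osc l" "y = p_Osc l'" using \<open>x \<in> _\<close> \<open>y \<in> _\<close> by blast
      then have "p_Osc (l \<otimes>\<^bsub>Osc\<^esub> inv\<^bsub>Osc\<^esub> l') \<in> p_Osc ` L"
        using subgroup.m_closed[OF L] subgroup.m_inv_closed[OF L] by blast
      then show ?thesis by (simp add: l)
    qed
    show "t = 0" if t: "t \<in> p_Osc ` L" "\<bar>t\<bar> < d" for t
    proof (rule ccontr)
      assume "t \<noteq> 0"
      obtain n :: int where n: "2 * cosh t = of_int n" using trace t(1) by blast
      have "cosh t > 1" using \<open>t \<noteq> 0\<close> cosh_real_ge_1[of t] cosh_real_one_iff[of t] by linarith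
      then have "real_of_int n > 2" "real_of_int n < 3" using d(2)[OF t(2)] n by linarith+
      then show False by simp
    qed
  qed (use d \<gamma> that in auto)
  have "s * of_int 1 \<in> p_Osc ` L" unfolding s(2) by blast
  then obtain l where "l \<in> L" "p_Osc l = s" by auto
  then obtain n :: int where n: "2 * cosh s = of_int n" using trace by blast
  have "exp s + exp (- s) = 2 * cosh s" by (simp add: cosh_def)
  also have "\<dots> = real (nat n)" using n cosh_real_ge_1[of s] by linarith
  finally have "s \<in> SS" using s(1) by (simp add: SS_def)
  moreover have "framed \<eta> P r s L" using s cr(2) P L H by (simp add: framed_def)
  ultimately show thesis using that by blast
qed

section \<open>The classification\<close>

lemma framed_in_Lats_rs:
  assumes "framed \<eta> P r s L" shows "L \<in> Lats_rs r s"
  using framed_is_lattice[OF assms] framed_r_inv[OF assms] framed_s_inv[OF assms]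
  by (simp add: Lats_rs_def Lats_def)

lemma Lats_rs_eq_image:
  assumes "r > 0" "s > 0"
  shows "Lats_rs r s = L_of r s ` \<P> r s"
proof (intro equalityI subsetI)
  fix L assume L: "L \<in> Lats_rs r s"
  then have "is_lattice Osc L" by (simp add: Lats_rs_def Lats_def)
  then obtain \<eta> P r' s' where f: "framed \<eta> P r' s' L" by (rule lattice_imp_framed)
  have "r' = r" "s' = s"
    using L framed_r_inv[OF f] framed_s_inv[OF f] by (simp_all add: Lats_rs_def)
  then obtain h where "(\<eta>, P, h) \<in> \<P> r s" "L = L_of r s (\<eta>, P, h)"
    using framed_obtain_param[OF f] by blast
  then show "L \<in> L_of r s ` \<P> r s" by blast
next
  fix L assume "L \<in> L_of r s ` \<P> r s"
  then obtain \<eta> P h where "(\<eta>, P, h) \<in> \<P> r s" "L = L_of r s (\<eta>, P, h)" by auto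
  then show "L \<in> Lats_rs r s"
    using L_of_framed(1)[OF assms] framed_in_Lats_rs by blast
qed

lemma orbit_rel_eq_kernel:
  assumes "r > 0" "s > 0"
  shows "orbit_rel r s = {(x, y). x \<in> \<P> r s \<and> y \<in> \<P> r s \<and> L_of r s x = L_of r s y}"
  using L_of_act[OF assms] L_of_eq_imp_act[OF assms] unfolding orbit_rel_def by blast

lemma kernel_quotient_bij:
  assumes R: "R = {(x, y). x \<in> A \<and> y \<in> A \<and> f x = f y}"
  shows "\<exists>\<Phi>. bij_betw \<Phi> (A // R) (f ` A) \<and> (\<forall>x \<in> A. \<Phi> (R `` {x}) = f x)"
proof -
  define \<Phi> where "\<Phi> C = the_elem (f ` C)" for C
  have \<Phi>: "\<Phi> (R `` {x}) = f x" if "x \<in> A" for x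
  proof -
    have "f ` (R `` {x}) = {f x}" using that by (auto simp: R)
    then show ?thesis by (simp add: \<Phi>_def)
  qed
  have quotient: "A // R = (\<lambda>x. R `` {x}) ` A"
    unfolding quotient_def by blast
  have "inj_on \<Phi> (A // R)"
  proof (rule inj_onI)
    fix C D assume "C \<in> A // R" "D \<in> A // R" and eq: "\<Phi> C = \<Phi> D"
    then obtain x y where xy: "x \<in> A" "C = R `` {x}" "y \<in> A" "D = R `` {y}"
      unfolding quotient by blast
    then have "f x = f y" using eq \<Phi> by metis
    then show "C = D" using xy by (simp add: R Image_def)
  qed
  moreover have "\<Phi> ` (A // R) = f ` A"
    unfolding quotient image_image by (rule image_cong[OF refl \<Phi>])
  ultimately show ?thesis using \<Phi> unfolding bij_betw_def by blast
qed

theorem proposition6p7: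
  shows "disjoint_family_on (\<lambda>(r, s). Lats_rs r s) ({r. r > 0} \<times> SS)
       \<and> Lats = (\<Union>(r, s) \<in> {r. r > 0} \<times> SS. Lats_rs r s)
       \<and> (\<forall>r > 0. \<forall>s \<in> SS.
            \<exists>\<Phi>. bij_betw \<Phi> (\<P> r s // orbit_rel r s) (Lats_rs r s)
              \<and> (\<forall>x \<in> \<P> r s. \<Phi> (orbit_rel r s `` {x}) = L_of r s x))"
proof (intro conjI allI impI ballI)
  show "disjoint_family_on (\<lambda>(r, s). Lats_rs r s) ({r. r > 0} \<times> SS)"
    by (auto simp: disjoint_family_on_def Lats_rs_def)
  show "Lats = (\<Union>(r, s) \<in> {r. r > 0} \<times> SS. Lats_rs r s)"
  proof (intro equalityI subsetI)
    fix L assume "L \<in> Lats"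
    then have "is_lattice Osc L" by (simp add: Lats_def)
    then obtain \<eta> P r s where f: "framed \<eta> P r s L" "s \<in> SS" by (rule lattice_imp_framed)
    then have "r > 0" by (simp add: framed_def)
    then show "L \<in> (\<Union>(r, s) \<in> {r. r > 0} \<times> SS. Lats_rs r s)"
      using f framed_in_Lats_rs by blast
  qed (auto simp: Lats_rs_def)
  fix r :: nat and s assume r: "r > 0" and "s \<in> SS"
  then have s: "s > 0" by (simp add: SS_def)
  show "\<exists>\<Phi>. bij_betw \<Phi> (\<P> r s // orbit_rel r s) (Lats_rs r s)
              \<and> (\<forall>x \<in> \<P> r s. \<Phi> (orbit_rel r s `` {x}) = L_of r s x)"
    unfolding Lats_rs_eq_image[OF r s] by (rule kernel_quotient_bij[OF orbit_rel_eq_kernel[OF r s]])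
qed

end
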